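(* Let $\Gamma=(X,\mathcal E)$ be the dodecahedron graph (the distance-regular graph with $20$ vertices and intersection array $\{3,2,1,1,1;1,1,1,2,3\}$); the spectrum of its adjacency matrix $A$ is $3^1(\sqrt5)^31^50^4(-2)^4(-\sqrt5)^3$. Let $x\in X$ and $T=T(x)$. Order the three vertices of $\Gamma_1(x)$ arbitrarily, and order $\Gamma_2(x)$ as $y_1,\dots,y_6$ so that each of the pairs $\{y_1,y_2\},\{y_3,y_4\},\{y_5,y_6\}$ has a common neighbor in $\Gamma_1(x)$, and every edge inside $\Gamma_2(x)$ joins a vertex of $\{y_1,y_3,y_6\}$ to a vertex of $\{y_2,y_4,y_5\}$. Then the standard module $V=\mathbb C^X$ is an orthogonal direct sum of irreducible $T$-modules $V=W_0\oplus W_{1,a}\oplus W_{1,b}\oplus W_2$, where two summands are isomorphic if and only if they have the same type in the following list, and the data are as listed. Each listed basis is a pure basis of the module. For each summand other than $W_0$, the seed vector $\nu$ spans $E_r^*W$ (so $\dim E_r^*W=1$), where $r$ is the endpoint of the summand $W$, and is given by its essential part. Type I ($W_0$): endpoint 0, multiplicity 1, dimension 6, diameter 5, shape $(1,1,1,1,1,1)$; basis $e_0^*,\dots,e_5^*$; matrix representing $A$: $\begin{pmatrix}0&3&0&0&0&0\\1&0&2&0&0&0\\0&1&1&1&0&0\\0&0&1&1&1&0\\0&0&0&2&0&1\\0&0&0&0&3&0\end{pmatrix}$, with eigenvalues $3,\sqrt5,1,0,-2,-\sqrt5$. Type II ($W_{1,a},W_{1,b}$): endpoint 1, multiplicity 2,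 dimension 6, diameter 3, shape $(1,2,2,1)$; basis $\nu,A\nu,E_2^*A^2\nu,E_3^*A^2\nu,E_3^*A^3\nu,E_4^*A^3\nu$ (with $A\nu=E_2^*A\nu$), where $\nu=[1,-1,0]$ for $W_{1,a}$ and $\nu=[1,1,-2]$ for $W_{1,b}$; matrix representing $A$: $\begin{pmatrix}0&2&-1&0&0&0\\1&0&1&1&1&0\\0&1&0&0&1&0\\0&1&-1&1&1&0\\0&0&1&0&-1&1\\0&0&0&1&2&0\end{pmatrix}$, with eigenvalues $\sqrt5,1,1,0,-2,-\sqrt5$. Type III ($W_2$): endpoint 2, multiplicity 1, dimension 2, diameter 1, shape $(1,1)$; basis $\nu,E_3^*A\nu$, where $\nu=[1,-1,1,-1,-1,1]$; matrix representing $A$: $\begin{pmatrix}-1&1\\1&-1\end{pmatrix}$, with eigenvalues $0,-2$. Moreover $\dim T=6^2+6^2+2^2=76$.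
   Context: Let $\Gamma=(X,\mathcal E)$ be a finite undirected connected graph without loops or multiple edges, with path-length distance $d$ and diameter $D\ge1$; put $\Gamma_i(x)=\{y\in X:d(x,y)=i\}$. $\Gamma$ is distance-regular if for all $0\le h,i,j\le D$ the number $p^h_{i,j}=|\Gamma_i(y)\cap\Gamma_j(z)|$ is the same for all $y,z\in X$ with $d(y,z)=h$. Its intersection array is $\{b_0,\dots,b_{D-1};c_1,\dots,c_D\}$ with $b_i=p^i_{1,i+1}$, $c_i=p^i_{1,i-1}$. $A\in\mathrm{Mat}_X(\mathbb C)$ is the adjacency matrix; in its spectrum, exponents denote multiplicities. The standard module $V=\mathbb C^X$ (column vectors) carries the Hermitian inner product $\langle u,v\rangle=u^t\bar v$. Fix a base vertex $x\in X$. For $0\le i\le D$, $E_i^*=E_i^*(x)$ is the diagonal matrix with $(y,y)$-entry $1$ if $d(x,y)=i$ and $0$ otherwise, and $e_i^*\in V$ is the vector with $y$-entry $1$ if $d(x,y)=i$ and $0$ otherwise. The Terwilliger algebra $T=T(x)$ is the subalgebra of $\mathrm{Mat}_X(\mathbb C)$ generated by $A$ and $E_0^*,\dots,E_D^*$. A $T$-module is a subspace $W\subseteq V$ with $BW\subseteq W$ for all $B\in T$; it is irreducible if $W\ne0$ and it properly contains no nonzero $T$-module. Isomorphisms of $T$-modules are vector space isomorphisms commuting with every $B\in T$. The endpoint of $W$ is $r=\min\{i:E_i^*W\ne0\}$; the diameter of an irreducible $W$ is $\delta=|\{i:E_i^*W\ne0\}|-1$, and its shape is $(\dim E_r^*W,\dots,\dim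 E_{r+\delta}^*W)$. The multiplicity of an irreducible module is the number of summands isomorphic to it in an orthogonal decomposition of $V$ into irreducible $T$-modules. A nonzero vector is pure with support $i$ if it lies in $E_i^*V$; its essential part is the row vector of its coordinates at the vertices of $\Gamma_i(x)$, in the chosen order (all its other coordinates are $0$). A pure basis of an irreducible $T$-module is an ordered basis of pure vectors with weakly increasing supports. The matrix $B$ representing $A$ with respect to a basis $v_1,\dots,v_\ell$ is given by $Av_j=\sum_iB_{ij}v_i$. *)

theory Defs
  imports "HOL-Analysis.Analysis" "Jordan_Normal_Form.Char_Poly"
begin

(* Matrices and vectors over the vertex set are those of HOL-Analysis; Jordan_Normal_Form
   supplies only the matrices representing A with respect to a basis. *)
no_notation Matrix.vec_index (infixl \<open>$\<close> 100)

section \<open>Distance-regular graphs\<close>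

text \<open>The vertex set is a finite type, the edge relation a binary predicate on it.\<close>

definition connected_graph :: "('v \<Rightarrow> 'v \<Rightarrow> bool) \<Rightarrow> bool" where
  "connected_graph E \<longleftrightarrow> symp E \<and> irreflp E \<and> (\<forall>y z. E\<^sup>*\<^sup>* y z)"

definition gdist :: "('v \<Rightarrow> 'v \<Rightarrow> bool) \<Rightarrow> 'v \<Rightarrow> 'v \<Rightarrow> nat" where
  "gdist E y z = (LEAST n. (E ^^ n) y z)"

definition gdiam :: "('v::finite \<Rightarrow> 'v \<Rightarrow> bool) \<Rightarrow> nat" where
  "gdiam E = Max (range (\<lambda>(y, z). gdist E y z))"

definition sphere_at :: "('v \<Rightarrow> 'v \<Rightarrow> bool) \<Rightarrow> nat \<Rightarrow> 'v \<Rightarrow> 'v set" where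
  "sphere_at E i y = {z. gdist E y z = i}"

definition distance_regular :: "('v::finite \<Rightarrow> 'v \<Rightarrow> bool) \<Rightarrow> bool" where
  "distance_regular E \<longleftrightarrow> connected_graph E \<and> gdiam E \<ge> 1 \<and>
     (\<forall>h\<le>gdiam E. \<forall>i\<le>gdiam E. \<forall>j\<le>gdiam E. \<exists>p. \<forall>y z. gdist E y z = h \<longrightarrow>
        card (sphere_at E i y \<inter> sphere_at E j z) = p)"

definition intersection_number :: "('v \<Rightarrow> 'v \<Rightarrow> bool) \<Rightarrow> nat \<Rightarrow> nat \<Rightarrow> nat \<Rightarrow> nat" where
  "intersection_number E h i j =
     (THE p. \<forall>y z. gdist E y z = h \<longrightarrow> card (sphere_at E i y \<inter> sphere_at E j z) = p)"

text \<open>The pair of lists \<open>([b\<^sub>0, \<dots>, b\<^sub>D\<^sub>-\<^sub>1], [c\<^sub>1, \<dots>, c\<^sub>D])\<close>.\<close>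

definition intersection_array :: "('v::finite \<Rightarrow> 'v \<Rightarrow> bool) \<Rightarrow> nat list \<times> nat list" where
  "intersection_array E =
     (map (\<lambda>i. intersection_number E i 1 (i + 1)) [0..<gdiam E],
      map (\<lambda>i. intersection_number E i 1 (i - 1)) [1..<Suc (gdiam E)])"

definition dodecahedron_graph :: "('v::finite \<Rightarrow> 'v \<Rightarrow> bool) \<Rightarrow> bool" where
  "dodecahedron_graph E \<longleftrightarrow> distance_regular E \<and> CARD('v) = 20 \<and>
     intersection_array E = ([3, 2, 1, 1, 1], [1, 1, 1, 2, 3])"

section \<open>Matrices and the standard module\<close>

definition adj_matrix :: "('v::finite \<Rightarrow> 'v \<Rightarrow> bool) \<Rightarrow> complex^'v^'v" where
  "adj_matrix E = (\<chi> y z. if E y z then 1 else 0)"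

definition eigenspace :: "complex^'n^'n \<Rightarrow> complex \<Rightarrow> (complex^'n) set" where
  "eigenspace M \<theta> = {v. M *v v = \<theta> *s v}"

text \<open>A spectrum is given as a list of distinct eigenvalues with their (geometric) multiplicities.\<close>

definition has_spectrum :: "complex^'n^'n \<Rightarrow> (complex \<times> nat) list \<Rightarrow> bool" where
  "has_spectrum M sp \<longleftrightarrow> distinct (map fst sp) \<and>
     {\<theta>. eigenspace M \<theta> \<noteq> {0}} = fst ` set sp \<and>
     (\<forall>(\<theta>, m) \<in> set sp. vec.dim (eigenspace M \<theta>) = m)"

definition herm :: "complex^'n \<Rightarrow> complex^'n \<Rightarrow> complex" where
  "herm u v = (\<Sum>y\<in>UNIV. u $ y * cnj (v $ y))"

definition mscale :: "complex \<Rightarrow> complex^'n^'m \<Rightarrow> complex^'n^'m" where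
  "mscale c M = (\<chi> i j. c * M $ i $ j)"

global_interpretation mat_space: vector_space "mscale :: complex \<Rightarrow> complex^'n^'m \<Rightarrow> complex^'n^'m"
  by unfold_locales (simp_all add: mscale_def Finite_Cartesian_Product.vec_eq_iff algebra_simps)

section \<open>The Terwilliger algebra\<close>

definition Estar :: "('v::finite \<Rightarrow> 'v \<Rightarrow> bool) \<Rightarrow> 'v \<Rightarrow> nat \<Rightarrow> complex^'v^'v" where
  "Estar E x i = (\<chi> y z. if y = z \<and> gdist E x y = i then 1 else 0)"

definition estar :: "('v::finite \<Rightarrow> 'v \<Rightarrow> bool) \<Rightarrow> 'v \<Rightarrow> nat \<Rightarrow> complex^'v" where
  "estar E x i = (\<chi> y. if gdist E x y = i then 1 else 0)"

definition subalgebra :: "(complex^'n^'n) set \<Rightarrow> bool" where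
  "subalgebra S \<longleftrightarrow> mat_space.subspace S \<and> Finite_Cartesian_Product.mat 1 \<in> S \<and> (\<forall>M\<in>S. \<forall>N\<in>S. M ** N \<in> S)"

definition terwilliger :: "('v::finite \<Rightarrow> 'v \<Rightarrow> bool) \<Rightarrow> 'v \<Rightarrow> (complex^'v^'v) set" where
  "terwilliger E x = subalgebra hull (insert (adj_matrix E) (Estar E x ` {0..gdiam E}))"

section \<open>Modules for the Terwilliger algebra\<close>

definition T_module :: "('v::finite \<Rightarrow> 'v \<Rightarrow> bool) \<Rightarrow> 'v \<Rightarrow> (complex^'v) set \<Rightarrow> bool" where
  "T_module E x W \<longleftrightarrow> vec.subspace W \<and> (\<forall>B\<in>terwilliger E x. \<forall>w\<in>W. B *v w \<in> W)"

definition T_irreducible :: "('v::finite \<Rightarrow> 'v \<Rightarrow> bool) \<Rightarrow> 'v \<Rightarrow> (complex^'v) set \<Rightarrow> bool" where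
  "T_irreducible E x W \<longleftrightarrow> T_module E x W \<and> W \<noteq> {0} \<and>
     \<not> (\<exists>U. T_module E x U \<and> U \<noteq> {0} \<and> U \<subset> W)"

definition T_isomorphic ::
  "('v::finite \<Rightarrow> 'v \<Rightarrow> bool) \<Rightarrow> 'v \<Rightarrow> (complex^'v) set \<Rightarrow> (complex^'v) set \<Rightarrow> bool" where
  "T_isomorphic E x U W \<longleftrightarrow>
     (\<exists>\<phi>. bij_betw \<phi> U W \<and>
        (\<forall>u\<in>U. \<forall>v\<in>U. \<phi> (u + v) = \<phi> u + \<phi> v) \<and>
        (\<forall>c. \<forall>u\<in>U. \<phi> (c *s u) = c *s \<phi> u) \<and>
        (\<forall>B\<in>terwilliger E x. \<forall>u\<in>U. \<phi> (B *v u) = B *v \<phi> u))"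

definition orthogonal_decomposition ::
  "('v::finite \<Rightarrow> 'v \<Rightarrow> bool) \<Rightarrow> 'v \<Rightarrow> (complex^'v) set list \<Rightarrow> bool" where
  "orthogonal_decomposition E x Ws \<longleftrightarrow>
     (\<forall>W\<in>set Ws. T_irreducible E x W) \<and>
     (\<forall>i<length Ws. \<forall>j<length Ws. i \<noteq> j \<longrightarrow> (\<forall>u\<in>Ws ! i. \<forall>v\<in>Ws ! j. herm u v = 0)) \<and>
     (\<forall>v. \<exists>!ws. length ws = length Ws \<and> (\<forall>i<length Ws. ws ! i \<in> Ws ! i) \<and> v = sum_list ws)"

definition multiplicity_in_V :: "('v::finite \<Rightarrow> 'v \<Rightarrow> bool) \<Rightarrow> 'v \<Rightarrow> (complex^'v) set \<Rightarrow> nat" where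
  "multiplicity_in_V E x W =
     (THE m. \<forall>Ws. orthogonal_decomposition E x Ws \<longrightarrow> length (filter (T_isomorphic E x W) Ws) = m)"

definition EstarW ::
  "('v::finite \<Rightarrow> 'v \<Rightarrow> bool) \<Rightarrow> 'v \<Rightarrow> nat \<Rightarrow> (complex^'v) set \<Rightarrow> (complex^'v) set" where
  "EstarW E x i W = (\<lambda>w. Estar E x i *v w) ` W"

definition endpoint :: "('v::finite \<Rightarrow> 'v \<Rightarrow> bool) \<Rightarrow> 'v \<Rightarrow> (complex^'v) set \<Rightarrow> nat" where
  "endpoint E x W = (LEAST i. EstarW E x i W \<noteq> {0})"

definition mod_diameter :: "('v::finite \<Rightarrow> 'v \<Rightarrow> bool) \<Rightarrow> 'v \<Rightarrow> (complex^'v) set \<Rightarrow> nat" where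
  "mod_diameter E x W = card {i. i \<le> gdiam E \<and> EstarW E x i W \<noteq> {0}} - 1"

definition shape :: "('v::finite \<Rightarrow> 'v \<Rightarrow> bool) \<Rightarrow> 'v \<Rightarrow> (complex^'v) set \<Rightarrow> nat list" where
  "shape E x W = map (\<lambda>i. vec.dim (EstarW E x i W))
     [endpoint E x W ..< Suc (endpoint E x W + mod_diameter E x W)]"

definition pure_vector :: "('v::finite \<Rightarrow> 'v \<Rightarrow> bool) \<Rightarrow> 'v \<Rightarrow> nat \<Rightarrow> complex^'v \<Rightarrow> bool" where
  "pure_vector E x i v \<longleftrightarrow> v \<noteq> 0 \<and> v \<in> EstarW E x i UNIV"

text \<open>The coordinates of a vector at the vertices \<open>ys\<close>, in the order of that list.\<close>

definition essential_part :: "'v list \<Rightarrow> complex^'v \<Rightarrow> complex list" where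
  "essential_part ys v = map (\<lambda>y. v $ y) ys"

definition pure_basis ::
  "('v::finite \<Rightarrow> 'v \<Rightarrow> bool) \<Rightarrow> 'v \<Rightarrow> (complex^'v) set \<Rightarrow> (complex^'v) list \<Rightarrow> bool" where
  "pure_basis E x W vs \<longleftrightarrow>
     distinct vs \<and> vec.independent (set vs) \<and> vec.span (set vs) = W \<and>
     (\<exists>is. length is = length vs \<and> sorted is \<and>
        (\<forall>k<length vs. is ! k \<le> gdiam E \<and> pure_vector E x (is ! k) (vs ! k)))"

definition represents :: "complex^'n^'n \<Rightarrow> (complex^'n) list \<Rightarrow> complex mat \<Rightarrow> bool" where
  "represents M vs B \<longleftrightarrow> B \<in> carrier_mat (length vs) (length vs) \<and>
     (\<forall>j<length vs. M *v (vs ! j) = (\<Sum>i<length vs. B $$ (i, j) *s (vs ! i)))"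

text \<open>Eigenvalues are listed with their multiplicities as roots of the characteristic polynomial.\<close>

definition has_eigenvalues :: "complex mat \<Rightarrow> complex list \<Rightarrow> bool" where
  "has_eigenvalues B es \<longleftrightarrow> char_poly B = (\<Prod>e\<leftarrow>es. [:- e, 1:])"

definition module_data ::
  "('v::finite \<Rightarrow> 'v \<Rightarrow> bool) \<Rightarrow> 'v \<Rightarrow> (complex^'v) set \<Rightarrow> nat \<Rightarrow> nat \<Rightarrow> nat \<Rightarrow> nat \<Rightarrow> nat list \<Rightarrow>
     (complex^'v) list \<Rightarrow> complex mat \<Rightarrow> complex list \<Rightarrow> bool" where
  "module_data E x W r m n \<delta> sh vs B es \<longleftrightarrow>
     T_irreducible E x W \<and>
     endpoint E x W = r \<and>
     multiplicity_in_V E x W = m \<and>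
     vec.dim W = n \<and>
     mod_diameter E x W = \<delta> \<and>
     shape E x W = sh \<and>
     pure_basis E x W vs \<and>
     represents (adj_matrix E) vs B \<and>
     has_eigenvalues B es"

text \<open>\<open>\<nu>\<close> spans \<open>E\<^sub>r\<^sup>*W\<close>, where \<open>r\<close> is the endpoint of \<open>W\<close>, and has the given essential part with
  respect to the ordering \<open>ys\<close> of the vertices at distance \<open>r\<close> from \<open>x\<close>.\<close>

definition is_seed ::
  "('v::finite \<Rightarrow> 'v \<Rightarrow> bool) \<Rightarrow> 'v \<Rightarrow> (complex^'v) set \<Rightarrow> 'v list \<Rightarrow> complex list \<Rightarrow>
     complex^'v \<Rightarrow> bool" where
  "is_seed E x W ys cs \<nu> \<longleftrightarrow>
     pure_vector E x (endpoint E x W) \<nu> \<and>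
     essential_part ys \<nu> = cs \<and>
     vec.span {\<nu>} = EstarW E x (endpoint E x W) W \<and>
     vec.dim (EstarW E x (endpoint E x W) W) = 1"

section \<open>Orderings and representing matrices\<close>

definition ordering_of :: "'v list \<Rightarrow> 'v set \<Rightarrow> bool" where
  "ordering_of ys S \<longleftrightarrow> distinct ys \<and> set ys = S"

text \<open>With \<open>ys = [y\<^sub>1, \<dots>, y\<^sub>6]\<close>, the vertex \<open>y\<^sub>k\<close> is \<open>ys ! (k - 1)\<close>.\<close>

definition admissible_ordering :: "('v \<Rightarrow> 'v \<Rightarrow> bool) \<Rightarrow> 'v \<Rightarrow> 'v list \<Rightarrow> bool" where
  "admissible_ordering E x ys \<longleftrightarrow>
     length ys = 6 \<and> ordering_of ys (sphere_at E 2 x) \<and>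
     (\<forall>(i, j) \<in> {(0, 1), (2, 3), (4, 5)}. \<exists>z\<in>sphere_at E 1 x. E z (ys ! i) \<and> E z (ys ! j)) \<and>
     (\<forall>u\<in>sphere_at E 2 x. \<forall>w\<in>sphere_at E 2 x. E u w \<longrightarrow>
        (u \<in> {ys ! 0, ys ! 2, ys ! 5} \<and> w \<in> {ys ! 1, ys ! 3, ys ! 4}) \<or>
        (w \<in> {ys ! 0, ys ! 2, ys ! 5} \<and> u \<in> {ys ! 1, ys ! 3, ys ! 4}))"

definition B_I :: "complex mat" where
  "B_I = mat_of_rows_list 6
    [[0, 3, 0, 0, 0, 0],
     [1, 0, 2, 0, 0, 0],
     [0, 1, 1, 1, 0, 0],
     [0, 0, 1, 1, 1, 0],
     [0, 0, 0, 2, 0, 1],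
     [0, 0, 0, 0, 3, 0]]"

definition B_II :: "complex mat" where
  "B_II = mat_of_rows_list 6
    [[0, 2, -1, 0, 0, 0],
     [1, 0, 1, 1, 1, 0],
     [0, 1, 0, 0, 1, 0],
     [0, 1, -1, 1, 1, 0],
     [0, 0, 1, 0, -1, 1],
     [0, 0, 0, 1, 2, 0]]"

definition B_III :: "complex mat" where
  "B_III = mat_of_rows_list 2
    [[-1, 1],
     [1, -1]]"

definition basis_II ::
  "('v::finite \<Rightarrow> 'v \<Rightarrow> bool) \<Rightarrow> 'v \<Rightarrow> complex^'v \<Rightarrow> (complex^'v) list" where
  "basis_II E x \<nu> =
     (let A = adj_matrix E; A2\<nu> = A *v (A *v \<nu>); A3\<nu> = A *v (A *v (A *v \<nu>)) in
      [\<nu>, A *v \<nu>, Estar E x 2 *v A2\<nu>, Estar E x 3 *v A2\<nu>, Estar E x 3 *v A3\<nu>, Estar E x 4 *v A3\<nu>])"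

end

theory Submission
  imports Defs
begin

text \<open>
  For a self-adjoint idempotent \<open>e \<in> T\<close> with \<open>e T e = \<complex> e\<close>, every nonzero \<open>u\<close> in the image of \<open>e\<close>
  generates an irreducible module \<open>T u\<close>, all these modules are isomorphic, and every irreducible module
  that \<open>e\<close> does not annihilate is one of them; hence the multiplicity of \<open>T u\<close> is the rank of \<open>e\<close>. There
  are three such idempotents: \<open>E\<^sub>0\<^sup>*\<close>, the projection of \<open>E\<^sub>1\<^sup>* V\<close> onto the vectors of coordinate sum zero,
  and the projection onto the line spanned by the alternating vector of the hexagon \<open>\<Gamma>\<^sub>2(x)\<close>. Their
  modules have dimensions 6, 6, 2 and multiplicities 1, 2, 1, which already exhausts the 20 dimensions
  of \<open>V\<close>, and the elements \<open>q\<^sub>j e q\<^sub>k\<^sup>*\<close> of \<open>T\<close>, where \<open>q\<^sub>j u\<close> runs through an orthogonal basis of \<open>T u\<close>,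
  form a basis of \<open>T\<close>.

  That the intersection array determines the graph follows from \<open>a\<^sub>1 = 0\<close>, \<open>c\<^sub>2 = 1\<close> and \<open>a\<^sub>2 = 1\<close>, which put
  every path of length two on a pentagon; filling in pentagons from \<open>x\<close> outwards labels all vertices.
\<close>

section \<open>The Hermitian form\<close>

text \<open>Two features of the statement shape the proof. Multiplicity is defined through all
  orthogonal decompositions, so exhibiting one is not enough: the summands isomorphic to a given
  module are counted in an arbitrary decomposition. And both vertex orderings are arbitrary: the
  order of the neighbours of \<open>x\<close> is absorbed by building the labelling from it, while
  an admissible order of the hexagon can change only the sign of the alternating vector. The scalar
  condition on an idempotent is immediate in rank one. For rank two the reason is different:
  \<open>A\<close> acts by the same matrix \<open>B_II\<close> on the basis generated by any vector
  of coordinate sum zero, so each element of \<open>T\<close> acts by one matrix on all these bases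
  at once, and the corner entry of that matrix is the scalar. No general semisimplicity theory
  enters; closure of \<open>T\<close> under adjoints and definiteness of the form take its place.
  Once the graph is labelled, vectors are explicit lists of 20 coordinates and what remains is
  rewriting.\<close>

lemma herm_add_left: "herm (u + v) w = herm u w + herm v w"
  and herm_add_right: "herm u (v + w) = herm u v + herm u w"
  and herm_diff_right: "herm u (v - w) = herm u v - herm u w"
  by (simp_all add: herm_def algebra_simps sum.distrib sum_subtractf)

lemma herm_scale_left: "herm (c *s u) v = c * herm u v"
  and herm_scale_right: "herm u (c *s v) = cnj c * herm u v"
  by (simp_all add: herm_def sum_distrib_left algebra_simps)

lemma herm_0_left [simp]: "herm 0 v = 0"
  and herm_0_right [simp]: "herm u 0 = 0"
  by (simp_all add: herm_def)

lemma herm_sum_left: "herm (\<Sum>i\<in>I. f i) v = (\<Sum>i\<in>I. herm (f i) v)"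
  by (induction I rule: infinite_finite_induct) (simp_all add: herm_add_left)

lemma cnj_herm: "cnj (herm u v) = herm v u"
  by (simp add: herm_def mult.commute)

lemma herm_eq_0_sym: "herm u v = 0 \<longleftrightarrow> herm v u = 0"
  by (metis cnj_herm complex_cnj_zero)

lemma herm_self_eq_0 [simp]: "herm u u = 0 \<longleftrightarrow> u = 0"
proof
  assume h: "herm u u = 0"
  have "herm u u = of_real (\<Sum>y\<in>UNIV. (cmod (u $ y))\<^sup>2)"
    by (simp only: herm_def complex_norm_square of_real_sum)
  with h have "(\<Sum>y\<in>UNIV. (cmod (u $ y))\<^sup>2) = 0"
    by (metis of_real_eq_0_iff)
  then show "u = 0"
    by (simp add: sum_nonneg_eq_0_iff Finite_Cartesian_Product.vec_eq_iff)
qed simp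

lemma vec_subspace_orthogonal: "vec.subspace {v. herm u v = 0}"
  by (simp add: vec.subspace_def herm_add_right herm_scale_right)

lemma herm_span_right:
  assumes "\<And>v. v \<in> S \<Longrightarrow> herm u v = 0" "w \<in> vec.span S"
  shows "herm u w = 0"
  using vec.span_minimal[OF _ vec_subspace_orthogonal, of S u] assms by blast

lemma independent_orthogonal:
  assumes "\<And>u v. u \<in> S \<Longrightarrow> v \<in> S \<Longrightarrow> u \<noteq> v \<Longrightarrow> herm u v = 0" "0 \<notin> S"
  shows "vec.independent S"
proof
  assume "vec.dependent S"
  then obtain a where a: "a \<in> S" "a \<in> vec.span (S - {a})"
    by (auto simp: vec.dependent_def)
  have "herm a a = 0"
    by (rule herm_span_right[OF _ a(2)]) (use a assms in auto)
  with a assms show False by simp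
qed

text \<open>\<open>ds\<close> is a certificate of independence: pairing with \<open>ds ! i\<close>
  kills every \<open>vs ! j\<close> with \<open>j \<noteq> i\<close>, but not \<open>vs ! i\<close>.
  It also serves for bases that are not orthogonal.\<close>

lemma independent_dual:
  assumes len: "length ds = length vs"
    and dual: "\<And>i j. i < length vs \<Longrightarrow> j < length vs \<Longrightarrow> herm (vs ! i) (ds ! j) = 0 \<longleftrightarrow> i \<noteq> j"
  shows "distinct vs" "vec.independent (set vs)"
proof -
  show "distinct vs"
    unfolding distinct_conv_nth using dual by metis
  show "vec.independent (set vs)"
  proof
    assume "vec.dependent (set vs)"
    then obtain a where a: "a \<in> set vs" "a \<in> vec.span (set vs - {a})"
      by (auto simp: vec.dependent_def)
    then obtain i where i: "i < length vs" "a = vs ! i"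
      by (metis in_set_conv_nth)
    have "herm (ds ! i) a = 0"
    proof (rule herm_span_right[OF _ a(2)])
      fix v assume "v \<in> set vs - {a}"
      then obtain j where "j < length vs" "v = vs ! j" "j \<noteq> i"
        by (metis Diff_iff in_set_conv_nth i(2) singletonI)
      with dual[of j i] i show "herm (ds ! i) v = 0"
        by (simp add: herm_eq_0_sym[of "ds ! i"])
    qed
    with dual[of i i] i show False by (simp add: herm_eq_0_sym[of "ds ! i"])
  qed
qed

lemma dim_ge_dual:
  assumes "length ds = length vs" "set vs \<subseteq> S"
    and "\<And>i j. i < length vs \<Longrightarrow> j < length vs \<Longrightarrow> herm (vs ! i) (ds ! j) = 0 \<longleftrightarrow> i \<noteq> j"
  shows "length vs \<le> vec.dim S"
  using vec.independent_card_le_dim[OF assms(2) independent_dual(2)[OF assms(1,3)]]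
    distinct_card[OF independent_dual(1)[OF assms(1,3)]] by simp

text \<open>Each new subspace meets the span of the others only in 0, since a common vector is
  orthogonal to itself. Eigenspaces, irreducible summands and the blocks behind the dimension of
  \<open>T\<close> are all added up this way.\<close>

lemma dim_span_Union_orthogonal:
  fixes S :: "'i \<Rightarrow> (complex^'n) set"
  assumes "finite I"
    and "\<And>i. i \<in> I \<Longrightarrow> vec.subspace (S i)"
    and "\<And>i j u v. i \<in> I \<Longrightarrow> j \<in> I \<Longrightarrow> i \<noteq> j \<Longrightarrow> u \<in> S i \<Longrightarrow> v \<in> S j \<Longrightarrow> herm u v = 0"
  shows "vec.dim (vec.span (\<Union>i\<in>I. S i)) = (\<Sum>i\<in>I. vec.dim (S i))"
  using assms
proof (induction I)
  case empty
  then show ?case by simp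
next
  case (insert a I)
  let ?U = "vec.span (\<Union>i\<in>I. S i)"
  have sub: "vec.subspace (S a)" using insert by auto
  have "u = 0" if "u \<in> S a" "u \<in> ?U" for u
  proof -
    have "herm u u = 0"
      by (rule herm_span_right[OF _ that(2)]) (use insert that in \<open>auto 5 5\<close>)
    then show ?thesis by simp
  qed
  then have int: "S a \<inter> ?U = {0}"
    using sub vec.span_zero by (auto simp: vec.subspace_0)
  have "vec.span (\<Union>i\<in>insert a I. S i) = {x + y |x y. x \<in> S a \<and> y \<in> ?U}"
    using vec.span_Un[of "S a" "\<Union>i\<in>I. S i"] vec.span_eq_iff[THEN iffD2, OF sub] by simp
  then have "vec.dim (vec.span (\<Union>i\<in>insert a I. S i)) = vec.dim (S a) + vec.dim ?U"
    using vec.dim_sums_Int[OF sub vec.subspace_span, of "\<Union>i\<in>I. S i"] int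
    by (simp del: vec.dim_span add: vec.dim_eq_0)
  moreover have "vec.dim ?U = (\<Sum>i\<in>I. vec.dim (S i))"
    by (rule insert.IH) (use insert.prems in blast)+
  ultimately show ?case using insert.hyps by simp
qed

section \<open>Adjoint matrices and spectra\<close>

definition adjoint :: "complex^'n^'n \<Rightarrow> complex^'n^'n" where
  "adjoint M = (\<chi> i j. cnj (M $ j $ i))"

lemma herm_adjoint: "herm (M *v u) v = herm u (adjoint M *v v)"
proof -
  have "herm (M *v u) v = (\<Sum>i\<in>UNIV. \<Sum>j\<in>UNIV. M $ i $ j * u $ j * cnj (v $ i))"
    by (simp add: herm_def matrix_vector_mult_def sum_distrib_right)
  also have "\<dots> = (\<Sum>j\<in>UNIV. \<Sum>i\<in>UNIV. M $ i $ j * u $ j * cnj (v $ i))"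
    by (rule sum.swap)
  finally show ?thesis
    by (simp add: herm_def matrix_vector_mult_def adjoint_def sum_distrib_left mult_ac)
qed

lemma adjoint_adjoint [simp]: "adjoint (adjoint M) = M"
  by (simp add: adjoint_def Finite_Cartesian_Product.vec_eq_iff)

lemma adjoint_mult: "adjoint (M ** N) = adjoint N ** adjoint M"
  by (simp add: adjoint_def matrix_matrix_mult_def Finite_Cartesian_Product.vec_eq_iff mult.commute)

lemma adjoint_add: "adjoint (M + N) = adjoint M + adjoint N"
  by (simp add: adjoint_def Finite_Cartesian_Product.vec_eq_iff)

lemma adjoint_zero [simp]: "adjoint 0 = 0"
  by (simp add: adjoint_def Finite_Cartesian_Product.vec_eq_iff)

lemma adjoint_mscale: "adjoint (mscale c M) = mscale (cnj c) (adjoint M)"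
  by (simp add: adjoint_def mscale_def Finite_Cartesian_Product.vec_eq_iff)

lemma adjoint_one: "adjoint (Finite_Cartesian_Product.mat 1) = Finite_Cartesian_Product.mat 1"
  by (simp add: adjoint_def Finite_Cartesian_Product.mat_def Finite_Cartesian_Product.vec_eq_iff)

lemma mscale_mult_vec: "mscale c M *v v = c *s (M *v v)"
  by (simp add: mscale_def matrix_vector_mult_def Finite_Cartesian_Product.vec_eq_iff
      sum_distrib_left mult.assoc)

lemma mscale_mult_left: "mscale c M ** N = mscale c (M ** N)"
  and mscale_mult_right: "M ** mscale c N = mscale c (M ** N)"
  by (simp_all add: mscale_def matrix_matrix_mult_def Finite_Cartesian_Product.vec_eq_iff
      sum_distrib_left mult_ac)

lemma mult_vec_scale: "M *v (c *s v) = c *s (M *v (v :: complex^'n))"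
  by (simp add: vec.scale)

lemma matrix_eqI: "(\<And>v. M *v v = N *v v) \<Longrightarrow> M = (N :: complex^'n^'m)"
  by (simp add: matrix_eq)

lemma subspace_eigenspace: "vec.subspace (eigenspace M \<theta>)"
  by (simp add: vec.subspace_def eigenspace_def matrix_vector_right_distrib vec.scale_right_distrib
      mult_vec_scale mult.commute vector_smult_assoc)

text \<open>Eigenspaces of a self-adjoint matrix are mutually orthogonal, so their dimensions add up to at
  most the size of the matrix; lower bounds with that sum are therefore exact.\<close>

lemma has_spectrumI:
  fixes M :: "complex^'n^'n"
  assumes sa: "adjoint M = M" and dist: "distinct (map fst sp)"
    and lower: "\<And>\<theta> m. (\<theta>, m) \<in> set sp \<Longrightarrow> 0 < m \<and> m \<le> vec.dim (eigenspace M \<theta>)"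
    and total: "(\<Sum>(\<theta>, m)\<leftarrow>sp. m) = CARD('n)"
  shows "has_spectrum M sp"
proof -
  have real: "cnj \<theta> = \<theta>" if "u \<in> eigenspace M \<theta>" "u \<noteq> 0" for u \<theta>
    using that herm_adjoint[of M u u] sa by (simp add: eigenspace_def herm_scale_left herm_scale_right)
  have orth: "herm u v = 0"
    if "u \<in> eigenspace M \<theta>" "v \<in> eigenspace M \<tau>" "\<theta> \<noteq> \<tau>" for u v \<theta> \<tau>
  proof (cases "v = 0")
    case False
    have "\<theta> * herm u v = \<tau> * herm u v"
      using herm_adjoint[of M u v] sa that real[OF that(2) False]
      by (simp add: eigenspace_def herm_scale_left herm_scale_right)
    with that show ?thesis by simp
  qed simp
  have bound: "(\<Sum>\<theta>\<in>F. vec.dim (eigenspace M \<theta>)) \<le> CARD('n)" if "finite F" for F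
    using dim_span_Union_orthogonal[OF that, of "eigenspace M"] orth subspace_eigenspace
      vec.dim_subset_UNIV[of "vec.span (\<Union>\<theta>\<in>F. eigenspace M \<theta>)"]
    by (metis (no_types, lifting) vec.dimension_def card_cart_basis vec.dim_UNIV)
  let ?F = "fst ` set sp"
  have sum_m: "(\<Sum>(\<theta>, m)\<in>set sp. m) = CARD('n)"
    using total dist by (simp add: distinct_map sum.distinct_set_conv_list)
  have inj: "inj_on fst (set sp)" using dist by (simp add: distinct_map)
  have sum_dim: "(\<Sum>\<theta>\<in>?F. vec.dim (eigenspace M \<theta>)) = (\<Sum>(\<theta>, m)\<in>set sp. vec.dim (eigenspace M \<theta>))"
    by (simp add: sum.reindex[OF inj] case_prod_unfold)
  have le: "(\<Sum>(\<theta>, m)\<in>set sp. m) \<le> (\<Sum>(\<theta>, m)\<in>set sp. vec.dim (eigenspace M \<theta>))"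
    by (rule sum_mono) (use lower in auto)
  have eq: "vec.dim (eigenspace M \<theta>) = m" if "(\<theta>, m) \<in> set sp" for \<theta> m
  proof (rule ccontr)
    assume "\<not> ?thesis"
    then have "(\<Sum>(\<theta>, m)\<in>set sp. m) < (\<Sum>(\<theta>, m)\<in>set sp. vec.dim (eigenspace M \<theta>))"
      using lower that by (intro sum_strict_mono_ex1) (fastforce intro!: bexI[OF _ that])+
    with bound[of ?F] sum_m sum_dim show False by simp
  qed
  have "eigenspace M \<theta> \<noteq> {0} \<longleftrightarrow> \<theta> \<in> ?F" for \<theta>
  proof
    assume "\<theta> \<in> ?F"
    with lower show "eigenspace M \<theta> \<noteq> {0}" by fastforce
  next
    assume nz: "eigenspace M \<theta> \<noteq> {0}"
    show "\<theta> \<in> ?F"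
    proof (rule ccontr)
      \<comment> \<open>An eigenvalue outside the list would push the sum of the dimensions above
        the size of the matrix.\<close>
      assume "\<theta> \<notin> ?F"
      then have "(\<Sum>\<theta>\<in>insert \<theta> ?F. vec.dim (eigenspace M \<theta>)) = vec.dim (eigenspace M \<theta>) + CARD('n)"
        using sum_m sum_dim le bound[of ?F] by simp
      with bound[of "insert \<theta> ?F"] have "vec.dim (eigenspace M \<theta>) = 0" by simp
      with nz show False
        using subspace_eigenspace[of M \<theta>] by (auto simp: vec.dim_eq_0 vec.subspace_0)
    qed
  qed
  with eq dist show ?thesis by (auto simp: has_spectrum_def)
qed

section \<open>The Terwilliger algebra and its modules\<close>

lemma adjoint_Estar: "adjoint (Estar E x i) = Estar E x i"
  by (auto simp: adjoint_def Estar_def Finite_Cartesian_Product.vec_eq_iff)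

lemma adjoint_adj_matrix: "symp E \<Longrightarrow> adjoint (adj_matrix E) = adj_matrix E"
  by (auto simp: adjoint_def adj_matrix_def Finite_Cartesian_Product.vec_eq_iff symp_def)

lemma Estar_mult_vec: "(Estar E x i *v v) $ y = (if gdist E x y = i then v $ y else 0)"
proof -
  have "(Estar E x i *v v) $ y = (\<Sum>z\<in>UNIV. if y = z then (if gdist E x y = i then v $ y else 0) else 0)"
    unfolding Estar_def matrix_vector_mult_def by (auto simp: mult_delta_left)
  then show ?thesis by simp
qed

lemma Estar_Estar: "Estar E x i *v (Estar E x j *v v) = (if i = j then Estar E x j *v v else 0)"
  by (auto simp: Finite_Cartesian_Product.vec_eq_iff Estar_mult_vec)

lemma pure_vector_iff: "pure_vector E x i v \<longleftrightarrow> v \<noteq> 0 \<and> Estar E x i *v v = v"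
  unfolding pure_vector_def EstarW_def using Estar_Estar[of E x i i] by (metis image_iff rangeI)

lemma subspace_EstarW: "vec.subspace W \<Longrightarrow> vec.subspace (EstarW E x i W)"
  unfolding EstarW_def by (rule vec.subspace_image) auto

locale symmetric_graph =
  fixes E :: "'v::finite \<Rightarrow> 'v \<Rightarrow> bool" and x :: 'v
  assumes symp_E: "symp E"
begin

abbreviation "T \<equiv> terwilliger E x"
abbreviation "A \<equiv> adj_matrix E"

lemma subalgebra_T: "subalgebra T"
  unfolding terwilliger_def
proof (rule hull_in)
  fix S :: "(complex^'v^'v) set set"
  assume "Ball S subalgebra"
  then show "subalgebra (\<Inter>S)"
    by (auto simp: subalgebra_def mat_space.subspace_def)
qed

lemma T_one: "Finite_Cartesian_Product.mat 1 \<in> T"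
  and T_zero: "0 \<in> T"
  and T_add: "M \<in> T \<Longrightarrow> N \<in> T \<Longrightarrow> M + N \<in> T"
  and T_scale: "M \<in> T \<Longrightarrow> mscale c M \<in> T"
  and T_mult: "M \<in> T \<Longrightarrow> N \<in> T \<Longrightarrow> M ** N \<in> T"
  using subalgebra_T by (auto simp: subalgebra_def mat_space.subspace_def)

lemma T_diff: "M \<in> T \<Longrightarrow> N \<in> T \<Longrightarrow> M - N \<in> T"
  using subalgebra_T by (auto simp: subalgebra_def mat_space.subspace_diff)

lemma T_A: "A \<in> T"
  unfolding terwilliger_def by (rule hull_inc) simp

lemma T_Estar: "i \<le> gdiam E \<Longrightarrow> Estar E x i \<in> T"
  unfolding terwilliger_def by (rule hull_inc) simp

lemma T_minimal:
  assumes "subalgebra S" "A \<in> S" "\<And>i. i \<le> gdiam E \<Longrightarrow> Estar E x i \<in> S"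
  shows "T \<subseteq> S"
  unfolding terwilliger_def by (rule hull_minimal) (use assms in auto)

text \<open>The generators are self-adjoint, so the matrices whose adjoint lies in \<open>T\<close>
  form a subalgebra containing them. The later orthogonality arguments move elements of
  \<open>T\<close> across the form by this closure.\<close>

lemma T_adjoint: "M \<in> T \<Longrightarrow> adjoint M \<in> T"
proof -
  have "T \<subseteq> {M. adjoint M \<in> T}"
    by (rule T_minimal)
      (auto simp: subalgebra_def mat_space.subspace_def adjoint_add adjoint_mscale adjoint_mult
        adjoint_one adjoint_Estar adjoint_adj_matrix[OF symp_E]
        T_A T_Estar T_add T_scale T_mult T_one T_zero)
  then show "M \<in> T \<Longrightarrow> adjoint M \<in> T" by auto
qed

text \<open>The matrices that stabilise \<open>W\<close> form a subalgebra, so the generators of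
  \<open>T\<close> suffice.\<close>

lemma T_moduleI:
  assumes W: "vec.subspace W" and "\<And>w. w \<in> W \<Longrightarrow> A *v w \<in> W"
    and "\<And>i w. i \<le> gdiam E \<Longrightarrow> w \<in> W \<Longrightarrow> Estar E x i *v w \<in> W"
  shows "T_module E x W"
proof -
  have "subalgebra {B. \<forall>w\<in>W. B *v w \<in> W}"
    using W by (auto simp: subalgebra_def mat_space.subspace_def mscale_mult_vec
        matrix_vector_mult_add_rdistrib vec.subspace_0 vec.subspace_add vec.subspace_scale
        simp flip: matrix_vector_mul_assoc)
  from T_minimal[OF this] assms show ?thesis
    by (auto simp: T_module_def)
qed

section \<open>Cyclic modules and the idempotents that classify them\<close>

definition gen :: "complex^'v \<Rightarrow> (complex^'v) set" where
  "gen u = (\<lambda>B. B *v u) ` T"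

lemma genI: "B \<in> T \<Longrightarrow> B *v u \<in> gen u"
  by (auto simp: gen_def)

lemma gen_self: "u \<in> gen u"
  using genI[OF T_one, of u] by simp

lemma T_module_gen: "T_module E x (gen u)"
proof -
  have "vec.subspace (gen u)"
    unfolding vec.subspace_def gen_def
  proof (intro conjI ballI allI)
    show "0 \<in> (\<lambda>B. B *v u) ` T"
      using T_zero by (metis imageI matrix_vector_mult_0)
  next
    fix v w assume "v \<in> (\<lambda>B. B *v u) ` T" "w \<in> (\<lambda>B. B *v u) ` T"
    then show "v + w \<in> (\<lambda>B. B *v u) ` T"
      by (auto simp flip: matrix_vector_mult_add_rdistrib intro: T_add)
  next
    fix c v assume "v \<in> (\<lambda>B. B *v u) ` T"
    then show "c *s v \<in> (\<lambda>B. B *v u) ` T"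
      by (auto simp flip: mscale_mult_vec intro: T_scale)
  qed
  then show ?thesis
    by (auto simp: T_module_def gen_def matrix_vector_mul_assoc intro: T_mult)
qed

lemma subspace_gen: "vec.subspace (gen u)"
  using T_module_gen by (simp add: T_module_def)

lemma gen_closed: "B \<in> T \<Longrightarrow> w \<in> gen u \<Longrightarrow> B *v w \<in> gen u"
  using T_module_gen by (auto simp: T_module_def)

lemma gen_minimal: "T_module E x U \<Longrightarrow> u \<in> U \<Longrightarrow> gen u \<subseteq> U"
  by (auto simp: T_module_def gen_def)

text \<open>Elements of \<open>T\<close> move across the form as adjoints, so it suffices to test
  the generator \<open>u\<close> alone against \<open>gen v\<close>.\<close>

lemma herm_gen_gen:
  assumes "\<And>w. w \<in> gen v \<Longrightarrow> herm u w = 0" "u' \<in> gen u" "v' \<in> gen v"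
  shows "herm u' v' = 0"
proof -
  obtain B where "B \<in> T" "u' = B *v u" using assms(2) by (auto simp: gen_def)
  then show ?thesis
    using assms(1)[OF gen_closed[OF T_adjoint assms(3)]] by (simp add: herm_adjoint)
qed

text \<open>Such an \<open>e\<close> has rank one on the irreducible modules of one isomorphism class and annihilates all
  others.\<close>

definition primitive :: "complex^'v^'v \<Rightarrow> bool" where
  "primitive e \<longleftrightarrow> e \<in> T \<and> adjoint e = e \<and> e ** e = e \<and>
     (\<forall>B\<in>T. \<exists>c. e ** B ** e = mscale c e)"

lemma primitive_fix_iff: "primitive e \<Longrightarrow> e *v u = u \<longleftrightarrow> u \<in> range ((*v) e)"
  by (auto simp: primitive_def matrix_vector_mul_assoc) (metis rangeI)

lemma primitive_compress:
  assumes "primitive e" "B \<in> T"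
  obtains c where "\<And>u. e *v u = u \<Longrightarrow> e *v (B *v u) = c *s u"
proof -
  obtain c where c: "e ** B ** e = mscale c e"
    using assms by (auto simp: primitive_def)
  have "e *v (B *v u) = c *s u" if "e *v u = u" for u
    using arg_cong[OF c, of "\<lambda>M. M *v u"] that
    by (simp add: mscale_mult_vec flip: matrix_vector_mul_assoc)
  with that show ?thesis by blast
qed

lemma primitive_gen:
  assumes "primitive e" "e *v u = u" "w \<in> gen u"
  obtains c where "e *v w = c *s u"
proof -
  from assms(3) obtain B where "B \<in> T" "w = B *v u" by (auto simp: gen_def)
  with primitive_compress[OF assms(1)] assms(2) that show ?thesis by metis
qed

text \<open>Let \<open>U\<close> be a nonzero submodule. If \<open>e\<close> does not kill it, then
  \<open>U\<close> contains a nonzero multiple of \<open>u\<close> and is everything. If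
  \<open>e\<close> kills it, write \<open>w = B *v u\<close>; then \<open>herm w w\<close> equals
  \<open>herm u (e *v (adjoint B *v w))\<close>, which vanishes because
  \<open>adjoint B *v w\<close> lies in \<open>U\<close>.\<close>

lemma irreducible_gen:
  assumes e: "primitive e" and u: "e *v u = u" "u \<noteq> 0"
  shows "T_irreducible E x (gen u)"
proof -
  have False if U: "T_module E x U" "U \<noteq> {0}" "U \<subset> gen u" for U
  proof (cases "\<exists>w\<in>U. e *v w \<noteq> 0")
    case True
    then obtain w where w: "w \<in> U" "e *v w \<noteq> 0" by blast
    then obtain c where c: "e *v w = c *s u"
      using primitive_gen[OF e u(1), of w] U by blast
    have "e *v w \<in> U" using w U e by (auto simp: T_module_def primitive_def)
    then have "inverse c *s (e *v w) \<in> U"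
      using U by (auto simp: T_module_def intro: vec.subspace_scale)
    moreover have "inverse c *s (e *v w) = u" using c w by (cases "c = 0") auto
    ultimately show False using gen_minimal[of U u] U by auto
  next
    case False
    have "w = 0" if w: "w \<in> U" for w
    proof -
      have "w \<in> gen u" using w U by blast
      then obtain B where B: "B \<in> T" "w = B *v u" by (auto simp: gen_def)
      have "adjoint B *v w \<in> U" using U w T_adjoint[OF B(1)] by (auto simp: T_module_def)
      then have 0: "e *v (adjoint B *v w) = 0" using False by blast
      have "herm w w = herm (e *v u) (adjoint B *v w)"
        using B u by (simp add: herm_adjoint)
      also have "\<dots> = herm u (e *v (adjoint B *v w))"
        using e by (simp add: primitive_def herm_adjoint)
      finally show ?thesis using 0 by simp
    qed
    moreover have "0 \<in> U" using U by (auto simp: T_module_def vec.subspace_0)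
    ultimately show False using U by blast
  qed
  then show ?thesis
    unfolding T_irreducible_def using T_module_gen gen_self u by blast
qed

lemma irreducible_eq_gen:
  assumes e: "primitive e" and U: "T_irreducible E x U" "w \<in> U" "e *v w \<noteq> 0"
  shows "U = gen (e *v w)" "e *v (e *v w) = e *v w"
proof -
  have "e *v w \<in> U" using e U by (auto simp: primitive_def T_irreducible_def T_module_def)
  then have "gen (e *v w) \<subseteq> U" using U gen_minimal by (auto simp: T_irreducible_def)
  with U T_module_gen gen_self[of "e *v w"] show "U = gen (e *v w)"
    unfolding T_irreducible_def by blast
  show "e *v (e *v w) = e *v w" using primitive_fix_iff[OF e] by auto
qed

text \<open>For \<open>u\<close>, \<open>u'\<close> in the image of \<open>e\<close>, the norm of \<open>B u\<close> is determined by the scalar that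
  \<open>e B\<^sup>* B e\<close> represents, so \<open>B u = 0\<close> iff \<open>B u' = 0\<close>.\<close>

lemma primitive_zero_transfer:
  assumes e: "primitive e" and u: "e *v u = u" "u \<noteq> 0" and u': "e *v u' = u'"
    and B: "B \<in> T" "B *v u = 0"
  shows "B *v u' = 0"
proof -
  obtain c where c: "\<And>u. e *v u = u \<Longrightarrow> e *v ((adjoint B ** B) *v u) = c *s u"
    using primitive_compress[OF e T_mult[OF T_adjoint[OF B(1)] B(1)]] by blast
  have norm: "herm (B *v v) (B *v v) = cnj c * herm v v" if "e *v v = v" for v
  proof -
    have "herm (B *v v) (B *v v) = herm (e *v v) ((adjoint B ** B) *v v)"
      using that by (simp add: herm_adjoint matrix_vector_mul_assoc)
    also have "\<dots> = herm v (e *v ((adjoint B ** B) *v v))"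
      using e by (simp add: primitive_def herm_adjoint)
    finally show ?thesis using c[OF that] by (simp add: herm_scale_right)
  qed
  from norm[OF u(1)] B u have "c = 0" by simp
  with norm[OF u'] show ?thesis by simp
qed

text \<open>The isomorphism sends \<open>B *v u\<close> to \<open>B *v u'\<close>. It is well
  defined and injective by \<open>primitive_zero_transfer\<close>, applied in both directions to the
  difference of two elements of \<open>T\<close>.\<close>

lemma isomorphic_gen:
  assumes e: "primitive e" and u: "e *v u = u" "u \<noteq> 0" and u': "e *v u' = u'" "u' \<noteq> 0"
  shows "T_isomorphic E x (gen u) (gen u')"
proof -
  have eq_iff: "B *v u = C *v u \<longleftrightarrow> B *v u' = C *v u'" if "B \<in> T" "C \<in> T" for B C
    using primitive_zero_transfer[OF e u u'(1) T_diff[OF that]]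
      primitive_zero_transfer[OF e u' u(1) T_diff[OF that]]
    by (auto simp: matrix_vector_mult_diff_rdistrib)
  define \<phi> where "\<phi> w = (SOME B. B \<in> T \<and> B *v u = w) *v u'" for w
  have \<phi>: "\<phi> (B *v u) = B *v u'" if "B \<in> T" for B
    unfolding \<phi>_def by (rule someI2[of _ B]) (use that eq_iff in auto)
  have "inj_on \<phi> (gen u)"
    by (auto simp: inj_on_def gen_def \<phi> eq_iff)
  moreover have "\<phi> ` gen u = gen u'"
    by (auto simp: gen_def image_image \<phi>)
  moreover have "\<phi> (v + w) = \<phi> v + \<phi> w" if "v \<in> gen u" "w \<in> gen u" for v w
    using that by (auto simp: gen_def \<phi> T_add simp flip: matrix_vector_mult_add_rdistrib)
  moreover have "\<phi> (c *s v) = c *s \<phi> v" if "v \<in> gen u" for v c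
    using that by (auto simp: gen_def \<phi> T_scale simp flip: mscale_mult_vec)
  moreover have "\<phi> (B *v v) = B *v \<phi> v" if "v \<in> gen u" "B \<in> T" for v B
    using that by (auto simp: gen_def \<phi> T_mult matrix_vector_mul_assoc)
  ultimately show ?thesis
    unfolding T_isomorphic_def bij_betw_def by blast
qed

text \<open>Being annihilated by a fixed \<open>B\<close> is an isomorphism invariant; this is how
  modules are told apart.\<close>

lemma T_isomorphic_nonzero:
  assumes iso: "T_isomorphic E x U W" and B: "B \<in> T" and U: "T_module E x U"
    and u: "u \<in> U" "B *v u \<noteq> 0"
  shows "\<exists>w\<in>W. B *v w \<noteq> 0"
proof -
  obtain \<phi> where bij: "bij_betw \<phi> U W" and scale: "\<And>c u. u \<in> U \<Longrightarrow> \<phi> (c *s u) = c *s \<phi> u"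
    and comm: "\<And>u. u \<in> U \<Longrightarrow> \<phi> (B *v u) = B *v \<phi> u"
    using iso B unfolding T_isomorphic_def by blast
  have 0: "0 \<in> U" and BU: "B *v u \<in> U"
    using U B u by (auto simp: T_module_def vec.subspace_0)
  have "\<phi> 0 = 0" using scale[OF 0, of 0] by simp
  then have "\<phi> (B *v u) \<noteq> 0"
    using bij 0 BU u by (metis bij_betw_def inj_onD)
  then show ?thesis using comm bij u by (metis bij_betwE)
qed

section \<open>Multiplicities and orthogonal decompositions\<close>

lemma isomorphic_gen_iff:
  assumes e: "primitive e" and u: "e *v u = u" "u \<noteq> 0" and U: "T_irreducible E x U"
  shows "T_isomorphic E x (gen u) U \<longleftrightarrow> (\<exists>w\<in>U. e *v w \<noteq> 0)"
proof
  assume "T_isomorphic E x (gen u) U"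
  then show "\<exists>w\<in>U. e *v w \<noteq> 0"
    using T_isomorphic_nonzero[OF _ _ T_module_gen gen_self] e u by (auto simp: primitive_def)
next
  assume "\<exists>w\<in>U. e *v w \<noteq> 0"
  then obtain w where w: "w \<in> U" "e *v w \<noteq> 0" by blast
  show "T_isomorphic E x (gen u) U"
    using isomorphic_gen[OF e u irreducible_eq_gen(2)[OF e U w] w(2)]
      irreducible_eq_gen(1)[OF e U w] by simp
qed

text \<open>Each summand isomorphic to \<open>gen u\<close> meets the image of \<open>e\<close> in a
  line, spanned by some \<open>z i\<close>, and \<open>e\<close> kills all other summands. Hence the
  vectors \<open>z i\<close> form an orthogonal basis of the image of \<open>e\<close>, and their
  number does not depend on \<open>Ws\<close>.\<close>

lemma multiplicity_count:
  assumes e: "primitive e" and u: "e *v u = u" "u \<noteq> 0" and Ws: "orthogonal_decomposition E x Ws"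
  shows "length (filter (T_isomorphic E x (gen u)) Ws) = vec.dim (range ((*v) e))"
proof -
  have irr: "T_irreducible E x (Ws ! i)" if "i < length Ws" for i
    using Ws that by (auto simp: orthogonal_decomposition_def)
  define I where "I = {i. i < length Ws \<and> T_isomorphic E x (gen u) (Ws ! i)}"
  have "\<exists>z. z \<in> Ws ! i \<and> z \<noteq> 0 \<and> e *v z = z \<and> Ws ! i = gen z" if i: "i \<in> I" for i
  proof -
    have "\<exists>w\<in>Ws ! i. e *v w \<noteq> 0"
      using i isomorphic_gen_iff[OF e u irr] by (auto simp: I_def)
    then obtain w where w: "w \<in> Ws ! i" "e *v w \<noteq> 0" by blast
    have "T_irreducible E x (Ws ! i)" using i irr by (auto simp: I_def)
    note irreducible_eq_gen[OF e this w]
    then show ?thesis using w(2) gen_self by metis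
  qed
  then obtain z where z: "\<And>i. i \<in> I \<Longrightarrow> z i \<in> Ws ! i \<and> z i \<noteq> 0 \<and> e *v z i = z i \<and> Ws ! i = gen (z i)"
    by metis
  have orth: "herm (z i) (z j) = 0" if "i \<in> I" "j \<in> I" "i \<noteq> j" for i j
    using Ws that z unfolding orthogonal_decomposition_def I_def by blast
  have inj: "inj_on z I"
    by (metis (no_types, lifting) herm_self_eq_0 inj_onI orth z)
  have ind: "vec.independent (z ` I)"
    by (rule independent_orthogonal) (use orth z in auto)
  have "e *v v \<in> vec.span (z ` I)" for v
  proof -
    obtain ws where ws: "length ws = length Ws" "\<forall>i<length Ws. ws ! i \<in> Ws ! i" "v = sum_list ws"
      using Ws unfolding orthogonal_decomposition_def by metis
    have "v = (\<Sum>i<length Ws. ws ! i)"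
      using ws by (simp add: sum_list_sum_nth atLeast0LessThan)
    then have "e *v v = (\<Sum>i<length Ws. e *v (ws ! i))"
      by (simp add: vec.sum)
    also have "\<dots> \<in> vec.span (z ` I)"
    proof (rule vec.span_sum)
      fix i assume i: "i \<in> {..<length Ws}"
      show "e *v (ws ! i) \<in> vec.span (z ` I)"
      proof (cases "i \<in> I")
        case True
        then have "e *v z i = z i" "ws ! i \<in> gen (z i)"
          using z ws i by auto
        then obtain c where "e *v (ws ! i) = c *s z i"
          using primitive_gen[OF e] by blast
        with True show ?thesis by (simp add: vec.span_base vec.span_scale)
      next
        case False
        then have "e *v (ws ! i) = 0"
          using isomorphic_gen_iff[OF e u irr] ws i by (auto simp: I_def)
        then show ?thesis by (simp add: vec.span_zero)
      qed
    qed
    finally show ?thesis .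
  qed
  moreover have "z ` I \<subseteq> range ((*v) e)"
    using z by (metis image_subsetI rangeI)
  ultimately have "card (z ` I) = vec.dim (range ((*v) e))"
    using ind by (intro vec.basis_card_eq_dim) auto
  then show ?thesis
    using card_image[OF inj] by (simp add: length_filter_conv_card I_def)
qed

text \<open>A decomposition has to be at hand: only then does the count single out the number
  denoted by \<open>THE\<close>.\<close>

lemma multiplicity_gen:
  assumes "primitive e" "e *v u = u" "u \<noteq> 0" "orthogonal_decomposition E x Ws"
  shows "multiplicity_in_V E x (gen u) = vec.dim (range ((*v) e))"
  unfolding multiplicity_in_V_def
  by (rule the_equality) (use multiplicity_count[OF assms(1-3)] assms(4) in blast)+

text \<open>Orthogonality makes the dimensions add up, so \<open>total\<close> forces the summands
  to span the whole space. Components are unique because pairing a vanishing sum with one of its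
  terms leaves the norm of that term.\<close>

lemma orthogonal_decompositionI:
  assumes irr: "\<And>W. W \<in> set Ws \<Longrightarrow> T_irreducible E x W"
    and orth: "\<And>i j u v. i < length Ws \<Longrightarrow> j < length Ws \<Longrightarrow> i \<noteq> j \<Longrightarrow> u \<in> Ws ! i \<Longrightarrow> v \<in> Ws ! j \<Longrightarrow>
      herm u v = 0"
    and total: "(\<Sum>W\<leftarrow>Ws. vec.dim W) = CARD('v)"
  shows "orthogonal_decomposition E x Ws"
proof -
  let ?n = "length Ws"
  have sub: "vec.subspace (Ws ! i)" if "i < ?n" for i
    using irr that by (auto simp: T_irreducible_def T_module_def)
  have "vec.dim (vec.span (\<Union>i\<in>{..<?n}. Ws ! i)) = (\<Sum>i<?n. vec.dim (Ws ! i))"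
    by (rule dim_span_Union_orthogonal) (use sub orth in auto)
  also have "\<dots> = CARD('v)"
    using total by (simp add: sum_list_sum_nth atLeast0LessThan)
  finally have span: "vec.span (\<Union>i\<in>{..<?n}. Ws ! i) = UNIV"
    by (metis vec.dim_eq_full vec.dim_span vec.dimension_def card_cart_basis vec.span_span)
  have ex: "\<exists>f. (\<forall>i<?n. f i \<in> Ws ! i) \<and> v = (\<Sum>i<?n. f i)" for v
  proof -
    have "v \<in> vec.span (\<Union>i\<in>{..<?n}. Ws ! i)" using span by simp
    then show ?thesis
    proof (induction v rule: vec.span_induct)
      case base
      show ?case
        unfolding vec.subspace_def mem_Collect_eq
      proof (intro conjI allI ballI impI)
        show "\<exists>f. (\<forall>i<?n. f i \<in> Ws ! i) \<and> 0 = (\<Sum>i<?n. f i)"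
          using sub vec.subspace_0 by (intro exI[of _ "\<lambda>_. 0"]) auto
      next
        fix a b
        assume "a \<in> {v. \<exists>f. (\<forall>i<?n. f i \<in> Ws ! i) \<and> v = (\<Sum>i<?n. f i)}"
          "b \<in> {v. \<exists>f. (\<forall>i<?n. f i \<in> Ws ! i) \<and> v = (\<Sum>i<?n. f i)}"
        then obtain f g where "\<forall>i<?n. f i \<in> Ws ! i" "\<forall>i<?n. g i \<in> Ws ! i"
          "a = (\<Sum>i<?n. f i)" "b = (\<Sum>i<?n. g i)" by auto
        then show "\<exists>f. (\<forall>i<?n. f i \<in> Ws ! i) \<and> a + b = (\<Sum>i<?n. f i)"
          using vec.subspace_add[OF sub]
          by (intro exI[of _ "\<lambda>i. f i + g i"]) (auto simp: sum.distrib)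
      next
        fix c a
        assume "a \<in> {v. \<exists>f. (\<forall>i<?n. f i \<in> Ws ! i) \<and> v = (\<Sum>i<?n. f i)}"
        then obtain f where "\<forall>i<?n. f i \<in> Ws ! i" "a = (\<Sum>i<?n. f i)" by auto
        then show "\<exists>f. (\<forall>i<?n. f i \<in> Ws ! i) \<and> c *s a = (\<Sum>i<?n. f i)"
          using vec.subspace_scale[OF sub]
          by (intro exI[of _ "\<lambda>i. c *s f i"]) (auto simp: vec.scale_sum_right)
      qed
    next
      case (step v)
      then obtain k where k: "k < ?n" "v \<in> Ws ! k" by auto
      then show ?case
        using sub vec.subspace_0
        by (intro exI[of _ "\<lambda>i. if i = k then v else 0"]) auto
    qed
  qed
  have "\<exists>!ws. length ws = ?n \<and> (\<forall>i<?n. ws ! i \<in> Ws ! i) \<and> v = sum_list ws" for v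
  proof (rule ex_ex1I)
    obtain f where f: "\<forall>i<?n. f i \<in> Ws ! i" "v = (\<Sum>i<?n. f i)" using ex by blast
    show "\<exists>ws. length ws = ?n \<and> (\<forall>i<?n. ws ! i \<in> Ws ! i) \<and> v = sum_list ws"
      by (rule exI[of _ "map f [0..<?n]"])
        (use f in \<open>simp add: sum_list_sum_nth atLeast0LessThan\<close>)
  next
    fix us ws
    assume us: "length us = ?n \<and> (\<forall>i<?n. us ! i \<in> Ws ! i) \<and> v = sum_list us"
      and ws: "length ws = ?n \<and> (\<forall>i<?n. ws ! i \<in> Ws ! i) \<and> v = sum_list ws"
    define d where "d i = us ! i - ws ! i" for i
    have d: "d i \<in> Ws ! i" if "i < ?n" for i
      using us ws sub that by (auto simp: d_def intro: vec.subspace_diff)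
    have "(\<Sum>i<?n. us ! i) = (\<Sum>i<?n. ws ! i)"
      using us ws by (metis (no_types, lifting) atLeast0LessThan sum_list_sum_nth)
    then have sum0: "(\<Sum>i<?n. d i) = 0"
      by (simp add: d_def sum_subtractf)
    have "d k = 0" if k: "k < ?n" for k
    proof -
      have "herm (\<Sum>i<?n. d i) (d k) = (\<Sum>i<?n. if i = k then herm (d k) (d k) else 0)"
        unfolding herm_sum_left using orth d k by (intro sum.cong) auto
      with sum0 k show ?thesis by simp
    qed
    then show "us = ws"
      using us ws by (intro nth_equalityI) (auto simp: d_def)
  qed
  with irr orth show ?thesis
    unfolding orthogonal_decomposition_def by blast
qed

end

section \<open>Determinants of sparse matrices\<close>

text \<open>Expansion along the first row, on plain lists of rows, that skips the minors at zero
  entries; this keeps symbolic determinants of sparse matrices within reach of the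
  simplifier.\<close>

fun laplace :: "'a::comm_ring_1 list list \<Rightarrow> 'a" where
  "laplace [] = 1"
| "laplace (r # rs) = (\<Sum>j\<leftarrow>[0..<length r].
     if r ! j = 0 then 0 else (-1) ^ j * r ! j * laplace (map (\<lambda>r. take j r @ drop (Suc j) r) rs))"

lemma det_eq_laplace:
  assumes "length rws = n" "\<forall>r\<in>set rws. length r = n"
  shows "Determinant.det (mat_of_rows_list n rws) = laplace rws"
  using assms
proof (induction n arbitrary: rws)
  case 0
  then show ?case by (simp add: mat_of_rows_list_def det_dim_zero)
next
  case (Suc m)
  then obtain r rs where rws: "rws = r # rs" by (cases rws) auto
  let ?n = "Suc m"
  let ?A = "mat_of_rows_list ?n (r # rs)"
  have n: "length rs = m" "length r = ?n" "\<forall>r\<in>set rs. length r = ?n"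
    using Suc.prems rws by auto
  have A: "?A \<in> carrier_mat ?n ?n" using n by (simp add: mat_of_rows_list_def)
  have minor: "Determinant.det (mat_delete ?A 0 j) = laplace (map (\<lambda>r. take j r @ drop (Suc j) r) rs)"
    if "j < ?n" for j
  proof -
    have "mat_delete ?A 0 j = mat_of_rows_list m (map (\<lambda>r. take j r @ drop (Suc j) r) rs)"
      using that n
      by (intro eq_matI) (auto simp: mat_delete_def mat_of_rows_list_def nth_append min_def)
    moreover have "Determinant.det (mat_of_rows_list m (map (\<lambda>r. take j r @ drop (Suc j) r) rs)) =
        laplace (map (\<lambda>r. take j r @ drop (Suc j) r) rs)"
      by (rule Suc.IH) (use that n in auto)
    ultimately show ?thesis by simp
  qed
  have "Determinant.det ?A = (\<Sum>j<?n. ?A $$ (0, j) * cofactor ?A 0 j)"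
    by (rule laplace_expansion_row[OF A]) (simp add: n)
  also have "\<dots> = (\<Sum>j<?n. if r ! j = 0 then 0 else (-1) ^ j * r ! j *
      laplace (map (\<lambda>r. take j r @ drop (Suc j) r) rs))"
  proof (rule sum.cong[OF refl])
    fix j assume "j \<in> {..<?n}"
    then show "?A $$ (0, j) * cofactor ?A 0 j = (if r ! j = 0 then 0 else (-1) ^ j * r ! j *
        laplace (map (\<lambda>r. take j r @ drop (Suc j) r) rs))"
      using minor[of j] by (simp add: cofactor_def mat_of_rows_list_def)
  qed
  also have "\<dots> = laplace (r # rs)"
    by (simp add: n(2) interv_sum_list_conv_sum_set_nat atLeast0LessThan
        del: upt_Suc sum.lessThan_Suc sum.op_ivl_Suc)
  finally show ?case using rws by simp
qed

lemma sqrt5_square: "complex_of_real (sqrt 5) * complex_of_real (sqrt 5) = 5"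
  by (simp flip: of_real_mult)

lemma char_poly_rows:
  assumes "length rws = n" "\<forall>r\<in>set rws. length r = n"
  shows "char_poly (mat_of_rows_list n rws) =
    laplace (map (\<lambda>i. map (\<lambda>j. [:- (rws ! i ! j), if i = j then 1 else 0:]) [0..<n]) [0..<n])"
    (is "_ = laplace ?rws")
proof -
  have "char_poly_matrix (mat_of_rows_list n rws) = mat_of_rows_list n ?rws"
    using assms by (intro eq_matI) (auto simp: char_poly_matrix_def mat_of_rows_list_def)
  then show ?thesis
    unfolding char_poly_def by (simp add: det_eq_laplace)
qed

lemma upt_0_6: "[0..<6] = [0, 1, 2, 3, 4, 5::nat]"
  by (simp add: upt_rec)

lemma eigenvalues_B_III: "has_eigenvalues B_III [0, -2]"
proof -
  \<comment> \<open>Over an infinite field, polynomials may be compared through their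
    values.\<close>
  have "poly (char_poly B_III) z = poly (\<Prod>e\<leftarrow>[0, -2]. [:- e, 1:]) z" for z
    unfolding B_III_def by (subst char_poly_rows; simp add: upt_rec[of _ "2::nat"])
  then show ?thesis
    unfolding has_eigenvalues_def by (simp add: poly_eq_poly_eq_iff[symmetric] fun_eq_iff)
qed

lemma eigenvalues_B_I:
  "has_eigenvalues B_I [3, complex_of_real (sqrt 5), 1, 0, -2, - complex_of_real (sqrt 5)]"
proof -
  define s where "s = complex_of_real (sqrt 5)"
  have s: "s * s = 5" unfolding s_def by (rule sqrt5_square)
  \<comment> \<open>This form catches a square hidden in a right-nested product.\<close>
  have s': "s * (s * w) = 5 * w" for w using s by (simp flip: mult.assoc)
  have "poly (char_poly B_I) z = poly (\<Prod>e\<leftarrow>[3, s, 1, 0, -2, - s]. [:- e, 1:]) z" for z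
    unfolding B_I_def
    by (subst char_poly_rows, simp, simp, simp add: upt_0_6 del: mult_minus_left mult_minus_right)
      (rule disjI2, simp add: algebra_simps s s')
  then show ?thesis
    unfolding has_eigenvalues_def s_def by (simp add: poly_eq_poly_eq_iff[symmetric] fun_eq_iff)
qed

lemma eigenvalues_B_II:
  "has_eigenvalues B_II [complex_of_real (sqrt 5), 1, 1, 0, -2, - complex_of_real (sqrt 5)]"
proof -
  define s where "s = complex_of_real (sqrt 5)"
  have s: "s * s = 5" unfolding s_def by (rule sqrt5_square)
  have s': "s * (s * w) = 5 * w" for w using s by (simp flip: mult.assoc)
  have "poly (char_poly B_II) z = poly (\<Prod>e\<leftarrow>[s, 1, 1, 0, -2, - s]. [:- e, 1:]) z" for z
    unfolding B_II_def
    by (subst char_poly_rows, simp, simp, simp add: upt_0_6 del: mult_minus_left mult_minus_right)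
      (rule disjI2, simp add: algebra_simps s s')
  then show ?thesis
    unfolding has_eigenvalues_def s_def by (simp add: poly_eq_poly_eq_iff[symmetric] fun_eq_iff)
qed

lemma sum_mult_vec: "(\<Sum>a\<in>I. f a) *v v = (\<Sum>a\<in>I. f a *v (v :: complex^'n))"
  by (induction I rule: infinite_finite_induct) (simp_all add: matrix_vector_mult_add_rdistrib)

section \<open>Pure bases\<close>

text \<open>\<open>Estar E x i\<close> fixes the basis vectors of support \<open>i\<close> and kills
  the others.\<close>

lemma EstarW_span:
  assumes len: "length is = length vs"
    and pure: "\<And>k. k < length vs \<Longrightarrow> pure_vector E x (is ! k) (vs ! k)"
  shows "EstarW E x i (vec.span (set vs)) = vec.span {vs ! k |k. k < length vs \<and> is ! k = i}"
    (is "_ = vec.span ?S")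
proof -
  have split: "Estar E x i *v v = v \<and> v \<in> ?S \<or> Estar E x i *v v = 0" if "v \<in> set vs" for v
  proof -
    from that obtain k where k: "k < length vs" "v = vs ! k" by (auto simp: in_set_conv_nth)
    have "Estar E x (is ! k) *v v = v" using pure[OF k(1)] k by (simp add: pure_vector_iff)
    then show ?thesis
      using Estar_Estar[of E x i "is ! k" v] k by (cases "is ! k = i") auto
  qed
  have fixed: "Estar E x i *v v = v" if "v \<in> ?S" for v
    using that pure by (auto simp: pure_vector_iff)
  have eq: "EstarW E x i (vec.span (set vs)) = vec.span ((*v) (Estar E x i) ` set vs)"
    unfolding EstarW_def by (rule vec.linear_span_image[symmetric]) simp
  show ?thesis
    unfolding eq
  proof (rule antisym; rule vec.span_minimal)
    show "(*v) (Estar E x i) ` set vs \<subseteq> vec.span ?S"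
    proof
      fix w assume "w \<in> (*v) (Estar E x i) ` set vs"
      then obtain v where v: "v \<in> set vs" "w = Estar E x i *v v" by auto
      show "w \<in> vec.span ?S"
        using split[OF v(1)]
      proof (elim disjE conjE)
        assume "Estar E x i *v v = v" "v \<in> ?S"
        then show ?thesis using vec.span_base[of v ?S] v(2) by simp
      qed (simp add: v(2) vec.span_zero)
    qed
    show "?S \<subseteq> vec.span ((*v) (Estar E x i) ` set vs)"
    proof
      fix v assume v: "v \<in> ?S"
      then have "v \<in> set vs" by auto
      then have "Estar E x i *v v \<in> (*v) (Estar E x i) ` set vs" by blast
      with fixed[OF v] show "v \<in> vec.span ((*v) (Estar E x i) ` set vs)"
        by (simp add: vec.span_base)
    qed
  qed (rule vec.subspace_span)+
qed

lemma dim_EstarW_span: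
  assumes len: "length is = length vs"
    and pure: "\<And>k. k < length vs \<Longrightarrow> pure_vector E x (is ! k) (vs ! k)"
    and vs: "distinct vs" "vec.independent (set vs)"
  shows "vec.dim (EstarW E x i (vec.span (set vs))) = count_list is i"
proof -
  let ?S = "{vs ! k |k. k < length vs \<and> is ! k = i}"
  have S: "?S = (!) vs ` {k. k < length vs \<and> is ! k = i}" by auto
  have inj: "inj_on ((!) vs) {k. k < length vs \<and> is ! k = i}"
    using vs(1) by (auto simp: inj_on_def nth_eq_iff_index_eq)
  have ind: "vec.independent ?S"
    by (rule vec.independent_mono[OF vs(2)]) auto
  have "vec.dim (EstarW E x i (vec.span (set vs))) = card ?S"
    using EstarW_span[OF len pure, of i] vec.dim_span_eq_card_independent[OF ind] by simp
  also have "\<dots> = card {k. k < length vs \<and> is ! k = i}"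
    unfolding S by (rule card_image[OF inj])
  also have "\<dots> = count_list is i"
    using len by (simp add: count_list_eq_length_filter length_filter_conv_card eq_commute)
  finally show ?thesis .
qed

text \<open>All numerical invariants are read off the list of supports, because
  \<open>count_list is i\<close> is the dimension of the component at distance
  \<open>i\<close>.\<close>

lemma pure_basis_data:
  assumes len: "length is = length vs"
    and pure: "\<And>k. k < length vs \<Longrightarrow> pure_vector E x (is ! k) (vs ! k)"
    and vs: "distinct vs" "vec.independent (set vs)"
    and "is": "sorted is" "is \<noteq> []" "\<And>i. i \<in> set is \<Longrightarrow> i \<le> gdiam E"
    and W: "W = vec.span (set vs)"
  shows "endpoint E x W = hd is"
    and "mod_diameter E x W = card (set is) - 1"
    and "shape E x W = map (count_list is) [hd is..<hd is + card (set is)]"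
    and "vec.dim W = length vs"
    and "pure_basis E x W vs"
proof -
  have dim: "vec.dim (EstarW E x i W) = count_list is i" for i
    unfolding W by (rule dim_EstarW_span[OF len pure vs])
  have nz: "EstarW E x i W \<noteq> {0} \<longleftrightarrow> i \<in> set is" for i
  proof -
    have "0 \<in> EstarW E x i W"
      unfolding W by (rule vec.subspace_0[OF subspace_EstarW[OF vec.subspace_span]])
    then have "EstarW E x i W \<noteq> {0} \<longleftrightarrow> vec.dim (EstarW E x i W) \<noteq> 0"
      by (auto simp: vec.dim_eq_0)
    then show ?thesis by (simp add: dim count_list_0_iff)
  qed
  show ep: "endpoint E x W = hd is"
    unfolding endpoint_def nz
  proof (rule Least_equality)
    show "hd is \<in> set is" using "is" by simp
    show "hd is \<le> i" if "i \<in> set is" for i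
      using "is" that by (cases "is") auto
  qed
  have "{i. i \<le> gdiam E \<and> i \<in> set is} = set is" using "is" by auto
  then show md: "mod_diameter E x W = card (set is) - 1"
    by (simp add: mod_diameter_def nz)
  have "card (set is) > 0" using "is" by (simp add: card_gt_0_iff)
  then show "shape E x W = map (count_list is) [hd is..<hd is + card (set is)]"
    unfolding shape_def ep md using dim by simp
  show "vec.dim W = length vs"
    unfolding W using vec.dim_span_eq_card_independent[OF vs(2)] distinct_card[OF vs(1)] by simp
  show "pure_basis E x W vs"
    unfolding pure_basis_def using assms by auto
qed

lemma represents_mult:
  assumes M: "represents M vs B" and N: "represents N vs C"
  shows "represents (M ** N) vs (B * C)"
  unfolding represents_def
proof (intro conjI allI impI)
  let ?n = "length vs"
  have B: "B \<in> carrier_mat ?n ?n" and C: "C \<in> carrier_mat ?n ?n"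
    using M N by (auto simp: represents_def)
  then show "B * C \<in> carrier_mat ?n ?n" by simp
  fix j assume j: "j < ?n"
  have "(M ** N) *v (vs ! j) = M *v (\<Sum>i<?n. C $$ (i, j) *s (vs ! i))"
    using N j by (simp add: represents_def flip: matrix_vector_mul_assoc)
  also have "\<dots> = (\<Sum>i<?n. C $$ (i, j) *s (\<Sum>k<?n. B $$ (k, i) *s (vs ! k)))"
    using M by (simp add: represents_def vec.sum mult_vec_scale)
  also have "\<dots> = (\<Sum>i<?n. \<Sum>k<?n. (B $$ (k, i) * C $$ (i, j)) *s (vs ! k))"
    by (simp add: vec.scale_sum_right vector_smult_assoc mult.commute)
  also have "\<dots> = (\<Sum>k<?n. \<Sum>i<?n. (B $$ (k, i) * C $$ (i, j)) *s (vs ! k))"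
    by (rule sum.swap)
  also have "\<dots> = (\<Sum>k<?n. (B * C) $$ (k, j) *s (vs ! k))"
    using B C j by (intro sum.cong) (auto simp: scalar_prod_def atLeast0LessThan vec.scale_sum_left)
  finally show "(M ** N) *v (vs ! j) = (\<Sum>k<?n. (B * C) $$ (k, j) *s (vs ! k))" .
qed

text \<open>The matrix depends on the supports only, not on the vectors;
  \<open>primitive_represents\<close> needs this uniformity for every generator.\<close>

lemma represents_Estar:
  assumes "length is = length vs"
    and pure: "\<And>k. k < length vs \<Longrightarrow> Estar E x (is ! k) *v (vs ! k) = vs ! k"
  shows "represents (Estar E x i) vs
    (Matrix.mat (length vs) (length vs) (\<lambda>(k, j). if k = j \<and> is ! j = i then 1 else 0))"
  unfolding represents_def
proof (intro conjI allI impI)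
  fix j assume j: "j < length vs"
  have "Estar E x i *v (vs ! j) = (if is ! j = i then vs ! j else 0)"
    using Estar_Estar[of E x i "is ! j" "vs ! j"] unfolding pure[OF j] by metis
  also have "\<dots> = (\<Sum>k<length vs. if k = j then (if is ! j = i then vs ! j else 0) else 0)"
    using j by simp
  also have "\<dots> = (\<Sum>k<length vs. Matrix.mat (length vs) (length vs)
      (\<lambda>(k, j). if k = j \<and> is ! j = i then 1 else 0) $$ (k, j) *s (vs ! k))"
    using j by (intro sum.cong) auto
  finally show "Estar E x i *v (vs ! j) = \<dots>" .
qed simp

lemma represents_span_closed:
  assumes "represents M vs B" "w \<in> vec.span (set vs)"
  shows "M *v w \<in> vec.span (set vs)"
proof -
  have "vec.subspace {w. M *v w \<in> vec.span (set vs)}"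
    by (simp add: vec.subspace_def matrix_vector_right_distrib mult_vec_scale vec.span_zero
        vec.span_add vec.span_scale)
  moreover have "set vs \<subseteq> {w. M *v w \<in> vec.span (set vs)}"
  proof
    fix v assume "v \<in> set vs"
    then obtain j where "j < length vs" "v = vs ! j" by (auto simp: in_set_conv_nth)
    then have "M *v v = (\<Sum>i<length vs. B $$ (i, j) *s (vs ! i))"
      using assms(1) by (simp add: represents_def)
    also have "\<dots> \<in> vec.span (set vs)"
      by (intro vec.span_sum vec.span_scale vec.span_base) auto
    finally show "v \<in> {w. M *v w \<in> vec.span (set vs)}" by simp
  qed
  ultimately show ?thesis
    using assms(2) vec.span_minimal by blast
qed

section \<open>Recognising modules, primitive idempotents and distinct isomorphism classes\<close>

context symmetric_graph
begin

lemma T_module_span: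
  assumes "represents A vs B" "length is = length vs"
    and "\<And>k. k < length vs \<Longrightarrow> Estar E x (is ! k) *v (vs ! k) = vs ! k"
  shows "T_module E x (vec.span (set vs))"
  by (rule T_moduleI)
    (use represents_span_closed[OF assms(1)] represents_span_closed[OF represents_Estar[OF assms(2,3)]]
      in auto)

lemma gen_eq_span:
  assumes "T_module E x (vec.span (set vs))" "u \<in> set vs" "set vs \<subseteq> gen u"
  shows "gen u = vec.span (set vs)"
  using gen_minimal[OF assms(1)] vec.span_base[OF assms(2)] vec.span_minimal[OF assms(3) subspace_gen]
  by blast

text \<open>When the image of \<open>e\<close> is a line, compressing any \<open>B\<close> to it can
  only give a scalar.\<close>

lemma primitive_rank_one:
  assumes e: "e \<in> T" "adjoint e = e" and u: "e *v u = u" and range: "\<And>v. \<exists>c. e *v v = c *s u"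
  shows "primitive e"
  unfolding primitive_def
proof (intro conjI ballI e)
  show "e ** e = e"
  proof (rule matrix_eqI)
    fix v
    from range[of v] obtain c where "e *v v = c *s u" by blast
    then show "(e ** e) *v v = e *v v"
      using u by (simp add: mult_vec_scale flip: matrix_vector_mul_assoc)
  qed
  fix B assume "B \<in> T"
  obtain l where l: "e *v (B *v u) = l *s u" using range by blast
  have "e ** B ** e = mscale l e"
  proof (rule matrix_eqI)
    fix v
    from range[of v] obtain c where "e *v v = c *s u" by blast
    then show "(e ** B ** e) *v v = mscale l e *v v"
      using l by (simp add: mult_vec_scale mscale_mult_vec vector_smult_assoc mult.commute
          flip: matrix_vector_mul_assoc)
  qed
  then show "\<exists>c. e ** B ** e = mscale c e" ..
qed

text \<open>If the vectors \<open>p u\<close> span a module on which \<open>A\<close> acts by a matrix that does not depend on \<open>u\<close>,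
  and \<open>u\<close> is the only one of them that \<open>e\<close> does not annihilate, then \<open>e B e\<close> is the multiplication by
  the corner entry of the matrix of \<open>B\<close>.\<close>

lemma primitive_represents:
  assumes e: "e \<in> T" "adjoint e = e" "e ** e = e"
    and len: "\<And>u. length (p u) = Suc n" "length is = Suc n"
    and hd: "\<And>u. e *v u = u \<Longrightarrow> p u ! 0 = u"
    and tl: "\<And>u k. e *v u = u \<Longrightarrow> 0 < k \<Longrightarrow> k \<le> n \<Longrightarrow> e *v (p u ! k) = 0"
    and pure: "\<And>u k. e *v u = u \<Longrightarrow> k \<le> n \<Longrightarrow> Estar E x (is ! k) *v (p u ! k) = p u ! k"
    and A: "\<And>u. e *v u = u \<Longrightarrow> represents A (p u) B\<^sub>A"
  shows "primitive e"
  unfolding primitive_def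
proof (intro conjI ballI e)
  \<comment> \<open>\<open>C\<close> is chosen before \<open>u\<close>: one matrix represents
    \<open>B\<close> for all fixed vectors \<open>u\<close> of \<open>e\<close> simultaneously.
    These \<open>B\<close> form a subalgebra containing the generators, hence all of
    \<open>T\<close>.\<close>
  let ?S = "{B. \<exists>C. \<forall>u. e *v u = u \<longrightarrow> represents B (p u) C}"
  let ?N = "Suc n"
  have "subalgebra ?S"
    unfolding subalgebra_def mat_space.subspace_def
  proof (intro conjI ballI allI)
    show "0 \<in> ?S"
      by (auto simp: represents_def len intro!: exI[of _ "0\<^sub>m ?N ?N"])
    have "represents (Finite_Cartesian_Product.mat 1) (p u) (1\<^sub>m ?N)" for u
      unfolding represents_def len(1)
    proof (intro conjI allI impI)
      fix j assume j: "j < ?N"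
      have "(\<Sum>i<?N. 1\<^sub>m ?N $$ (i, j) *s (p u ! i)) = (\<Sum>i<?N. if i = j then p u ! j else 0)"
        using j by (intro sum.cong) auto
      with j show "Finite_Cartesian_Product.mat 1 *v (p u ! j) =
          (\<Sum>i<?N. 1\<^sub>m ?N $$ (i, j) *s (p u ! i))"
        by (simp del: sum.lessThan_Suc)
    qed simp
    then show "Finite_Cartesian_Product.mat 1 \<in> ?S" by blast
  next
    fix M N assume "M \<in> ?S" "N \<in> ?S"
    then obtain B C where B: "\<And>u. e *v u = u \<Longrightarrow> represents M (p u) B"
      and C: "\<And>u. e *v u = u \<Longrightarrow> represents N (p u) C" by blast
    show "M ** N \<in> ?S" using represents_mult[OF B C] by blast
    have "represents (M + N) (p u) (B + C)" if "e *v u = u" for u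
      using B[OF that] C[OF that]
      by (auto simp: represents_def matrix_vector_mult_add_rdistrib sum.distrib vec.scale_left_distrib)
    then show "M + N \<in> ?S" by blast
  next
    fix c M assume "M \<in> ?S"
    then obtain B where B: "\<And>u. e *v u = u \<Longrightarrow> represents M (p u) B" by blast
    have "represents (mscale c M) (p u) (c \<cdot>\<^sub>m B)" if "e *v u = u" for u
      using B[OF that]
      by (auto simp: represents_def mscale_mult_vec vec.scale_sum_right vector_smult_assoc)
    then show "mscale c M \<in> ?S" by blast
  qed
  moreover have "Estar E x i \<in> ?S" for i
    using represents_Estar[of "is" "p _" E x i] pure len by (auto simp: less_Suc_eq_le)
  ultimately have "T \<subseteq> ?S" using A by (intro T_minimal) auto
  moreover fix B assume "B \<in> T"
  ultimately obtain C where C: "\<And>u. e *v u = u \<Longrightarrow> represents B (p u) C" by blast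
  have "e ** B ** e = mscale (C $$ (0, 0)) e"
  proof (rule matrix_eqI)
    fix v
    let ?u = "e *v v"
    have u: "e *v ?u = ?u" using e by (simp add: matrix_vector_mul_assoc)
    have "B *v ?u = (\<Sum>i\<le>n. C $$ (i, 0) *s (p ?u ! i))"
      using C[OF u] hd[OF u] len by (auto simp: represents_def lessThan_Suc_atMost)
    then have "e *v (B *v ?u) = (\<Sum>i\<le>n. C $$ (i, 0) *s (e *v (p ?u ! i)))"
      by (simp add: vec.sum mult_vec_scale)
    also have "\<dots> = (\<Sum>i\<le>n. if i = 0 then C $$ (0, 0) *s ?u else 0)"
      using hd[OF u] tl[OF u] u by (intro sum.cong) auto
    finally show "(e ** B ** e) *v v = mscale (C $$ (0, 0)) e *v v"
      by (simp add: mscale_mult_vec flip: matrix_vector_mul_assoc)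
  qed
  then show "\<exists>c. e ** B ** e = mscale c e" ..
qed

lemma separated_sym:
  assumes "adjoint e = e" "adjoint f = f" "\<And>B. B \<in> T \<Longrightarrow> e ** B ** f = 0" "B \<in> T"
  shows "f ** B ** e = 0"
proof -
  have "adjoint (e ** adjoint B ** f) = 0" using assms T_adjoint by simp
  then show ?thesis using assms by (simp add: adjoint_mult matrix_mul_assoc)
qed

text \<open>The conclusion for all \<open>B\<close> means that \<open>e\<close> kills every module
  generated by a vector in the image of \<open>f\<close>, so it is enough to enclose each such
  vector in some module killed by \<open>e\<close>.\<close>

lemma separatedI:
  assumes f: "f ** f = f"
    and "\<And>u. f *v u = u \<Longrightarrow> \<exists>U. T_module E x U \<and> u \<in> U \<and> (\<forall>w\<in>U. e *v w = 0)"
    and B: "B \<in> T"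
  shows "e ** B ** f = 0"
proof (rule matrix_eqI)
  fix v
  have "f *v (f *v v) = f *v v" using f by (simp add: matrix_vector_mul_assoc)
  with assms(2) obtain U where "T_module E x U" "f *v v \<in> U" "\<forall>w\<in>U. e *v w = 0" by blast
  then show "(e ** B ** f) *v v = 0 *v v"
    using B by (simp add: T_module_def flip: matrix_vector_mul_assoc)
qed

lemma separated_annihilates:
  assumes "\<And>B. B \<in> T \<Longrightarrow> e ** B ** f = 0" "f *v v = v" "w \<in> gen v"
  shows "e *v w = 0"
proof -
  obtain B where B: "B \<in> T" "w = B *v v" using assms(3) by (auto simp: gen_def)
  have "e *v w = (e ** B ** f) *v v"
    using assms(2) B by (simp flip: matrix_vector_mul_assoc)
  then show ?thesis using assms(1)[OF B(1)] by simp
qed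

lemma separated_not_isomorphic:
  assumes "e \<in> T" "\<And>B. B \<in> T \<Longrightarrow> e ** B ** f = 0" "e *v u = u" "u \<noteq> 0" "f *v v = v"
  shows "\<not> T_isomorphic E x (gen u) (gen v)"
  using T_isomorphic_nonzero[OF _ assms(1) T_module_gen gen_self, of u "gen v"]
    separated_annihilates[OF assms(2,5)] assms(3,4) by auto

lemma separated_orthogonal:
  assumes e: "adjoint e = e" "\<And>B. B \<in> T \<Longrightarrow> e ** B ** f = 0" "e *v u = u" "f *v v = v"
    and "u' \<in> gen u" "v' \<in> gen v"
  shows "herm u' v' = 0"
proof (rule herm_gen_gen[OF _ assms(5,6)])
  fix w assume "w \<in> gen v"
  then have "e *v w = 0" using separated_annihilates[OF e(2,4)] by blast
  then show "herm u w = 0"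
    using herm_adjoint[of e u w] e(1,3) by simp
qed

text \<open>For \<open>w\<close> in \<open>gen v\<close>, \<open>herm u w\<close> equals
  \<open>herm u (e *v w)\<close>, and \<open>e *v w\<close> is a multiple of
  \<open>v\<close>.\<close>

lemma primitive_orthogonal:
  assumes e: "primitive e" "e *v u = u" "e *v v = v" and "herm u v = 0"
    and "u' \<in> gen u" "v' \<in> gen v"
  shows "herm u' v' = 0"
proof (rule herm_gen_gen[OF _ assms(5,6)])
  fix w assume "w \<in> gen v"
  then obtain c where "e *v w = c *s v" by (rule primitive_gen[OF e(1,3)])
  then show "herm u w = 0"
    using herm_adjoint[of e u w] e \<open>herm u v = 0\<close> by (simp add: primitive_def herm_scale_right)
qed

text \<open>The elements \<open>q\<^sub>j e q\<^sub>k\<^sup>*\<close> of \<open>T\<close>, where \<open>q\<^sub>j u\<close> runs through an orthogonal basis of a module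
  of the class selected by \<open>e\<close>, are up to scalars the matrix units of a simple component of \<open>T\<close>.\<close>

theorem dim_terwilliger:
  fixes e :: "nat \<Rightarrow> complex^'v^'v" and n :: "nat \<Rightarrow> nat"
  assumes prim: "\<And>i. i < N \<Longrightarrow> primitive (e i)"
    and sep: "\<And>i j B. i < N \<Longrightarrow> j < N \<Longrightarrow> i \<noteq> j \<Longrightarrow> B \<in> T \<Longrightarrow> e i ** B ** e j = 0"
    and u: "\<And>i. i < N \<Longrightarrow> e i *v u i = u i" "\<And>i. i < N \<Longrightarrow> u i \<noteq> 0"
    and w: "\<And>i j. i < N \<Longrightarrow> j < n i \<Longrightarrow> w i j \<in> gen (u i)" "\<And>i j. i < N \<Longrightarrow> j < n i \<Longrightarrow> w i j \<noteq> 0"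
    and orth: "\<And>i j k. i < N \<Longrightarrow> j < n i \<Longrightarrow> k < n i \<Longrightarrow> j \<noteq> k \<Longrightarrow> herm (w i j) (w i k) = 0"
    and total: "(\<Sum>i<N. n i * vec.dim (range ((*v) (e i)))) = CARD('v)"
  shows "mat_space.dim T = (\<Sum>i<N. (n i)\<^sup>2)"
proof -
  have e: "e i \<in> T" "adjoint (e i) = e i" "e i *v (e i *v v) = e i *v v" if "i < N" for i v
    using prim[OF that] by (simp_all add: primitive_def matrix_vector_mul_assoc)
  have "\<exists>B\<in>T. w i j = B *v u i" if "i < N" "j < n i" for i j
    using w(1)[OF that] by (auto simp: gen_def)
  then obtain q where q: "\<And>i j. i < N \<Longrightarrow> j < n i \<Longrightarrow> q i j \<in> T \<and> w i j = q i j *v u i"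
    by metis
  \<comment> \<open>This is the scalar by which \<open>adjoint (q i j) ** q i j\<close>, compressed
    by \<open>e i\<close>, acts on the image of \<open>e i\<close>; dividing by it normalises the
    matrix units.\<close>
  define g where "g i j = herm (w i j) (w i j) / herm (u i) (u i)" for i j
  have g: "g i j \<noteq> 0" if "i < N" "j < n i" for i j
    using w(2)[OF that] u(2)[of i] that by (simp add: g_def)
  have key: "e i *v (adjoint (q i j) *v (q i' k *v (e i' *v v))) =
      (if i = i' \<and> j = k then g i j *s (e i *v v) else 0)"
    if i: "i < N" "j < n i" "i' < N" "k < n i'" for i i' j k v
  proof (cases "i = i'")
    case False
    then have "e i ** (adjoint (q i j) ** q i' k) ** e i' = 0"
      using sep i q by (simp add: T_mult T_adjoint)
    then have "(e i ** (adjoint (q i j) ** q i' k) ** e i') *v v = 0" by simp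
    with False show ?thesis by (simp flip: matrix_vector_mul_assoc)
  next
    case True
    have "adjoint (q i j) ** q i k \<in> T" using q i True by (simp add: T_mult T_adjoint)
    then obtain c where c: "\<And>v. e i *v v = v \<Longrightarrow> e i *v ((adjoint (q i j) ** q i k) *v v) = c *s v"
      using primitive_compress[OF prim[OF i(1)]] by blast
    have "c * herm (u i) (u i) = herm (e i *v ((adjoint (q i j) ** q i k) *v u i)) (u i)"
      using c[OF u(1)[OF i(1)]] by (simp add: herm_scale_left)
    also have "\<dots> = herm ((adjoint (q i j) ** q i k) *v u i) (u i)"
      using e u i by (simp add: herm_adjoint[of "e i"])
    also have "\<dots> = herm (w i k) (w i j)"
      using q i True by (simp add: herm_adjoint flip: matrix_vector_mul_assoc)
    finally have "c = (if j = k then g i j else 0)"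
      using u(2)[OF i(1)] orth[of i k j] i True by (auto simp: g_def field_simps)
    with c[of "e i *v v"] e i True show ?thesis
      by (auto simp flip: matrix_vector_mul_assoc)
  qed
  \<comment> \<open>The blocks \<open>S (i, j)\<close> are pairwise orthogonal, each has the
    dimension of the image of \<open>e i\<close>, and by \<open>total\<close> they fill the whole
    space.\<close>
  define I where "I = (SIGMA i:{..<N}. {..<n i})"
  define S where "S = (\<lambda>(i, j). (\<lambda>v. q i j *v (e i *v v)) ` UNIV)"
  have I: "finite I" by (simp add: I_def)
  have S_sub: "vec.subspace (S a)" for a
  proof -
    have "S a = range ((*v) (q (fst a) (snd a) ** e (fst a)))"
      by (simp add: S_def case_prod_unfold matrix_vector_mul_assoc)
    then show ?thesis
      using vec.linear_subspace_image[OF matrix_vector_mul_linear_gen vec.subspace_UNIV] by metis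
  qed
  have S_herm: "herm (q i j *v (e i *v v)) (q i' k *v (e i' *v v')) =
      (if i = i' \<and> j = k then cnj (g i j) * herm (e i *v v) (e i *v v') else 0)"
    if "(i, j) \<in> I" "(i', k) \<in> I" for i i' j k v v'
  proof -
    have i: "i < N" "j < n i" "i' < N" "k < n i'" using that by (auto simp: I_def)
    have "herm (q i j *v (e i *v v)) (q i' k *v (e i' *v v')) =
        herm (e i *v (e i *v v)) (adjoint (q i j) *v (q i' k *v (e i' *v v')))"
      using e i by (simp add: herm_adjoint)
    also have "\<dots> = herm (e i *v v) (e i *v (adjoint (q i j) *v (q i' k *v (e i' *v v'))))"
      using e i by (simp only: herm_adjoint)
    finally show ?thesis
      unfolding key[OF i] by (auto simp: herm_scale_right)
  qed
  have S_orth: "herm v v' = 0" if "a \<in> I" "b \<in> I" "a \<noteq> b" "v \<in> S a" "v' \<in> S b" for a b v v'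
    using that S_herm by (auto simp: S_def split: prod.splits)
  have S_dim: "vec.dim (S a) = vec.dim (range ((*v) (e (fst a))))" if "a \<in> I" for a
  proof -
    obtain i j where a: "a = (i, j)" by (cases a)
    have i: "i < N" "j < n i" using that a by (auto simp: I_def)
    have img: "S a = (*v) (q i j) ` range ((*v) (e i))" by (auto simp: S_def a)
    have sub: "vec.subspace (range ((*v) (e i)))"
      by (rule vec.linear_subspace_image) auto
    have "inj_on ((*v) (q i j)) (range ((*v) (e i)))"
    proof (rule inj_onI, clarify)
      fix v v' assume "q i j *v (e i *v v) = q i j *v (e i *v v')"
      then have "q i j *v (e i *v (v - v')) = 0"
        by (simp add: matrix_vector_mult_diff_distrib)
      then have "e i *v (v - v') = 0"
        using S_herm[of i j i j "v - v'" "v - v'"] that a g[OF i] by simp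
      then show "e i *v v = e i *v v'" by (simp add: matrix_vector_mult_diff_distrib)
    qed
    then have "vec.dim ((*v) (q i j) ` range ((*v) (e i))) = vec.dim (range ((*v) (e i)))"
      by (intro vec.dim_image_eq matrix_vector_mul_linear_gen)
        (simp only: vec.span_eq_iff[THEN iffD2, OF sub])
    then show ?thesis unfolding img by (simp only: a fst_conv)
  qed
  have "vec.dim (vec.span (\<Union>a\<in>I. S a)) = (\<Sum>a\<in>I. vec.dim (S a))"
    by (rule dim_span_Union_orthogonal[OF I S_sub S_orth])
  also have "\<dots> = (\<Sum>(i, j)\<in>I. vec.dim (range ((*v) (e i))))"
    by (rule sum.cong) (auto simp: S_dim)
  also have "\<dots> = CARD('v)"
    unfolding I_def using total by (simp flip: sum.Sigma)
  finally have span: "vec.span (\<Union>a\<in>I. S a) = UNIV"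
    by (metis vec.dim_eq_full vec.dim_span vec.dimension_def card_cart_basis vec.span_span)
  \<comment> \<open>\<open>X a\<close> is the orthogonal projection onto \<open>S a\<close>; these
    projections sum to the identity.\<close>
  define X where "X = (\<lambda>(i, j). mscale (1 / g i j) (q i j ** e i ** adjoint (q i j)))"
  have X_sum: "(\<Sum>a\<in>I. X a *v v) = v" for v
  proof -
    have "(\<Sum>a\<in>I. X a *v v) = v" if v: "v \<in> S b" and b: "b \<in> I" for v b
    proof -
      obtain i j where ij: "b = (i, j)" by (cases b)
      obtain z where z: "v = q i j *v (e i *v z)" using v ij by (auto simp: S_def)
      have i: "i < N" "j < n i" using b ij by (auto simp: I_def)
      have "X a *v v = (if a = b then v else 0)" if a: "a \<in> I" for a
      proof -
        obtain i' k where a': "a = (i', k)" by (cases a)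
        have i': "i' < N" "k < n i'" using a a' by (auto simp: I_def)
        have "X a *v v = (1 / g i' k) *s (q i' k *v (e i' *v (adjoint (q i' k) *v v)))"
          by (simp add: X_def a' mscale_mult_vec flip: matrix_vector_mul_assoc)
        also have "\<dots> = (if a = b then v else 0)"
          unfolding z key[OF i' i] using g[OF i] by (simp add: a' ij mult_vec_scale vector_smult_assoc)
        finally show ?thesis .
      qed
      then have "(\<Sum>a\<in>I. X a *v v) = (\<Sum>a\<in>I. if a = b then v else 0)" by (rule sum.cong[OF refl])
      then show ?thesis using I b by simp
    qed
    moreover have "vec.subspace {v. (\<Sum>a\<in>I. X a *v v) = v}"
      by (simp add: vec.subspace_def matrix_vector_right_distrib sum.distrib mult_vec_scale
          flip: vec.scale_sum_right)
    ultimately have "vec.span (\<Union>a\<in>I. S a) \<subseteq> {v. (\<Sum>a\<in>I. X a *v v) = v}"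
      by (intro vec.span_minimal) auto
    with span show ?thesis by auto
  qed
  define K where "K = (SIGMA i:{..<N}. {..<n i} \<times> {..<n i})"
  define M where "M = (\<lambda>(i, j, k). q i j ** e i ** adjoint (q i k))"
  have K: "finite K" "card K = (\<Sum>i<N. (n i)\<^sup>2)"
    by (simp_all add: K_def power2_eq_square)
  have "M a \<in> T" if "a \<in> K" for a
    using that q e by (auto simp: K_def M_def intro!: T_mult T_adjoint)
  then have M_T: "M ` K \<subseteq> T" by blast
  \<comment> \<open>\<open>B\<close> is the double sum of the products
    \<open>X a ** B ** X b\<close>. Each contains a factor \<open>e i ** C ** e i'\<close> with
    \<open>C\<close> in \<open>T\<close>, which vanishes for different classes and is a multiple of
    \<open>e i\<close> within one class.\<close>
  have span_M: "B \<in> mat_space.span (M ` K)" if B: "B \<in> T" for B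
  proof -
    have "X a ** B ** X b \<in> mat_space.span (M ` K)" if a: "a \<in> I" and b: "b \<in> I" for a b
    proof -
      obtain i j i' k where ab: "a = (i, j)" "b = (i', k)" by (cases a, cases b)
      have i: "i < N" "j < n i" "i' < N" "k < n i'" using a b ab by (auto simp: I_def)
      define C where "C = adjoint (q i j) ** B ** q i' k"
      have C: "C \<in> T" using q i B by (simp add: C_def T_mult T_adjoint)
      have eq: "X a ** B ** X b =
          mscale (1 / g i j * (1 / g i' k)) (q i j ** (e i ** C ** e i') ** adjoint (q i' k))"
        by (simp add: ab X_def C_def mscale_mult_left mscale_mult_right matrix_mul_assoc
            mat_space.scale_scale mult.commute)
      show ?thesis
      proof (cases "i = i'")
        case False
        then have "e i ** C ** e i' = 0" using sep i C by blast
        then have "X a ** B ** X b = 0" using eq by simp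
        then show ?thesis by (simp add: mat_space.span_zero)
      next
        case True
        obtain c where "e i ** C ** e i' = mscale c (e i)"
          using prim[OF i(1)] C True by (auto simp: primitive_def)
        then have "X a ** B ** X b = mscale (1 / g i j * (1 / g i' k) * c) (M (i, j, k))"
          using eq True by (simp add: M_def mscale_mult_left mscale_mult_right)
        moreover have "(i, j, k) \<in> K" using i True by (simp add: K_def)
        ultimately show ?thesis
          by (simp add: mat_space.span_scale mat_space.span_base)
      qed
    qed
    then have "(\<Sum>a\<in>I. \<Sum>b\<in>I. X a ** B ** X b) \<in> mat_space.span (M ` K)"
      by (intro mat_space.span_sum) auto
    moreover have "(\<Sum>a\<in>I. \<Sum>b\<in>I. X a ** B ** X b) = B"
    proof (rule matrix_eqI)
      fix v
      have "(\<Sum>a\<in>I. \<Sum>b\<in>I. X a ** B ** X b) *v v = (\<Sum>a\<in>I. X a *v (B *v (\<Sum>b\<in>I. X b *v v)))"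
        by (simp add: sum_mult_vec vec.sum flip: matrix_vector_mul_assoc)
      then show "(\<Sum>a\<in>I. \<Sum>b\<in>I. X a ** B ** X b) *v v = B *v v"
        by (simp add: X_sum)
    qed
    ultimately show ?thesis by simp
  qed
  \<comment> \<open>Compressing by \<open>q i j\<close> on the left and \<open>q i k\<close> on the
    right isolates the coefficient of \<open>M (i, j, k)\<close>; injectivity of \<open>M\<close> on
    \<open>K\<close> and independence both follow.\<close>
  have corner: "e i *v (adjoint (q i j) *v (M b *v (q i k *v u i))) =
      (if b = (i, j, k) then (g i j * g i k) *s u i else 0)"
    if a: "(i, j, k) \<in> K" and b: "b \<in> K" for i j k b
  proof -
    obtain i' j' k' where b': "b = (i', j', k')" by (cases b)
    have i: "i < N" "j < n i" "k < n i" "i' < N" "j' < n i'" "k' < n i'"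
      using a b b' by (auto simp: K_def)
    have "M b *v (q i k *v u i) = q i' j' *v (e i' *v (adjoint (q i' k') *v (q i k *v (e i *v u i))))"
      using u i by (simp add: M_def b' flip: matrix_vector_mul_assoc)
    also have "\<dots> = (if i' = i \<and> k' = k then g i k *s (q i j' *v (e i *v u i)) else 0)"
      using key[of i' k' i k "u i"] i by (auto simp: mult_vec_scale)
    finally show ?thesis
      using key[of i j i j' "u i"] i u by (auto simp: b' mult_vec_scale vector_smult_assoc mult.commute)
  qed
  have inj: "inj_on M K"
  proof (rule inj_onI)
    fix a b assume ab: "a \<in> K" "b \<in> K" "M a = M b"
    obtain i j k where a: "a = (i, j, k)" by (cases a)
    have "i < N" "j < n i" "k < n i" using ab a by (auto simp: K_def)
    then have nz: "(g i j * g i k) *s u i \<noteq> 0" using g u(2) by simp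
    have aK: "(i, j, k) \<in> K" using ab(1) a by simp
    show "a = b"
    proof (rule ccontr)
      assume "a \<noteq> b"
      then have "b \<noteq> (i, j, k)" using a by simp
      then have "e i *v (adjoint (q i j) *v (M b *v (q i k *v u i))) = 0"
        using corner[OF aK ab(2)] by simp
      then show False
        using corner[OF aK ab(1)] nz a ab(3) by simp
    qed
  qed
  have "mat_space.independent (M ` K)"
  proof (rule mat_space.independent_if_scalars_zero)
    fix f B assume 0: "(\<Sum>B\<in>M ` K. mscale (f B) B) = 0" and "B \<in> M ` K"
    then obtain a where "a \<in> K" "B = M a" by blast
    then obtain i j k where a: "(i, j, k) \<in> K" "B = M (i, j, k)" by (cases a) auto
    have i: "i < N" "j < n i" "k < n i" using a by (auto simp: K_def)
    have "(\<Sum>b\<in>K. mscale (f (M b)) (M b)) = 0"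
      using 0 by (simp add: sum.reindex[OF inj])
    then have "0 = e i *v (adjoint (q i j) *v ((\<Sum>b\<in>K. mscale (f (M b)) (M b)) *v (q i k *v u i)))"
      by simp
    also have "\<dots> = (\<Sum>b\<in>K. f (M b) *s (e i *v (adjoint (q i j) *v (M b *v (q i k *v u i)))))"
      by (simp add: sum_mult_vec mscale_mult_vec vec.sum mult_vec_scale)
    also have "\<dots> = (\<Sum>b\<in>K. if b = (i, j, k) then f B *s ((g i j * g i k) *s u i) else 0)"
      using corner[OF a(1)] a(2) by (intro sum.cong) auto
    also have "\<dots> = f B *s ((g i j * g i k) *s u i)"
      using a(1) K(1) by simp
    finally show "f B = 0" using g[OF i(1,2)] g[OF i(1,3)] u(2)[OF i(1)] by simp
  qed (use K in simp)
  then have "card (M ` K) = mat_space.dim T"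
    using M_T span_M by (intro mat_space.basis_card_eq_dim) auto
  then show ?thesis
    using card_image[OF inj] K(2) by simp
qed

end

lemma card_1_unique: "card S = 1 \<Longrightarrow> a \<in> S \<Longrightarrow> b \<in> S \<Longrightarrow> a = b"
  by (metis card_1_singletonE singletonD)

section \<open>Distances in connected graphs\<close>

context
  fixes E :: "'v \<Rightarrow> 'v \<Rightarrow> bool"
  assumes conn: "connected_graph E"
begin

lemma gdist_path: "(E ^^ gdist E y z) y z"
proof -
  have "\<exists>n. (E ^^ n) y z"
    using conn rtranclp_imp_relpowp[of E y z] by (auto simp: connected_graph_def)
  then show ?thesis unfolding gdist_def by (rule LeastI_ex)
qed

lemma gdist_le: "(E ^^ n) y z \<Longrightarrow> gdist E y z \<le> n"
  unfolding gdist_def by (rule Least_le)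

lemma gdist_eq_0 [simp]: "gdist E y z = 0 \<longleftrightarrow> y = z"
  using gdist_path[of y z] gdist_le[of 0 y z] by (cases "gdist E y z") auto

lemma gdist_eq_1: "gdist E y z = Suc 0 \<longleftrightarrow> E y z"
proof
  assume "gdist E y z = Suc 0"
  then show "E y z" using gdist_path[of y z] by (auto simp: eq_OO)
next
  assume "E y z"
  then have "gdist E y z \<le> 1" "y \<noteq> z"
    using gdist_le[of 1 y z] conn by (auto simp: connected_graph_def irreflp_def)
  then show "gdist E y z = Suc 0" using gdist_eq_0[of y z] by linarith
qed

lemma relpowp_sym: "(E ^^ n) y z \<Longrightarrow> (E ^^ n) z y"
proof (induction n arbitrary: z)
  case (Suc n)
  then obtain w where "(E ^^ n) y w" "E w z" by auto
  with Suc.IH conn show ?case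
    by (metis relpowp_Suc_I2 connected_graph_def sympD)
qed simp

lemma gdist_sym: "gdist E y z = gdist E z y"
  using gdist_le relpowp_sym gdist_path by (metis order_antisym)

lemma gdist_step: "E z w \<Longrightarrow> gdist E y w \<le> Suc (gdist E y z)"
  by (rule gdist_le) (use gdist_path in auto)

lemma gdist_pred:
  assumes "gdist E y z = Suc n"
  obtains w where "E w z" "gdist E y w = n"
proof -
  have "(E ^^ Suc n) y z" using gdist_path[of y z] assms by simp
  then obtain w where w: "(E ^^ n) y w" "E w z" by auto
  with gdist_le[OF w(1)] gdist_step[OF w(2), of y] assms have "gdist E y w = n" by simp
  with w that show thesis by blast
qed

end

section \<open>The dodecahedron graph\<close>

text \<open>Around the base vertex \<open>0\<close>, the six vertices at distance two form, by edges (5,6), (7,8), (9,4) and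
  common neighbours \<open>1, 2, 3\<close>, a hexagon \<open>4, \<dots>, 9\<close>; vertex \<open>10 + i\<close> is the neighbour of \<open>4 + i\<close> at
  distance three.\<close>

definition nbrs :: "nat list list" where
  "nbrs = [[1, 2, 3], [0, 4, 5], [0, 6, 7], [0, 8, 9],
     [1, 9, 10], [1, 6, 11], [2, 5, 12], [2, 8, 13], [3, 7, 14], [3, 4, 15],
     [4, 11, 18], [5, 10, 16], [6, 13, 16], [7, 12, 17], [8, 15, 17], [9, 14, 18],
     [11, 12, 19], [13, 14, 19], [10, 15, 19], [16, 17, 18]]"

definition level :: "nat list" where
  "level = [0, 1, 1, 1, 2, 2, 2, 2, 2, 2, 3, 3, 3, 3, 3, 3, 4, 4, 4, 5]"

lemma less_20: "{..<20} = {0, 1, 2, 3, 4, 5, 6, 7, 8, 9, 10, 11, 12, 13, 14, 15, 16, 17, 18, 19::nat}"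
proof -
  have "[0..<20] = [0, 1, 2, 3, 4, 5, 6, 7, 8, 9, 10, 11, 12, 13, 14, 15, 16, 17, 18, 19::nat]"
    by (simp add: upt_rec)
  from arg_cong[OF this, of set] show ?thesis
    by (simp only: set_upt atLeast0LessThan list.set)
qed

lemma all_less_20: "(\<forall>k<20. P k) \<longleftrightarrow> (\<forall>k\<in>{0, 1, 2, 3, 4, 5, 6, 7, 8, 9, 10, 11, 12, 13, 14, 15, 16,
    17, 18, 19::nat}. P k)"
  by (simp only: less_20[symmetric] lessThan_iff Ball_def)

text \<open>The distances are recorded along with the adjacencies so that \<open>Estar\<close> can
  be read off coordinates without evaluating \<open>gdist\<close> again.\<close>

definition dodecahedron_labelling :: "('v \<Rightarrow> 'v \<Rightarrow> bool) \<Rightarrow> 'v \<Rightarrow> 'v list \<Rightarrow> bool" where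
  "dodecahedron_labelling E x vs \<longleftrightarrow> length vs = 20 \<and> distinct vs \<and> set vs = UNIV \<and> vs ! 0 = x \<and>
     (\<forall>k<20. {z. E (vs ! k) z} = (!) vs ` set (nbrs ! k)) \<and>
     (\<forall>k<20. gdist E x (vs ! k) = level ! k)"

locale dodecahedron =
  fixes E :: "'v::finite \<Rightarrow> 'v \<Rightarrow> bool"
  assumes dodecahedron: "dodecahedron_graph E"
begin

lemma conn: "connected_graph E"
  using dodecahedron by (simp add: dodecahedron_graph_def distance_regular_def)

lemma E_sym: "E y z \<Longrightarrow> E z y"
  using conn by (auto simp: connected_graph_def symp_def)

lemma gdiam: "gdiam E = 5"
proof -
  have "length (fst (intersection_array E)) = 5"
    using dodecahedron by (simp add: dodecahedron_graph_def)
  then show ?thesis by (simp add: intersection_array_def)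
qed

lemma gdist_le_5: "gdist E y z \<le> 5"
proof -
  have "gdist E y z \<le> gdiam E"
    unfolding gdiam_def by (rule Max_ge) (auto intro: image_eqI[of _ _ "(y, z)"])
  then show ?thesis by (simp add: gdiam)
qed

lemma intersection_count:
  assumes "gdist E z y = h" "j \<le> 5"
  shows "card {w. E y w \<and> gdist E z w = j} = intersection_number E h 1 j"
proof -
  obtain p where p: "\<And>y z. gdist E y z = h \<Longrightarrow> card (sphere_at E 1 y \<inter> sphere_at E j z) = p"
    using dodecahedron gdist_le_5[of z y] assms
    unfolding dodecahedron_graph_def distance_regular_def gdiam by (metis one_le_numeral)
  have yz: "gdist E y z = h" using assms gdist_sym[OF conn] by metis
  have "intersection_number E h 1 j = p"
    unfolding intersection_number_def
  proof (rule the_equality)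
    fix q assume "\<forall>y z. gdist E y z = h \<longrightarrow> card (sphere_at E 1 y \<inter> sphere_at E j z) = q"
    with p yz show "q = p" by metis
  qed (use p in blast)
  also have "p = card (sphere_at E 1 y \<inter> sphere_at E j z)" using p yz by simp
  also have "sphere_at E 1 y \<inter> sphere_at E j z = {w. E y w \<and> gdist E z w = j}"
    by (auto simp: sphere_at_def gdist_eq_1[OF conn])
  finally show ?thesis by simp
qed

lemma intersection_numbers:
  "i < 5 \<Longrightarrow> intersection_number E i 1 (Suc i) = [3, 2, 1, 1, 1] ! i"
  "i < 5 \<Longrightarrow> intersection_number E (Suc i) 1 i = [1, 1, 1, 2, 3] ! i"
proof -
  have arr: "map (\<lambda>i. intersection_number E i 1 (i + 1)) [0..<5] = [3, 2, 1, 1, 1]"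
    "map (\<lambda>i. intersection_number E i 1 (i - 1)) [1..<6] = [1, 1, 1, 2, 3]"
    using dodecahedron by (simp_all add: dodecahedron_graph_def intersection_array_def gdiam)
  show "intersection_number E i 1 (Suc i) = [3, 2, 1, 1, 1] ! i" if "i < 5"
    using arg_cong[OF arr(1), of "\<lambda>l. l ! i"] that by simp
  show "intersection_number E (Suc i) 1 i = [1, 1, 1, 2, 3] ! i" if "i < 5"
    using arg_cong[OF arr(2), of "\<lambda>l. l ! i"] that by simp
qed

lemma up: "gdist E z y = i \<Longrightarrow> i < 5 \<Longrightarrow>
    card {w. E y w \<and> gdist E z w = Suc i} = [3, 2, 1, 1, 1] ! i"
  and down: "gdist E z y = Suc i \<Longrightarrow> i < 5 \<Longrightarrow>
    card {w. E y w \<and> gdist E z w = i} = [1, 1, 1, 2, 3] ! i"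
  using intersection_count[of z y] intersection_numbers by auto

lemma degree: "card {w. E y w} = 3"
  using up[of y y 0] by (simp add: gdist_eq_0[OF conn] gdist_eq_1[OF conn])

lemma neighbours:
  assumes "E y a" "E y b" "E y c" "distinct [a, b, c]"
  shows "{w. E y w} = {a, b, c}"
  by (rule card_subset_eq[symmetric]) (use assms degree in auto)

text \<open>The neighbours of \<open>y\<close> have distance \<open>i\<close>, \<open>i + 1\<close>
  or \<open>i + 2\<close> from \<open>z\<close>, so b_(i+1) and c_(i+1) leave this remainder of the
  degree 3. The lists hold b_1 to b_4 and c_1 to c_4; the values a_1 to a_4 are 0, 1, 1, 0.\<close>

lemma card_same_level:
  assumes "gdist E z y = Suc i" "i < 4"
  shows "card {w. E y w \<and> gdist E z w = Suc i} = 3 - [2, 1, 1, 1] ! i - [1, 1, 1, 2] ! i"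
proof -
  let ?N = "\<lambda>j. {w. E y w \<and> gdist E z w = j}"
  have "gdist E z w \<in> {i, Suc i, Suc (Suc i)}" if "E y w" for w
    using gdist_step[OF conn that, of z] gdist_step[OF conn E_sym[OF that], of z] assms by auto
  then have "{w. E y w} = ?N i \<union> ?N (Suc i) \<union> ?N (Suc (Suc i))" by blast
  then have "3 = card (?N i \<union> ?N (Suc i) \<union> ?N (Suc (Suc i)))" using degree[of y] by metis
  also have "\<dots> = card (?N i) + card (?N (Suc i)) + card (?N (Suc (Suc i)))"
    by (subst card_Un_disjoint; (subst card_Un_disjoint)?) auto
  finally have "card (?N (Suc i)) = 3 - card (?N (Suc (Suc i))) - card (?N i)" by simp
  moreover have "card (?N (Suc (Suc i))) = [3, 2, 1, 1, 1] ! Suc i" by (rule up) (use assms in auto)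
  moreover have "card (?N i) = [1, 1, 1, 2, 3] ! i" by (rule down) (use assms in auto)
  moreover have "[3, 2, 1, 1, 1] ! Suc i = [2, 1, 1, 1::nat] ! i" by simp
  moreover have "[1, 1, 1, 2, 3] ! i = [1, 1, 1, 2::nat] ! i"
    using assms(2) by (auto simp: less_Suc_eq numeral_eq_Suc)
  ultimately show ?thesis by simp
qed

lemma triangle_free: "E a b \<Longrightarrow> E b c \<Longrightarrow> \<not> E a c"
  using card_same_level[of a b 0] by (auto simp: gdist_eq_1[OF conn])

lemma gdist_2: "E a b \<Longrightarrow> E b c \<Longrightarrow> a \<noteq> c \<Longrightarrow> gdist E a c = 2"
  using gdist_step[OF conn, of b c a] gdist_eq_1[OF conn] gdist_eq_0[OF conn] triangle_free[of a b c]
  by (metis One_nat_def Suc_1 le_Suc_eq le_zero_eq)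

text \<open>\<open>b\<close> and \<open>d\<close> are common neighbours of two vertices at distance
  two, and c_2 = 1.\<close>

lemma square_free:
  assumes "E a b" "E b c" "E c d" "E d a" "a \<noteq> c"
  shows "b = d"
proof -
  have "card {w. E c w \<and> gdist E a w = 1} = 1"
    using down[of a c 1] gdist_2[OF assms(1,2,5)] by simp
  moreover have "b \<in> {w. E c w \<and> gdist E a w = 1}" "d \<in> {w. E c w \<and> gdist E a w = 1}"
    using assms E_sym by (auto simp: gdist_eq_1[OF conn])
  ultimately show ?thesis by (rule card_1_unique)
qed

text \<open>Since a_2 = 1, \<open>c\<close> has a neighbour \<open>d\<close> at distance two from
  \<open>a\<close>; a common neighbour \<open>e\<close> of \<open>d\<close> and \<open>a\<close>
  closes the cycle.\<close>

lemma pentagon: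
  assumes "E a b" "E b c" "a \<noteq> c"
  obtains d e where "E c d" "E d e" "E e a" "d \<noteq> b" "e \<noteq> b"
proof -
  have "gdist E a c = 2" using gdist_2 assms by blast
  then have "card {w. E c w \<and> gdist E a w = 2} = 1"
    using card_same_level[of a c 1] by (simp add: numeral_2_eq_2)
  then obtain d where d: "E c d" "gdist E a d = 2" by (auto simp: card_1_singleton_iff)
  then obtain e where e: "E e d" "gdist E a e = 1"
    using gdist_pred[OF conn, of a d 1] by (metis Suc_1)
  have "d \<noteq> b" using d assms gdist_eq_1[OF conn, of a b] by auto
  moreover have "e \<noteq> b" using e d assms triangle_free by blast
  ultimately show thesis
    using that d e E_sym by (metis One_nat_def gdist_eq_1[OF conn])
qed

lemma unique_up:
  assumes "gdist E z y = i" "i \<in> {2, 3, 4}"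
  obtains m where "E y m" "gdist E z m = Suc i" "\<And>w. E y w \<Longrightarrow> gdist E z w = Suc i \<Longrightarrow> w = m"
proof -
  have "card {w. E y w \<and> gdist E z w = Suc i} = 1" using up[OF assms(1)] assms(2) by auto
  then obtain m where "{w. E y w \<and> gdist E z w = Suc i} = {m}" by (auto simp: card_1_singleton_iff)
  with that show thesis by blast
qed

lemma unique_down:
  assumes "gdist E z m = 3" "E m y" "E m y'" "gdist E z y = 2" "gdist E z y' = 2"
  shows "y = y'"
proof -
  have "card {w. E m w \<and> gdist E z w = 2} = 1" using down[of z m 2] assms(1) by simp
  then show ?thesis by (rule card_1_unique) (use assms in auto)
qed

text \<open>The neighbours of \<open>y\<close> would be \<open>z\<close>, \<open>y'\<close> and
  \<open>y''\<close>, none of them at distance three from \<open>x\<close>, against b_2 = 1.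
  Consequently the two pentagons over \<open>z\<close> and the other neighbours of \<open>x\<close>
  leave \<open>z\<close> along different edges.\<close>

lemma siblings_distinct:
  assumes z: "distinct [z, z', z'']" "E x z" "E x z'" "E x z''"
    and y: "E z y" "E y y'" "E y' z'" "y \<noteq> x" "E y y''" "E y'' z''" "y' \<noteq> x"
  shows False
proof -
  have y2: "gdist E x y = 2" using gdist_2[OF z(2) y(1)] y(4) by auto
  have "y' \<noteq> y''"
    using square_free[of x z' y' z''] z y E_sym by auto
  moreover have "z \<noteq> y'" "z \<noteq> y''"
    using triangle_free[of x z z'] triangle_free[of x z z''] z y E_sym by blast+
  ultimately have N: "{w. E y w} = {z, y', y''}"
    using neighbours[of y z y' y''] y E_sym by auto
  have "gdist E x w \<noteq> 3" if "w \<in> {z, y', y''}" for w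
  proof -
    have "gdist E x z = 1" "gdist E x z' = 1" "gdist E x z'' = 1"
      using z by (simp_all add: gdist_eq_1[OF conn])
    then have "gdist E x w \<le> 2"
      using that gdist_step[OF conn E_sym[OF y(3)], of x] gdist_step[OF conn E_sym[OF y(6)], of x]
      by auto
    then show ?thesis by simp
  qed
  then have "{w. E y w \<and> gdist E x w = 3} = {}" using N by blast
  then have "card {w. E y w \<and> gdist E x w = 3} = 0" by (simp only: card.empty)
  moreover have "card {w. E y w \<and> gdist E x w = 3} = 1" using up[OF y2] by simp
  ultimately show False by linarith
qed

theorem ex_labelling:
  assumes "ordering_of zs (sphere_at E 1 x)"
  shows "\<exists>vs. dodecahedron_labelling E x vs \<and> zs = [vs ! 1, vs ! 2, vs ! 3]"
proof -
  note d0 = gdist_eq_0[OF conn] and d1 = gdist_eq_1[OF conn] and step = gdist_step[OF conn]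
  have zs: "distinct zs" "set zs = {w. E x w}"
    using assms by (auto simp: ordering_of_def sphere_at_def d1)
  then have "length zs = 3" using degree[of x] distinct_card by metis
  then obtain z0 z1 z2 where zs_eq: "zs = [z0, z1, z2]"
    by (auto simp: numeral_3_eq_3 length_Suc_conv)
  have z: "distinct [z0, z1, z2]" "E x z0" "E x z1" "E x z2" "{w. E x w} = {z0, z1, z2}"
    using zs zs_eq by auto
  have lz: "gdist E x z0 = 1" "gdist E x z1 = 1" "gdist E x z2 = 1"
    using z d1 by auto
  \<comment> \<open>One pentagon over each pair of neighbours of \<open>x\<close>; together they
    supply the hexagon, two vertices next to each of \<open>z0\<close>, \<open>z1\<close>,
    \<open>z2\<close>.\<close>
  obtain y2 y1 where y12: "E z1 y2" "E y2 y1" "E y1 z0" "y2 \<noteq> x" "y1 \<noteq> x"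
    using pentagon[of z0 x z1] z E_sym by auto
  obtain y4 y3 where y34: "E z2 y4" "E y4 y3" "E y3 z1" "y4 \<noteq> x" "y3 \<noteq> x"
    using pentagon[of z1 x z2] z E_sym by auto
  obtain y0 y5 where y50: "E z0 y0" "E y0 y5" "E y5 z2" "y0 \<noteq> x" "y5 \<noteq> x"
    using pentagon[of z2 x z0] z E_sym by auto
  have ly: "gdist E x y0 = 2" "gdist E x y1 = 2" "gdist E x y2 = 2" "gdist E x y3 = 2"
    "gdist E x y4 = 2" "gdist E x y5 = 2"
    using gdist_2[of x z0] gdist_2[of x z1] gdist_2[of x z2] z y12 y34 y50 E_sym by metis+
  \<comment> \<open>A second common neighbour of \<open>w\<close> and \<open>w'\<close> besides
    \<open>x\<close> would close a quadrilateral.\<close>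
  have cousins: "y \<noteq> y'" if "E x w" "E x w'" "w \<noteq> w'" "E w y" "E w' y'" "y \<noteq> x" for w w' y y'
    using square_free[of x w y w'] that E_sym by blast
  have ydist: "y0 \<noteq> y1" "y2 \<noteq> y3" "y4 \<noteq> y5"
    using siblings_distinct[of z0 z2 z1 x y0 y5 y2] siblings_distinct[of z1 z0 z2 x y2 y1 y4]
      siblings_distinct[of z2 z1 z0 x y4 y3 y0] z y12 y34 y50 E_sym by auto
  have zy: "E z0 y0" "E z0 y1" "E z1 y2" "E z1 y3" "E z2 y4" "E z2 y5"
    using y12 y34 y50 E_sym by blast+
  have zz: "z0 \<noteq> z1" "z0 \<noteq> z2" "z1 \<noteq> z2" using z(1) by auto
  have "y0 \<notin> {y2, y3, y4, y5}" "y1 \<notin> {y2, y3, y4, y5}" "y2 \<notin> {y4, y5}" "y3 \<notin> {y4, y5}"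
    using cousins[OF z(2,3) zz(1) zy(1) _ y50(4)] cousins[OF z(2,4) zz(2) zy(1) _ y50(4)]
      cousins[OF z(2,3) zz(1) zy(2) _ y12(5)] cousins[OF z(2,4) zz(2) zy(2) _ y12(5)]
      cousins[OF z(3,4) zz(3) zy(3) _ y12(4)] cousins[OF z(3,4) zz(3) zy(4) _ y34(5)] zy by blast+
  with ydist have y: "distinct [y0, y1, y2, y3, y4, y5]" by auto
  obtain m0 where m0: "E y0 m0" "gdist E x m0 = 3" using unique_up[OF ly(1)] by auto
  obtain m1 where m1: "E y1 m1" "gdist E x m1 = 3" using unique_up[OF ly(2)] by auto
  obtain m2 where m2: "E y2 m2" "gdist E x m2 = 3" using unique_up[OF ly(3)] by auto
  obtain m3 where m3: "E y3 m3" "gdist E x m3 = 3" using unique_up[OF ly(4)] by auto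
  obtain m4 where m4: "E y4 m4" "gdist E x m4 = 3" using unique_up[OF ly(5)] by auto
  obtain m5 where m5: "E y5 m5" "gdist E x m5 = 3" using unique_up[OF ly(6)] by auto
  note ms = m0 m1 m2 m3 m4 m5
  have mm: "m \<noteq> m'" if "gdist E x m = 3" "E y m" "E y' m'" "gdist E x y = 2" "gdist E x y' = 2" "y \<noteq> y'"
    for m m' y y'
    using unique_down[of x m y y'] that E_sym by blast
  have m: "distinct [m0, m1, m2, m3, m4, m5]"
    using mm ms ly y by simp
  have neq: "(a = b) = False" if "gdist E x a \<noteq> gdist E x b" for a b using that by auto
  have l0: "gdist E x x = 0" using d0 by simp
  note lev = l0 lz ly ms(2,4,6,8,10,12)
  note E_y = z(2-4) y12(1-3) y34(1-3) y50(1-3) ms(1,3,5,7,9,11)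
  note E_y' = E_y[THEN E_sym]
  have Nz: "{w. E z0 w} = {x, y0, y1}" "{w. E z1 w} = {x, y2, y3}" "{w. E z2 w} = {x, y4, y5}"
    by (rule neighbours; simp add: neq lev E_y E_y' ydist)+
  have Ny: "{w. E y0 w} = {z0, y5, m0}" "{w. E y1 w} = {z0, y2, m1}" "{w. E y2 w} = {z1, y1, m2}"
    "{w. E y3 w} = {z1, y4, m3}" "{w. E y4 w} = {z2, y3, m4}" "{w. E y5 w} = {z2, y0, m5}"
    by (rule neighbours; simp add: neq lev E_y E_y' ydist)+
  \<comment> \<open>The pentagon on the path \<open>y\<close>, \<open>z\<close>, \<open>y'\<close>
    is closed by one vertex of \<open>{a, m}\<close> and one of \<open>{b, m'}\<close>. Since c_3 =
    1, \<open>m\<close> and \<open>m'\<close> have no second neighbour at distance two, and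
    \<open>a\<close>, \<open>b\<close> are not adjacent; so the closing edge joins \<open>m\<close>
    to \<open>m'\<close>.\<close>
  have m_adj: "E m m'"
    if N: "{w. E y w} = {z, a, m}" "{w. E y' w} = {z, b, m'}" and "y \<noteq> y'" "a \<noteq> y'" "b \<noteq> y" "\<not> E a b"
      and "gdist E x y = 2" "gdist E x y' = 2" "gdist E x a = 2" "gdist E x b = 2"
        "gdist E x m = 3" "gdist E x m' = 3" for z y y' a b m m'
  proof -
    have "E y z" "E z y'" using N E_sym by blast+
    then obtain d e where de: "E y' d" "E d e" "E e y" "d \<noteq> z" "e \<noteq> z"
      using pentagon \<open>y \<noteq> y'\<close> by metis
    then have "d \<in> {b, m'}" "e \<in> {a, m}" using N E_sym[OF de(3)] by blast+
    moreover have "\<not> E b m" "\<not> E a m'"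
      using unique_down[of x m y b] unique_down[of x m' y' a] that E_sym by blast+
    ultimately show ?thesis using de(2) \<open>\<not> E a b\<close> E_sym by blast
  qed
  have nE: "\<not> E y5 y2" "\<not> E y1 y4" "\<not> E y3 y0"
    using Ny y by (auto simp: set_eq_iff neq lev)
  have m_E: "E m0 m1" "E m2 m3" "E m4 m5"
    by (rule m_adj[OF Ny(1,2)] m_adj[OF Ny(3,4)] m_adj[OF Ny(5,6)];
        use y in \<open>auto simp: nE lev\<close>)+
  note m_E' = m_E[THEN E_sym]
  obtain v0 where v0: "E m0 v0" "gdist E x v0 = 4" using unique_up[OF ms(2)] by auto
  obtain v1 where v1: "E m1 v1" "gdist E x v1 = 4" using unique_up[OF ms(4)] by auto
  obtain v2 where v2: "E m2 v2" "gdist E x v2 = 4" using unique_up[OF ms(6)] by auto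
  obtain v3 where v3: "E m3 v3" "gdist E x v3 = 4" using unique_up[OF ms(8)] by auto
  obtain v4 where v4: "E m4 v4" "gdist E x v4 = 4" using unique_up[OF ms(10)] by auto
  obtain v5 where v5: "E m5 v5" "gdist E x v5 = 4" using unique_up[OF ms(12)] by auto
  note vs = v0 v1 v2 v3 v4 v5
  note lev = lev vs(2,4,6,8,10,12)
  have Nm: "{w. E m0 w} = {y0, m1, v0}" "{w. E m1 w} = {y1, m0, v1}" "{w. E m2 w} = {y2, m3, v2}"
    "{w. E m3 w} = {y3, m2, v3}" "{w. E m4 w} = {y4, m5, v4}" "{w. E m5 w} = {y5, m4, v5}"
    by (rule neighbours; simp add: neq lev E_y' m_E m_E' vs(1,3,5,7,9,11))+
  \<comment> \<open>The pentagon on \<open>m\<close>, \<open>y\<close>, \<open>y'\<close> continues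
    through \<open>m'\<close>, because \<open>z'\<close> is too close to \<open>x\<close> to be
    adjacent to \<open>n\<close> or \<open>v\<close>. Its last vertex lies in \<open>{n, v}\<close>
    and is a neighbour of \<open>m'\<close>; the distances from \<open>x\<close> and
    \<open>n \<noteq> n'\<close> leave only \<open>v = v'\<close>.\<close>
  have v_eq: "v = v'"
    if N: "{w. E y w} = {z, y', m}" "{w. E y' w} = {z', y, m'}" "{w. E m w} = {y, n, v}"
        "{w. E m' w} = {y', n', v'}" and "n \<noteq> n'"
      and l: "gdist E x z' = 1" "gdist E x y' = 2" "gdist E x m = 3" "gdist E x m' = 3"
        "gdist E x n = 3" "gdist E x n' = 3" "gdist E x v = 4" "gdist E x v' = 4"
    for z z' y y' m m' n n' v v'
  proof -
    have "E m y" "E y y'" "m \<noteq> y'" using N E_sym l by auto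
    then obtain d e where de: "E y' d" "E d e" "E e m" "d \<noteq> y" "e \<noteq> y"
      using pentagon by metis
    have "d \<in> {z', m'}" "e \<in> {n, v}" using N de E_sym[OF de(3)] by blast+
    moreover have "\<not> E z' n" "\<not> E z' v" using step[of z' n x] step[of z' v x] l by auto
    ultimately have "d = m'" using de(2) by auto
    then have "e \<in> {y', n', v'}" using N de(2) by blast
    then show ?thesis using \<open>e \<in> {n, v}\<close> \<open>n \<noteq> n'\<close> l by auto
  qed
  have v_pairs: "v1 = v2" "v3 = v4" "v5 = v0"
    by (rule v_eq[OF Ny(2,3) Nm(2,3)] v_eq[OF Ny(4,5) Nm(4,5)] v_eq[OF Ny(6,1) Nm(6,1)];
        use m in \<open>auto simp: lev\<close>)+
  have two_down: "card {w. E v w \<and> gdist E x w = 3} = 2" if "gdist E x v = 4" for v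
    using down[of x v 3] that by simp
  have v_neq: "v \<noteq> v'" if "E a v" "E b v" "E a' v'" "gdist E x v = 4" "distinct [a, b, a']"
    "gdist E x a = 3" "gdist E x b = 3" "gdist E x a' = 3" for a b a' v v'
  proof
    assume "v = v'"
    then have "{a, b, a'} \<subseteq> {w. E v w \<and> gdist E x w = 3}" using that E_sym by auto
    then have "card {a, b, a'} \<le> 2" using two_down[OF that(4)] card_mono[of "{w. E v w \<and> gdist E x w = 3}"] by auto
    then show False using that(5) by simp
  qed
  have v: "distinct [v1, v3, v5]"
    using v_neq[of m1 v1 m2 m3 v3] v_neq[of m1 v1 m2 m5 v5] v_neq[of m3 v3 m4 m5 v5] vs v_pairs m lev
    by simp
  obtain p where p: "E v1 p" "gdist E x p = 5" using unique_up[OF vs(4)] by auto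
  \<comment> \<open>No vertices are missing: a vertex on levels two to four has a neighbour one
    level lower, and the neighbourhoods of that level are completely known.\<close>
  have lev1: "w \<in> {z0, z1, z2}" if "gdist E x w = 1" for w using that z(5) d1 by auto
  have lev2: "w \<in> {y0, y1, y2, y3, y4, y5}" if w: "gdist E x w = 2" for w
  proof -
    obtain u where u: "E u w" "gdist E x u = 1"
      by (rule gdist_pred[OF conn, of x w 1]) (use w in auto)
    have "w \<in> {x, y0, y1, y2, y3, y4, y5}"
      using lev1[OF u(2)] Nz u(1)
      by (auto simp only: insert_iff empty_iff set_eq_iff mem_Collect_eq)
    then show ?thesis using w l0 by auto
  qed
  have lev3: "w \<in> {m0, m1, m2, m3, m4, m5}" if w: "gdist E x w = 3" for w
  proof -
    obtain u where u: "E u w" "gdist E x u = 2"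
      by (rule gdist_pred[OF conn, of x w 2]) (use w in auto)
    have "w \<in> {z0, z1, z2, y0, y1, y2, y3, y4, y5, m0, m1, m2, m3, m4, m5}"
      using lev2[OF u(2)] Ny u(1)
      by (auto simp only: insert_iff empty_iff set_eq_iff mem_Collect_eq)
    then show ?thesis using w by (auto simp: lev)
  qed
  have lev4: "w \<in> {v1, v3, v5}" if w: "gdist E x w = 4" for w
  proof -
    obtain u where u: "E u w" "gdist E x u = 3"
      by (rule gdist_pred[OF conn, of x w 3]) (use w in auto)
    have "w \<in> {y0, y1, y2, y3, y4, y5, m0, m1, m2, m3, m4, m5, v0, v1, v2, v3, v4, v5}"
      using lev3[OF u(2)] Nm u(1)
      by (auto simp only: insert_iff empty_iff set_eq_iff mem_Collect_eq)
    then show ?thesis using w by (auto simp: lev v_pairs)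
  qed
  \<comment> \<open>All vertices at distance four are known to be among these three, and c_5 = 3
    makes \<open>p\<close> adjacent to every one.\<close>
  have "{w. E p w \<and> gdist E x w = 4} = {v1, v3, v5}"
  proof (rule card_subset_eq)
    show "card {w. E p w \<and> gdist E x w = 4} = card {v1, v3, v5}"
      using down[of x p 4] p(2) v by simp
  qed (use lev4 in auto)
  then have E_p: "E p v1" "E p v3" "E p v5" by blast+
  have lev5: "w = p" if w: "gdist E x w = 5" for w
  proof -
    obtain u where u: "E u w" "gdist E x u = 4" 
      by (rule gdist_pred[OF conn, of x w 4]) (use w in auto)
    then have "E u p" using lev4[of u] E_p E_sym by auto
    moreover obtain p' where "\<And>w. E u w \<Longrightarrow> gdist E x w = 5 \<Longrightarrow> w = p'"
      using unique_up[OF u(2)] by auto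
    ultimately show ?thesis using u w p(2) by metis
  qed
  note lev = lev p(2)
  have E_v: "E v1 m1" "E v1 m2" "E v3 m3" "E v3 m4" "E v5 m0" "E v5 m5"
    using vs(1,3,5,7,9,11)[THEN E_sym] v_pairs by auto
  have Nv: "{w. E v1 w} = {m1, m2, p}" "{w. E v3 w} = {m3, m4, p}" "{w. E v5 w} = {m0, m5, p}"
    by (rule neighbours; use m in \<open>simp add: neq lev E_v E_p[THEN E_sym]\<close>)+
  have Np: "{w. E p w} = {v1, v3, v5}"
    by (rule neighbours) (use E_p v in auto)
  \<comment> \<open>The order follows the numbering of \<open>nbrs\<close>; \<open>v1\<close>,
    \<open>v3\<close>, \<open>v5\<close> stand for the identified pairs in
    \<open>v_pairs\<close>.\<close>
  define vl where "vl = [x, z0, z1, z2, y0, y1, y2, y3, y4, y5, m0, m1, m2, m3, m4, m5, v1, v3, v5, p]"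
  have "distinct vl" using z(1) y m v by (simp add: vl_def neq lev)
  moreover have "w \<in> set vl" for w
  proof -
    have "gdist E x w \<in> {0, 1, 2, 3, 4, 5}" using gdist_le_5[of x w] by auto
    then show ?thesis
      using d0[of x w] lev1[of w] lev2[of w] lev3[of w] lev4[of w] lev5[of w] unfolding vl_def by auto
  qed
  moreover have "\<forall>k<20. {w. E (vl ! k) w} = (!) vl ` set (nbrs ! k)"
    unfolding all_less_20 vl_def nbrs_def by (simp add: z(5) Nz Ny Nm Nv Np v_pairs[symmetric])
  moreover have "\<forall>k<20. gdist E x (vl ! k) = level ! k"
    unfolding all_less_20 vl_def level_def by (simp add: lev)
  moreover have "length vl = 20" "vl ! 0 = x" by (simp_all add: vl_def)
  ultimately have "dodecahedron_labelling E x vl"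
    unfolding dodecahedron_labelling_def by blast
  moreover have "zs = [vl ! 1, vl ! 2, vl ! 3]" by (simp add: vl_def zs_eq)
  ultimately show ?thesis by blast
qed

end

section \<open>Computations in coordinates\<close>

lemma less_6: "{..<6} = {0, 1, 2, 3, 4, 5::nat}"
proof -
  have "[0..<6] = [0, 1, 2, 3, 4, 5::nat]" by (simp add: upt_rec)
  from arg_cong[OF this, of set] show ?thesis by (simp only: set_upt atLeast0LessThan list.set)
qed

lemma less_2: "{..<2} = {0, 1::nat}"
  by auto

lemma less_3: "{..<3} = {0, 1, 2::nat}"
  and less_4: "{..<4} = {0, 1, 2, 3::nat}"
  and less_5: "{..<5} = {0, 1, 2, 3, 4::nat}"
  by auto

lemma all_less_6: "(\<forall>k<6. P k) \<longleftrightarrow> (\<forall>k\<in>{0, 1, 2, 3, 4, 5::nat}. P k)"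
  and all_less_2: "(\<forall>k<2. P k) \<longleftrightarrow> (\<forall>k\<in>{0, 1::nat}. P k)"
  by (simp_all only: less_6[symmetric] less_2[symmetric] lessThan_iff Ball_def)

lemma all_less_1: "(\<forall>k<1. P k) \<longleftrightarrow> P (0::nat)"
  and all_less_3: "(\<forall>k<3. P k) \<longleftrightarrow> (\<forall>k\<in>{0, 1, 2::nat}. P k)"
  and all_less_4: "(\<forall>k<4. P k) \<longleftrightarrow> (\<forall>k\<in>{0, 1, 2, 3::nat}. P k)"
  and all_less_5: "(\<forall>k<5. P k) \<longleftrightarrow> (\<forall>k\<in>{0, 1, 2, 3, 4::nat}. P k)"
  by (simp_all only: less_3[symmetric] less_4[symmetric] less_5[symmetric] lessThan_iff Ball_def
      less_one simp_thms)

lemma self_adjointI: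
  assumes "\<And>u v. herm (M *v u) v = herm u (M *v v)"
  shows "adjoint M = M"
proof (rule matrix_eqI)
  fix v
  have "herm u (adjoint M *v v - M *v v) = 0" for u
    using assms by (simp add: herm_diff_right herm_adjoint[symmetric])
  from this[of "adjoint M *v v - M *v v"] show "adjoint M *v v = M *v v" by simp
qed

lemma represents_rows:
  assumes "length vs = n" "length rws = n" "\<forall>r\<in>set rws. length r = n"
  shows "represents M vs (mat_of_rows_list n rws) \<longleftrightarrow>
    (\<forall>j<n. M *v (vs ! j) = (\<Sum>i<n. rws ! i ! j *s (vs ! i)))"
proof -
  have "mat_of_rows_list n rws $$ (i, j) = rws ! i ! j" if "i < n" "j < n" for i j
    using assms that by (simp add: mat_of_rows_list_def)
  moreover have "mat_of_rows_list n rws \<in> carrier_mat n n"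
    using assms by (simp add: mat_of_rows_list_def)
  moreover have "(\<Sum>i<n. mat_of_rows_list n rws $$ (i, j) *s (vs ! i)) = (\<Sum>i<n. rws ! i ! j *s (vs ! i))"
    if "j < n" for j
    using calculation(1) that by (intro sum.cong) auto
  ultimately show ?thesis
    unfolding represents_def assms(1) by auto
qed

locale labelled_dodecahedron = dodecahedron E for E :: "'v::finite \<Rightarrow> 'v \<Rightarrow> bool" +
  fixes x :: 'v and vs :: "'v list"
  assumes labelling: "dodecahedron_labelling E x vs"

sublocale labelled_dodecahedron \<subseteq> symmetric_graph E x
  using conn by unfold_locales (simp add: connected_graph_def)

context labelled_dodecahedron
begin

text \<open>Vectors are handled as coordinate lists along \<open>vs\<close>; on explicit lists of
  length 20 the matrices and the form then become the rewrite rules \<open>coords\<close>.\<close>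

definition L :: "complex list \<Rightarrow> complex^'v" where
  "L cs = (\<chi> y. cs ! (THE k. k < 20 \<and> vs ! k = y))"

lemma vs: "length vs = 20" "distinct vs" "set vs = UNIV" "vs ! 0 = x"
    "\<And>k. k < 20 \<Longrightarrow> {z. E (vs ! k) z} = (!) vs ` set (nbrs ! k)"
    "\<And>k. k < 20 \<Longrightarrow> gdist E x (vs ! k) = level ! k"
  using labelling by (auto simp: dodecahedron_labelling_def)

lemma vs_inj: "inj_on ((!) vs) {..<20}"
  using vs by (auto simp: inj_on_def nth_eq_iff_index_eq)

lemma vs_UNIV: "UNIV = (!) vs ` {..<20}"
  using vs(1,3) by (metis atLeast0LessThan list.set_map map_nth set_upt)

lemma card_V: "CARD('v) = 20"
  by (simp add: vs_UNIV card_image[OF vs_inj])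

lemma L_nth: "k < 20 \<Longrightarrow> L cs $ (vs ! k) = cs ! k"
proof -
  assume k: "k < 20"
  then have "(THE j. j < 20 \<and> vs ! j = vs ! k) = k"
    using vs by (intro the_equality) (auto simp: nth_eq_iff_index_eq)
  then show ?thesis by (simp add: L_def)
qed

lemma vec_eqI: "(\<And>k. k < 20 \<Longrightarrow> u $ (vs ! k) = v $ (vs ! k)) \<Longrightarrow> u = v"
proof (unfold Finite_Cartesian_Product.vec_eq_iff, intro allI)
  fix y assume *: "\<And>k. k < 20 \<Longrightarrow> u $ (vs ! k) = v $ (vs ! k)"
  have "y \<in> (!) vs ` {..<20}" using vs_UNIV by blast
  then show "u $ y = v $ y" using * by auto
qed

lemma L_surj:
  obtains c0 c1 c2 c3 c4 c5 c6 c7 c8 c9 c10 c11 c12 c13 c14 c15 c16 c17 c18 c19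
  where "v = L [c0, c1, c2, c3, c4, c5, c6, c7, c8, c9, c10, c11, c12, c13, c14, c15, c16, c17, c18, c19]"
proof -
  have "v = L (map (\<lambda>k. v $ (vs ! k)) [0..<20])"
    by (rule vec_eqI) (simp add: L_nth)
  moreover have "[0..<20] = [0, 1, 2, 3, 4, 5, 6, 7, 8, 9, 10, 11, 12, 13, 14, 15, 16, 17, 18, 19::nat]"
    by (simp add: upt_rec)
  ultimately show thesis using that by simp
qed

lemma L_eq_iff: "length cs = 20 \<Longrightarrow> length ds = 20 \<Longrightarrow> L cs = L ds \<longleftrightarrow> cs = ds"
  by (metis L_nth nth_equalityI)

lemma L_add: "length cs = 20 \<Longrightarrow> length ds = 20 \<Longrightarrow> L cs + L ds = L (map2 (+) cs ds)"
  by (rule vec_eqI) (simp add: L_nth)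

lemma L_diff: "length cs = 20 \<Longrightarrow> length ds = 20 \<Longrightarrow> L cs - L ds = L (map2 (-) cs ds)"
  by (rule vec_eqI) (simp add: L_nth)

lemma L_scale: "length cs = 20 \<Longrightarrow> c *s L cs = L (map ((*) c) cs)"
  by (rule vec_eqI) (simp add: L_nth)

lemma L_0: "L (replicate 20 0) = 0"
  by (rule vec_eqI) (simp add: L_nth)

lemma L_eq_0: "length cs = 20 \<Longrightarrow> L cs = 0 \<longleftrightarrow> cs = replicate 20 0"
  using L_eq_iff[of cs "replicate 20 0"] by (simp add: L_0)

lemma length_level: "length level = 20"
  by (simp add: level_def)

lemma herm_L:
  assumes "length cs = 20" "length ds = 20"
  shows "herm (L cs) (L ds) = (\<Sum>c\<leftarrow>map2 (\<lambda>c d. c * cnj d) cs ds. c)"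
proof -
  have "herm (L cs) (L ds) = (\<Sum>k<20. L cs $ (vs ! k) * cnj (L ds $ (vs ! k)))"
    unfolding herm_def by (simp add: vs_UNIV sum.reindex[OF vs_inj])
  also have "\<dots> = (\<Sum>k<20. cs ! k * cnj (ds ! k))"
    by (rule sum.cong) (auto simp: L_nth)
  also have "\<dots> = (\<Sum>c\<leftarrow>map2 (\<lambda>c d. c * cnj d) cs ds. c)"
    using assms by (simp add: sum_list_sum_nth atLeast0LessThan)
  finally show ?thesis .
qed

lemma nbrs: "\<forall>k<20. distinct (nbrs ! k) \<and> set (nbrs ! k) \<subseteq> {..<20}"
  unfolding all_less_20 nbrs_def by simp

lemma length_nbrs: "length nbrs = 20"
  by (simp add: nbrs_def)

lemma A_L: "A *v L cs = L (map (\<lambda>ks. \<Sum>k\<leftarrow>ks. cs ! k) nbrs)"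
proof (rule vec_eqI)
  fix k :: nat assume k: "k < 20"
  have n: "distinct (nbrs ! k)" "set (nbrs ! k) \<subseteq> {..<20}" using nbrs k by blast+
  have "(A *v L cs) $ (vs ! k) = (\<Sum>z\<in>UNIV. if E (vs ! k) z then L cs $ z else 0)"
    by (simp add: adj_matrix_def matrix_vector_mult_def mult_delta_left cong: if_cong)
  also have "\<dots> = (\<Sum>z\<in>{z. E (vs ! k) z}. L cs $ z)"
    by (simp add: sum.If_cases)
  also have "\<dots> = (\<Sum>j\<in>set (nbrs ! k). L cs $ (vs ! j))"
    unfolding vs(5)[OF k] by (subst sum.reindex[OF inj_on_subset[OF vs_inj n(2)]]) simp
  also have "\<dots> = (\<Sum>j\<in>set (nbrs ! k). cs ! j)"
    by (rule sum.cong[OF refl], rule L_nth) (use n in auto)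
  also have "\<dots> = (\<Sum>j\<leftarrow>nbrs ! k. cs ! j)"
    using n by (simp add: sum.distinct_set_conv_list)
  finally show "(A *v L cs) $ (vs ! k) = L (map (\<lambda>ks. \<Sum>k\<leftarrow>ks. cs ! k) nbrs) $ (vs ! k)"
    using k by (simp add: L_nth length_nbrs)
qed

lemma Estar_L: "length cs = 20 \<Longrightarrow> Estar E x i *v L cs = L (map2 (\<lambda>l c. if l = i then c else 0) level cs)"
  by (rule vec_eqI) (simp add: Estar_mult_vec vs(6) L_nth length_level)

lemma estar_L: "estar E x i = L (map (\<lambda>l. if l = i then 1 else 0) level)"
  by (rule vec_eqI) (simp add: estar_def vs(6) L_nth length_level)

lemma A_20: "A *v L [c0, c1, c2, c3, c4, c5, c6, c7, c8, c9, c10, c11, c12, c13, c14, c15, c16, c17, c18, c19] =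
  L [c1 + c2 + c3, c0 + c4 + c5, c0 + c6 + c7, c0 + c8 + c9, c1 + c9 + c10, c1 + c6 + c11, c2 + c5 + c12, c2 + c8 + c13, c3 + c7 + c14, c3 + c4 + c15, c4 + c11 + c18, c5 + c10 + c16, c6 + c13 + c16, c7 + c12 + c17, c8 + c15 + c17, c9 + c14 + c18, c11 + c12 + c19, c13 + c14 + c19, c10 + c15 + c19, c16 + c17 + c18]"
  by (simp add: A_L nbrs_def add.assoc)

lemma Estar_20:
  "Estar E x 0 *v L [c0, c1, c2, c3, c4, c5, c6, c7, c8, c9, c10, c11, c12, c13, c14, c15, c16, c17, c18, c19] =
    L [c0, 0, 0, 0, 0, 0, 0, 0, 0, 0, 0, 0, 0, 0, 0, 0, 0, 0, 0, 0]"
  "Estar E x (Suc 0) *v L [c0, c1, c2, c3, c4, c5, c6, c7, c8, c9, c10, c11, c12, c13, c14, c15, c16, c17, c18, c19] =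
    L [0, c1, c2, c3, 0, 0, 0, 0, 0, 0, 0, 0, 0, 0, 0, 0, 0, 0, 0, 0]"
  "Estar E x 2 *v L [c0, c1, c2, c3, c4, c5, c6, c7, c8, c9, c10, c11, c12, c13, c14, c15, c16, c17, c18, c19] =
    L [0, 0, 0, 0, c4, c5, c6, c7, c8, c9, 0, 0, 0, 0, 0, 0, 0, 0, 0, 0]"
  "Estar E x 3 *v L [c0, c1, c2, c3, c4, c5, c6, c7, c8, c9, c10, c11, c12, c13, c14, c15, c16, c17, c18, c19] =
    L [0, 0, 0, 0, 0, 0, 0, 0, 0, 0, c10, c11, c12, c13, c14, c15, 0, 0, 0, 0]"
  "Estar E x 4 *v L [c0, c1, c2, c3, c4, c5, c6, c7, c8, c9, c10, c11, c12, c13, c14, c15, c16, c17, c18, c19] =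
    L [0, 0, 0, 0, 0, 0, 0, 0, 0, 0, 0, 0, 0, 0, 0, 0, c16, c17, c18, 0]"
  "Estar E x 5 *v L [c0, c1, c2, c3, c4, c5, c6, c7, c8, c9, c10, c11, c12, c13, c14, c15, c16, c17, c18, c19] =
    L [0, 0, 0, 0, 0, 0, 0, 0, 0, 0, 0, 0, 0, 0, 0, 0, 0, 0, 0, c19]"
  by (simp_all add: Estar_L level_def)

lemma herm_20: "herm (L [c0, c1, c2, c3, c4, c5, c6, c7, c8, c9, c10, c11, c12, c13, c14, c15, c16, c17, c18, c19]) (L [d0, d1, d2, d3, d4, d5, d6, d7, d8, d9, d10, d11, d12, d13, d14, d15, d16, d17, d18, d19]) =
  c0 * cnj d0 + c1 * cnj d1 + c2 * cnj d2 + c3 * cnj d3 + c4 * cnj d4 + c5 * cnj d5 + c6 * cnj d6 + c7 * cnj d7 + c8 * cnj d8 + c9 * cnj d9 + c10 * cnj d10 + c11 * cnj d11 + c12 * cnj d12 + c13 * cnj d13 + c14 * cnj d14 + c15 * cnj d15 + c16 * cnj d16 + c17 * cnj d17 + c18 * cnj d18 + c19 * cnj d19"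
  by (simp add: herm_L add.assoc)

lemma add_20: "L [c0, c1, c2, c3, c4, c5, c6, c7, c8, c9, c10, c11, c12, c13, c14, c15, c16, c17, c18, c19] + L [d0, d1, d2, d3, d4, d5, d6, d7, d8, d9, d10, d11, d12, d13, d14, d15, d16, d17, d18, d19] =
  L [c0 + d0, c1 + d1, c2 + d2, c3 + d3, c4 + d4, c5 + d5, c6 + d6, c7 + d7, c8 + d8, c9 + d9, c10 + d10, c11 + d11, c12 + d12, c13 + d13, c14 + d14, c15 + d15, c16 + d16, c17 + d17, c18 + d18, c19 + d19]"
  by (simp add: L_add)

lemma scale_20: "c *s L [c0, c1, c2, c3, c4, c5, c6, c7, c8, c9, c10, c11, c12, c13, c14, c15, c16, c17, c18, c19] =
  L [c * c0, c * c1, c * c2, c * c3, c * c4, c * c5, c * c6, c * c7, c * c8, c * c9, c * c10, c * c11, c * c12, c * c13, c * c14, c * c15, c * c16, c * c17, c * c18, c * c19]"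
  by (simp add: L_scale)

lemma L_eq_0_20: "L [c0, c1, c2, c3, c4, c5, c6, c7, c8, c9, c10, c11, c12, c13, c14, c15, c16, c17, c18, c19] = 0 \<longleftrightarrow>
    c0 = 0 \<and> c1 = 0 \<and> c2 = 0 \<and> c3 = 0 \<and> c4 = 0 \<and> c5 = 0 \<and> c6 = 0 \<and> c7 = 0 \<and> c8 = 0 \<and> c9 = 0 \<and> c10 = 0 \<and> c11 = 0 \<and> c12 = 0 \<and> c13 = 0 \<and> c14 = 0 \<and> c15 = 0 \<and> c16 = 0 \<and> c17 = 0 \<and> c18 = 0 \<and> c19 = 0"
  by (simp add: L_eq_0 numeral_eq_Suc)

lemmas coords = A_20 Estar_20 herm_20 add_20 scale_20 L_eq_iff L_eq_0_20

abbreviation "S\<^sub>1 a b c \<equiv> L [0, a, b, c, 0, 0, 0, 0, 0, 0, 0, 0, 0, 0, 0, 0, 0, 0, 0, 0]"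
abbreviation "S\<^sub>2 a b c d e f \<equiv> L [0, 0, 0, 0, a, b, c, d, e, f, 0, 0, 0, 0, 0, 0, 0, 0, 0, 0]"
abbreviation "S\<^sub>3 a b c d e f \<equiv> L [0, 0, 0, 0, 0, 0, 0, 0, 0, 0, a, b, c, d, e, f, 0, 0, 0, 0]"
abbreviation "S\<^sub>4 a b c \<equiv> L [0, 0, 0, 0, 0, 0, 0, 0, 0, 0, 0, 0, 0, 0, 0, 0, a, b, c, 0]"

lemma estar_20:
  "estar E x 0 = L [1, 0, 0, 0, 0, 0, 0, 0, 0, 0, 0, 0, 0, 0, 0, 0, 0, 0, 0, 0]"
  "estar E x (Suc 0) = S\<^sub>1 1 1 1"
  "estar E x 2 = S\<^sub>2 1 1 1 1 1 1"
  "estar E x 3 = S\<^sub>3 1 1 1 1 1 1"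
  "estar E x 4 = S\<^sub>4 1 1 1"
  "estar E x 5 = L [0, 0, 0, 0, 0, 0, 0, 0, 0, 0, 0, 0, 0, 0, 0, 0, 0, 0, 0, 1]"
  by (simp_all add: estar_L level_def)

lemma represents_I: "represents A (map (estar E x) [0, 1, 2, 3, 4, 5]) B_I"
  unfolding B_I_def list.map
  by (subst represents_rows; simp add: all_less_6 less_6 estar_20 coords)

text \<open>The sum condition removes the component of \<open>A *v \<nu>\<close> at \<open>x\<close>
  and turns a sum of two of the coordinates into the negative of the third.\<close>

lemma basis_II_20:
  assumes "a + b + c = 0"
  shows "basis_II E x (S\<^sub>1 a b c) = [S\<^sub>1 a b c, S\<^sub>2 a a b b c c, S\<^sub>2 c b a c b a,
    S\<^sub>3 a a b b c c, S\<^sub>3 (- b) (- c) (- c) (- a) (- a) (- b), S\<^sub>4 (- c) (- a) (- b)]"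
proof -
  have c: "c = - a - b" using assms by (simp add: eq_neg_iff_add_eq_0 algebra_simps)
  show ?thesis
    by (simp add: basis_II_def Let_def coords c)
qed

text \<open>What matters is that \<open>B_II\<close> is the same for all \<open>a\<close>,
  \<open>b\<close>, \<open>c\<close>; this makes \<open>e\<^sub>1\<close> primitive although its
  rank is two.\<close>

lemma represents_II:
  assumes "a + b + c = 0"
  shows "represents A (basis_II E x (S\<^sub>1 a b c)) B_II"
proof -
  have c: "c = - a - b" using assms by (simp add: eq_neg_iff_add_eq_0 algebra_simps)
  show ?thesis
    unfolding B_II_def basis_II_20[OF assms]
    by (subst represents_rows; simp add: all_less_6 less_6 coords c)
qed

abbreviation "\<nu>\<^sub>2 c \<equiv> S\<^sub>2 c (- c) c (- c) c (- c)"

lemma basis_III_20: "[\<nu>\<^sub>2 c, Estar E x 3 *v (A *v \<nu>\<^sub>2 c)] = [\<nu>\<^sub>2 c, S\<^sub>3 c (- c) c (- c) c (- c)]"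
  by (simp add: coords)

lemma represents_III: "represents A [\<nu>\<^sub>2 c, Estar E x 3 *v (A *v \<nu>\<^sub>2 c)] B_III"
  unfolding B_III_def basis_III_20
  by (subst represents_rows; simp add: all_less_2 less_2 coords)

text \<open>The triple product through \<open>Estar E x 0\<close> is the all-ones matrix on the
  three neighbours of \<open>x\<close>; a third of it projects onto the constant vectors
  there.\<close>

definition "e\<^sub>1 = Estar E x 1 -
  mscale (1 / 3) (Estar E x 1 ** A ** Estar E x 0 ** A ** Estar E x 1)"

text \<open>On the hexagon at distance two, \<open>E\<^sub>2\<^sup>* T E\<^sub>2\<^sup>*\<close> is the group algebra of the symmetric group of degree
  three generated by the two perfect matchings \<open>s\<close> (edges) and \<open>t\<close> (common neighbours); \<open>e\<^sub>2\<close> is the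
  idempotent of its sign character.\<close>

definition "e\<^sub>2 = (let e = Estar E x 2; s = e ** A ** e; t = e ** A ** Estar E x 1 ** A ** e - e
  in mscale (1 / 6) ((e + s ** t + t ** s) ** (e - s)))"

lemma e1_20: "e\<^sub>1 *v L [c0, c1, c2, c3, c4, c5, c6, c7, c8, c9, c10, c11, c12, c13, c14, c15, c16, c17, c18, c19] =
  S\<^sub>1 (c1 - (c1 + c2 + c3) / 3) (c2 - (c1 + c2 + c3) / 3) (c3 - (c1 + c2 + c3) / 3)"
  by (simp add: e\<^sub>1_def matrix_vector_mult_diff_rdistrib mscale_mult_vec coords L_diff
      flip: matrix_vector_mul_assoc)

lemma e2_20: "e\<^sub>2 *v L [c0, c1, c2, c3, c4, c5, c6, c7, c8, c9, c10, c11, c12, c13, c14, c15, c16, c17, c18, c19] = \<nu>\<^sub>2 ((c4 - c5 + c6 - c7 + c8 - c9) / 6)"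
  by (simp add: e\<^sub>2_def Let_def matrix_vector_mult_diff_rdistrib matrix_vector_mult_add_rdistrib
      mscale_mult_vec coords L_diff field_simps flip: matrix_vector_mul_assoc)

section \<open>Primitivity of the three idempotents\<close>

lemma T_E: "i \<le> 5 \<Longrightarrow> Estar E x i \<in> T"
  by (rule T_Estar) (simp add: gdiam)

lemma e_T: "Estar E x 0 \<in> T" "e\<^sub>1 \<in> T" "e\<^sub>2 \<in> T"
  by (auto simp: e\<^sub>1_def e\<^sub>2_def Let_def intro!: T_E T_A T_diff T_add T_scale T_mult)

lemma adjoint_e1: "adjoint e\<^sub>1 = e\<^sub>1"
proof (rule self_adjointI)
  fix u v
  show "herm (e\<^sub>1 *v u) v = herm u (e\<^sub>1 *v v)"
    by (rule L_surj[of u], rule L_surj[of v])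
      (simp only: e1_20 herm_20, simp add: field_simps)
qed

lemma adjoint_e2: "adjoint e\<^sub>2 = e\<^sub>2"
proof (rule self_adjointI)
  fix u v
  show "herm (e\<^sub>2 *v u) v = herm u (e\<^sub>2 *v v)"
    by (rule L_surj[of u], rule L_surj[of v])
      (simp only: e2_20 herm_20, simp add: field_simps)
qed

lemma e1_fix: "e\<^sub>1 *v u = u \<longleftrightarrow> (\<exists>a b c. a + b + c = 0 \<and> u = S\<^sub>1 a b c)"
proof
  assume "e\<^sub>1 *v u = u"
  moreover have "\<exists>a b c. a + b + c = 0 \<and> e\<^sub>1 *v u = S\<^sub>1 a b c"
    by (rule L_surj[of u], simp only: e1_20)
      (rule exI conjI[rotated] refl | simp add: field_simps)+
  ultimately show "\<exists>a b c. a + b + c = 0 \<and> u = S\<^sub>1 a b c" by simp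
next
  assume "\<exists>a b c. a + b + c = 0 \<and> u = S\<^sub>1 a b c"
  then show "e\<^sub>1 *v u = u" by (auto simp: e1_20)
qed

lemma e1_idem: "e\<^sub>1 ** e\<^sub>1 = e\<^sub>1"
proof (rule matrix_eqI)
  fix v
  show "(e\<^sub>1 ** e\<^sub>1) *v v = e\<^sub>1 *v v"
    by (rule L_surj[of v]) (simp add: e1_20 L_eq_iff field_simps flip: matrix_vector_mul_assoc)
qed

lemma primitive_e0: "primitive (Estar E x 0)"
proof (rule primitive_rank_one[OF e_T(1) adjoint_Estar])
  show "Estar E x 0 *v estar E x 0 = estar E x 0" by (simp add: estar_20 coords)
  show "\<exists>c. Estar E x 0 *v v = c *s estar E x 0" for v
    by (rule L_surj[of v]) (simp add: estar_20 coords)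
qed

lemma nu2_scale: "\<nu>\<^sub>2 c = c *s \<nu>\<^sub>2 1"
  by (simp add: coords)

lemma primitive_e2: "primitive e\<^sub>2"
proof (rule primitive_rank_one[OF e_T(3) adjoint_e2])
  show "e\<^sub>2 *v \<nu>\<^sub>2 1 = \<nu>\<^sub>2 1" by (simp add: e2_20 coords)
  show "\<exists>c. e\<^sub>2 *v v = c *s \<nu>\<^sub>2 1" for v
    by (rule L_surj[of v], simp only: e2_20, rule exI, rule nu2_scale)
qed

lemma primitive_e1: "primitive e\<^sub>1"
proof (rule primitive_represents[OF e_T(2) adjoint_e1 e1_idem])
  show "length (basis_II E x u) = Suc 5" for u by (simp add: basis_II_def Let_def)
  show "length [1, 2, 2, 3, 3, 4] = Suc 5" by simp
next
  fix u assume "e\<^sub>1 *v u = u"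
  then obtain a b c where u: "a + b + c = 0" "u = S\<^sub>1 a b c" by (auto simp: e1_fix)
  show "basis_II E x u ! 0 = u" by (simp add: basis_II_def Let_def)
  show "represents A (basis_II E x u) B_II" using represents_II[OF u(1)] u(2) by simp
  have "\<forall>k<6. (0 < k \<longrightarrow> e\<^sub>1 *v (basis_II E x u ! k) = 0) \<and>
      Estar E x ([1, 2, 2, 3, 3, 4] ! k) *v (basis_II E x u ! k) = basis_II E x u ! k"
    unfolding u(2) basis_II_20[OF u(1)] all_less_6 by (simp add: e1_20 coords)
  then show "e\<^sub>1 *v (basis_II E x u ! k) = 0" if "0 < k" "k \<le> 5" for k
    using that by simp
  show "Estar E x ([1, 2, 2, 3, 3, 4] ! k) *v (basis_II E x u ! k) = basis_II E x u ! k" if "k \<le> 5" for k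
    using \<open>\<forall>k<6. _ k\<close> that by simp
qed

section \<open>The irreducible summands and their bases\<close>

abbreviation "W\<^sub>0 \<equiv> gen (estar E x 0)"
abbreviation "\<nu>\<^sub>a \<equiv> S\<^sub>1 1 (- 1) 0"
abbreviation "\<nu>\<^sub>b \<equiv> S\<^sub>1 1 1 (- 2)"

lemma fix_e: "Estar E x 0 *v estar E x 0 = estar E x 0" "estar E x 0 \<noteq> 0"
  "e\<^sub>1 *v \<nu>\<^sub>a = \<nu>\<^sub>a" "\<nu>\<^sub>a \<noteq> 0" "e\<^sub>1 *v \<nu>\<^sub>b = \<nu>\<^sub>b" "\<nu>\<^sub>b \<noteq> 0"
  "e\<^sub>2 *v \<nu>\<^sub>2 c = \<nu>\<^sub>2 c" "c \<noteq> 0 \<Longrightarrow> \<nu>\<^sub>2 c \<noteq> 0"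
  by (simp_all add: estar_20 e1_20 e2_20 coords)

lemma pure_I: "k < 6 \<Longrightarrow> pure_vector E x ([0, 1, 2, 3, 4, 5] ! k) (map (estar E x) [0, 1, 2, 3, 4, 5] ! k)"
proof -
  have "\<forall>k<6. pure_vector E x ([0, 1, 2, 3, 4, 5] ! k) (map (estar E x) [0, 1, 2, 3, 4, 5] ! k)"
    unfolding all_less_6 by (simp add: pure_vector_iff estar_20 coords)
  then show "k < 6 \<Longrightarrow> ?thesis" by blast
qed

lemma independent_I: "distinct (map (estar E x) [0, 1, 2, 3, 4, 5])"
  "vec.independent (set (map (estar E x) [0, 1, 2, 3, 4, 5]))"
proof -
  have "\<forall>i<6. \<forall>j<6. herm (map (estar E x) [0, 1, 2, 3, 4, 5] ! i) (map (estar E x) [0, 1, 2, 3, 4, 5] ! j) = 0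
      \<longleftrightarrow> i \<noteq> j"
    unfolding all_less_6 by (simp add: estar_20 coords)
  then show "distinct (map (estar E x) [0, 1, 2, 3, 4, 5])"
    "vec.independent (set (map (estar E x) [0, 1, 2, 3, 4, 5]))"
    using independent_dual[of "map (estar E x) [0, 1, 2, 3, 4, 5]" "map (estar E x) [0, 1, 2, 3, 4, 5]"]
    by simp_all
qed

lemma estar_gen: "i \<le> 5 \<Longrightarrow> estar E x i \<in> W\<^sub>0"
proof (induction i)
  case 0
  show ?case by (rule gen_self)
next
  case (Suc i)
  \<comment> \<open>Going up one level multiplies by c_(i+1), the number of neighbours one level
    lower; the factors are the reciprocals of 1, 1, 1, 2, 3.\<close>
  have "\<forall>i\<in>{0, 1, 2, 3, 4}. estar E x (Suc i) =
      [1, 1, 1, 1 / 2, 1 / 3] ! i *s (Estar E x (Suc i) *v (A *v estar E x i))"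
    by (simp add: estar_20 coords flip: numeral_2_eq_2)
  moreover have "i \<in> {0, 1, 2, 3, 4}" using Suc.prems by auto
  ultimately have "\<exists>c. estar E x (Suc i) = c *s (Estar E x (Suc i) *v (A *v estar E x i))" by blast
  moreover have "Estar E x (Suc i) *v (A *v estar E x i) \<in> W\<^sub>0"
    using Suc by (intro gen_closed T_E T_A) auto
  ultimately show ?case using subspace_gen vec.subspace_scale by metis
qed

lemma span_I: "W\<^sub>0 = vec.span (set (map (estar E x) [0, 1, 2, 3, 4, 5]))"
proof (rule gen_eq_span)
  show "T_module E x (vec.span (set (map (estar E x) [0, 1, 2, 3, 4, 5])))"
    by (rule T_module_span[OF represents_I, of "[0, 1, 2, 3, 4, 5]"])
      (use pure_I in \<open>simp_all add: pure_vector_iff\<close>)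
qed (auto intro: estar_gen)

lemma pure_II:
  assumes "a + b + c = 0" "k < 6"
  shows "Estar E x ([1, 2, 2, 3, 3, 4] ! k) *v (basis_II E x (S\<^sub>1 a b c) ! k) = basis_II E x (S\<^sub>1 a b c) ! k"
proof -
  have "\<forall>k<6. Estar E x ([1, 2, 2, 3, 3, 4] ! k) *v (basis_II E x (S\<^sub>1 a b c) ! k) =
      basis_II E x (S\<^sub>1 a b c) ! k"
    unfolding basis_II_20[OF assms(1)] all_less_6 by (simp add: coords)
  with assms(2) show ?thesis by blast
qed

lemma span_II:
  assumes "a + b + c = 0"
  shows "gen (S\<^sub>1 a b c) = vec.span (set (basis_II E x (S\<^sub>1 a b c)))"
proof (rule gen_eq_span)
  show "T_module E x (vec.span (set (basis_II E x (S\<^sub>1 a b c))))"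
    by (rule T_module_span[OF represents_II[OF assms], of "[1, 2, 2, 3, 3, 4]"])
      (use pure_II[OF assms] in \<open>simp_all add: basis_II_def Let_def\<close>)
  show "set (basis_II E x (S\<^sub>1 a b c)) \<subseteq> gen (S\<^sub>1 a b c)"
    by (auto simp: basis_II_def Let_def intro!: gen_closed T_E T_A gen_self)
qed (simp add: basis_II_def Let_def)

lemma independent_II_a: "distinct (basis_II E x \<nu>\<^sub>a)" "vec.independent (set (basis_II E x \<nu>\<^sub>a))"
proof -
  have basis: "basis_II E x \<nu>\<^sub>a = [S\<^sub>1 1 (- 1) 0, S\<^sub>2 1 1 (- 1) (- 1) 0 0, S\<^sub>2 0 (- 1) 1 0 (- 1) 1, S\<^sub>3 1 1 (- 1) (- 1) 0 0, S\<^sub>3 1 0 0 (- 1) (- 1) 1, S\<^sub>4 0 (- 1) 1]"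
    by (subst basis_II_20) simp_all
  \<comment> \<open>The two basis vectors of support 2 are not orthogonal to each other, nor are
    those of support 3. The second list is the dual basis up to scalars, formed within the span of
    each pair.\<close>
  have "\<forall>i<6. \<forall>j<6. herm (basis_II E x \<nu>\<^sub>a ! i) ([S\<^sub>1 1 (- 1) 0, S\<^sub>2 2 1 (- 1) (- 2) (- 1) 1, S\<^sub>2 1 (- 1) 1 (- 1) (- 2) 2, S\<^sub>3 1 2 (- 2) (- 1) 1 (- 1), S\<^sub>3 1 (- 1) 1 (- 1) (- 2) 2, S\<^sub>4 0 (- 1) 1] ! j) = 0
      \<longleftrightarrow> i \<noteq> j"
    unfolding basis all_less_6 by (simp add: coords)
  then show "distinct (basis_II E x \<nu>\<^sub>a)" "vec.independent (set (basis_II E x \<nu>\<^sub>a))"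
    using independent_dual[of "[S\<^sub>1 1 (- 1) 0, S\<^sub>2 2 1 (- 1) (- 2) (- 1) 1, S\<^sub>2 1 (- 1) 1 (- 1) (- 2) 2, S\<^sub>3 1 2 (- 2) (- 1) 1 (- 1), S\<^sub>3 1 (- 1) 1 (- 1) (- 2) 2, S\<^sub>4 0 (- 1) 1]"
        "basis_II E x \<nu>\<^sub>a"]
    by (simp_all add: basis)
qed

lemma independent_II_b: "distinct (basis_II E x \<nu>\<^sub>b)" "vec.independent (set (basis_II E x \<nu>\<^sub>b))"
proof -
  have basis: "basis_II E x \<nu>\<^sub>b = [S\<^sub>1 1 1 (- 2), S\<^sub>2 1 1 1 1 (- 2) (- 2), S\<^sub>2 (- 2) 1 1 (- 2) 1 1, S\<^sub>3 1 1 1 1 (- 2) (- 2), S\<^sub>3 (- 1) 2 2 (- 1) (- 1) (- 1), S\<^sub>4 2 (- 1) (- 1)]"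
    by (subst basis_II_20) simp_all
  have "\<forall>i<6. \<forall>j<6. herm (basis_II E x \<nu>\<^sub>b ! i) ([S\<^sub>1 1 1 (- 2), S\<^sub>2 0 3 3 0 (- 3) (- 3), S\<^sub>2 (- 3) 3 3 (- 3) 0 0, S\<^sub>3 3 0 0 3 (- 3) (- 3), S\<^sub>3 (- 3) 3 3 (- 3) 0 0, S\<^sub>4 2 (- 1) (- 1)] ! j) = 0
      \<longleftrightarrow> i \<noteq> j"
    unfolding basis all_less_6 by (simp add: coords)
  then show "distinct (basis_II E x \<nu>\<^sub>b)" "vec.independent (set (basis_II E x \<nu>\<^sub>b))"
    using independent_dual[of "[S\<^sub>1 1 1 (- 2), S\<^sub>2 0 3 3 0 (- 3) (- 3), S\<^sub>2 (- 3) 3 3 (- 3) 0 0, S\<^sub>3 3 0 0 3 (- 3) (- 3), S\<^sub>3 (- 3) 3 3 (- 3) 0 0, S\<^sub>4 2 (- 1) (- 1)]"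
        "basis_II E x \<nu>\<^sub>b"]
    by (simp_all add: basis)
qed

abbreviation "basis_III c \<equiv> [\<nu>\<^sub>2 c, Estar E x 3 *v (A *v \<nu>\<^sub>2 c)]"

lemma pure_III: "k < 2 \<Longrightarrow> Estar E x ([2, 3] ! k) *v (basis_III c ! k) = basis_III c ! k"
proof -
  have "\<forall>k<2. Estar E x ([2, 3] ! k) *v (basis_III c ! k) = basis_III c ! k"
    unfolding all_less_2 by (simp add: coords)
  then show "k < 2 \<Longrightarrow> ?thesis" by blast
qed

lemma span_III: "gen (\<nu>\<^sub>2 c) = vec.span (set (basis_III c))"
proof (rule gen_eq_span)
  show "T_module E x (vec.span (set (basis_III c)))"
    by (rule T_module_span[OF represents_III, of "[2, 3]"]) (use pure_III in simp_all)
  show "set (basis_III c) \<subseteq> gen (\<nu>\<^sub>2 c)"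
    by (auto intro!: gen_closed T_E T_A gen_self)
qed simp

lemma independent_III:
  assumes "c \<noteq> 0"
  shows "distinct (basis_III c)" "vec.independent (set (basis_III c))"
proof -
  have "\<forall>i<2. \<forall>j<2. herm (basis_III c ! i) (basis_III c ! j) = 0 \<longleftrightarrow> i \<noteq> j"
    unfolding all_less_2 basis_III_20 using assms by (simp add: coords)
  then show "distinct (basis_III c)" "vec.independent (set (basis_III c))"
    using independent_dual[of "basis_III c" "basis_III c"] by simp_all
qed

text \<open>The basis vectors of type II have supports 1 to 4, so \<open>Estar E x 0\<close> kills
  them, and those on the hexagon have alternating sum zero, so \<open>e\<^sub>2\<close> kills them
  as well.\<close>

lemma sep_01: "B \<in> T \<Longrightarrow> Estar E x 0 ** B ** e\<^sub>1 = 0"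
  and sep_21: "B \<in> T \<Longrightarrow> e\<^sub>2 ** B ** e\<^sub>1 = 0"
proof -
  have "\<exists>U. T_module E x U \<and> u \<in> U \<and> (\<forall>w\<in>U. Estar E x 0 *v w = 0 \<and> e\<^sub>2 *v w = 0)"
    if fix_u: "e\<^sub>1 *v u = u" for u
  proof -
    obtain a b c where u: "a + b + c = 0" "u = S\<^sub>1 a b c" using fix_u by (auto simp: e1_fix)
    have "vec.subspace {w. Estar E x 0 *v w = 0 \<and> e\<^sub>2 *v w = 0}"
      by (simp add: vec.subspace_def matrix_vector_right_distrib mult_vec_scale)
    moreover have "set (basis_II E x u) \<subseteq> {w. Estar E x 0 *v w = 0 \<and> e\<^sub>2 *v w = 0}"
      unfolding u(2) basis_II_20[OF u(1)] using u(1) by (simp add: e2_20 coords)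
    ultimately have "\<forall>w\<in>gen u. Estar E x 0 *v w = 0 \<and> e\<^sub>2 *v w = 0"
      unfolding u(2) span_II[OF u(1)] using vec.span_minimal by blast
    then show ?thesis using T_module_gen[of u] gen_self[of u] by blast
  qed
  then have "\<exists>U. T_module E x U \<and> u \<in> U \<and> (\<forall>w\<in>U. Estar E x 0 *v w = 0)"
    "\<exists>U. T_module E x U \<and> u \<in> U \<and> (\<forall>w\<in>U. e\<^sub>2 *v w = 0)" if "e\<^sub>1 *v u = u" for u
    using that by metis+
  then show "B \<in> T \<Longrightarrow> Estar E x 0 ** B ** e\<^sub>1 = 0" "B \<in> T \<Longrightarrow> e\<^sub>2 ** B ** e\<^sub>1 = 0"
    using separatedI[OF e1_idem, of "Estar E x 0" B] separatedI[OF e1_idem, of e\<^sub>2 B] by simp_all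
qed

lemma sep_02: "B \<in> T \<Longrightarrow> Estar E x 0 ** B ** e\<^sub>2 = 0"
proof (rule separatedI)
  show "e\<^sub>2 ** e\<^sub>2 = e\<^sub>2" using primitive_e2 by (simp add: primitive_def)
  fix u assume fix_u: "e\<^sub>2 *v u = u"
  have "\<exists>c. e\<^sub>2 *v u = \<nu>\<^sub>2 c"
    by (rule L_surj[of u], simp only: e2_20, rule exI, rule refl)
  with fix_u obtain c where u: "u = \<nu>\<^sub>2 c" by auto
  have "vec.subspace {w. Estar E x 0 *v w = 0}"
    by (simp add: vec.subspace_def matrix_vector_right_distrib mult_vec_scale)
  moreover have "set (basis_III c) \<subseteq> {w. Estar E x 0 *v w = 0}"
    by (simp add: coords)
  ultimately have "\<forall>w\<in>gen u. Estar E x 0 *v w = 0"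
    unfolding u span_III using vec.span_minimal by blast
  then show "\<exists>U. T_module E x U \<and> u \<in> U \<and> (\<forall>w\<in>U. Estar E x 0 *v w = 0)"
    using T_module_gen[of u] gen_self[of u] by blast
qed

lemma sep: assumes "B \<in> T"
  shows "Estar E x 0 ** B ** e\<^sub>1 = 0" "e\<^sub>2 ** B ** e\<^sub>1 = 0" "Estar E x 0 ** B ** e\<^sub>2 = 0"
    "e\<^sub>1 ** B ** Estar E x 0 = 0" "e\<^sub>1 ** B ** e\<^sub>2 = 0" "e\<^sub>2 ** B ** Estar E x 0 = 0"
  using assms sep_01 sep_21 sep_02 separated_sym[OF adjoint_Estar adjoint_e1 sep_01]
    separated_sym[OF adjoint_e2 adjoint_e1 sep_21] separated_sym[OF adjoint_Estar adjoint_e2 sep_02]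
  by simp_all

lemma range_e: "vec.dim (range ((*v) (Estar E x 0))) = 1" "vec.dim (range ((*v) e\<^sub>1)) = 2"
  "vec.dim (range ((*v) e\<^sub>2)) = 1"
proof -
  have single: "vec.dim (range ((*v) M)) = 1" if "\<And>v. \<exists>c. M *v v = c *s u" "M *v u = u" "u \<noteq> 0"
    for M :: "complex^'v^'v" and u
  proof -
    have "range ((*v) M) = vec.span {u}"
    proof
      show "range ((*v) M) \<subseteq> vec.span {u}" using that(1) by (auto simp: vec.span_singleton)
      have "c *s u \<in> range ((*v) M)" for c
        using that(2) by (metis mult_vec_scale rangeI)
      then show "vec.span {u} \<subseteq> range ((*v) M)" by (auto simp: vec.span_singleton)
    qed
    then show ?thesis using that(3) by (simp add: vec.dim_singleton)
  qed
  show "vec.dim (range ((*v) (Estar E x 0))) = 1"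
  proof (rule single[OF _ fix_e(1,2)])
    show "\<exists>c. Estar E x 0 *v v = c *s estar E x 0" for v
      by (rule L_surj[of v]) (simp add: estar_20 coords)
  qed
  show "vec.dim (range ((*v) e\<^sub>2)) = 1"
  proof (rule single[OF _ fix_e(7) fix_e(8)])
    show "\<exists>c. e\<^sub>2 *v v = c *s \<nu>\<^sub>2 1" for v
      by (rule L_surj[of v], simp only: e2_20, rule exI, rule nu2_scale)
  qed simp
  have "range ((*v) e\<^sub>1) \<subseteq> vec.span {\<nu>\<^sub>a, \<nu>\<^sub>b}"
  proof clarify
    fix v
    have "e\<^sub>1 *v (e\<^sub>1 *v v) = e\<^sub>1 *v v" using e1_idem by (simp add: matrix_vector_mul_assoc)
    then obtain a b c where u: "a + b + c = 0" "e\<^sub>1 *v v = S\<^sub>1 a b c" by (auto simp: e1_fix)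
    have c: "c = - a - b" using u(1) by (simp add: eq_neg_iff_add_eq_0 algebra_simps)
    have "e\<^sub>1 *v v = ((a - b) / 2) *s \<nu>\<^sub>a + ((a + b) / 2) *s \<nu>\<^sub>b"
      by (simp add: u(2) c coords field_simps)
    then show "e\<^sub>1 *v v \<in> vec.span {\<nu>\<^sub>a, \<nu>\<^sub>b}"
      by (simp add: vec.span_add vec.span_scale vec.span_base)
  qed
  moreover have "{\<nu>\<^sub>a, \<nu>\<^sub>b} \<subseteq> range ((*v) e\<^sub>1)"
    using fix_e(3,5) by (metis insert_subset empty_subsetI rangeI)
  moreover have "vec.independent {\<nu>\<^sub>a, \<nu>\<^sub>b}"
    by (rule independent_orthogonal) (auto simp: coords)
  ultimately have "card {\<nu>\<^sub>a, \<nu>\<^sub>b} = vec.dim (range ((*v) e\<^sub>1))"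
    by (intro vec.basis_card_eq_dim)
  moreover have "\<nu>\<^sub>a \<noteq> \<nu>\<^sub>b" by (simp add: coords)
  ultimately show "vec.dim (range ((*v) e\<^sub>1)) = 2" by simp
qed

lemma L_uminus: "length cs = 20 \<Longrightarrow> - L cs = L (map uminus cs)"
  by (rule vec_eqI) (simp add: L_nth)

subsection \<open>The spectrum\<close>

lemma eigenspace_3:
  shows "1 \<le> vec.dim (eigenspace A 3)"
proof -
  let ?vs = "[L [1, 1, 1, 1, 1, 1, 1, 1, 1, 1, 1, 1, 1, 1, 1, 1, 1, 1, 1, 1]]"
  let ?ds = "[L [1, 0, 0, 0, 0, 0, 0, 0, 0, 0, 0, 0, 0, 0, 0, 0, 0, 0, 0, 0]]"
  have "length ?vs \<le> vec.dim (eigenspace A 3)"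
  proof (rule dim_ge_dual)
    show "set ?vs \<subseteq> eigenspace A 3"
      by (simp add: eigenspace_def coords)
    have "\<forall>i<1. \<forall>j<1. herm (?vs ! i) (?ds ! j) = 0 \<longleftrightarrow> i \<noteq> j"
      unfolding all_less_1 by (simp add: coords)
    then show "herm (?vs ! i) (?ds ! j) = 0 \<longleftrightarrow> i \<noteq> j" if "i < length ?vs" "j < length ?vs" for i j
      using that by simp
  qed simp
  then show ?thesis by simp
qed

text \<open>Stated for an abstract root \<open>s\<close> so that it covers both signs of the square
  root.\<close>

lemma eigenspace_sqrt5:
  assumes s: "s * s = 5"
  shows "3 \<le> vec.dim (eigenspace A s)"
proof -
  have s': "s * (s * w) = 5 * w" for w using s by (simp flip: mult.assoc)
  let ?vs = "[L [1, 0, 0, s, (- 1 + s) / 2, (- 1 - s) / 2, (- 1 - s) / 2, (- 1 + s) / 2, 2, 2, (1 - s) / 2, - 2, - 2, (1 - s) / 2, (1 + s) / 2, (1 + s) / 2, - s, 0, 0, - 1],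
      L [0, 1, 0, - 1, (- 1 + s) / 2, (1 + s) / 2, 1, - 1, (- 1 - s) / 2, (1 - s) / 2, 1, (1 + s) / 2, (- 1 + s) / 2, (1 - s) / 2, (- 1 - s) / 2, - 1, 1, - 1, 0, 0],
      L [0, 0, 1, - 1, - 1, 1, (1 + s) / 2, (- 1 + s) / 2, (1 - s) / 2, (- 1 - s) / 2, (1 - s) / 2, (- 1 + s) / 2, (1 + s) / 2, 1, - 1, (- 1 - s) / 2, 1, 0, - 1, 0]]"
  \<comment> \<open>Unit vectors at the pivots: at these coordinates the vectors \<open>?vs\<close>
    form an identity block.\<close>
  let ?ds = "[L [1, 0, 0, 0, 0, 0, 0, 0, 0, 0, 0, 0, 0, 0, 0, 0, 0, 0, 0, 0],
      L [0, 1, 0, 0, 0, 0, 0, 0, 0, 0, 0, 0, 0, 0, 0, 0, 0, 0, 0, 0],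
      L [0, 0, 1, 0, 0, 0, 0, 0, 0, 0, 0, 0, 0, 0, 0, 0, 0, 0, 0, 0]]"
  have "length ?vs \<le> vec.dim (eigenspace A s)"
  proof (rule dim_ge_dual)
    show "set ?vs \<subseteq> eigenspace A s"
      by (simp add: eigenspace_def coords field_simps s s')
    have "\<forall>i<3. \<forall>j<3. herm (?vs ! i) (?ds ! j) = 0 \<longleftrightarrow> i \<noteq> j"
      unfolding all_less_3 by (simp add: coords)
    then show "herm (?vs ! i) (?ds ! j) = 0 \<longleftrightarrow> i \<noteq> j" if "i < length ?vs" "j < length ?vs" for i j
      using that by simp
  qed simp
  then show ?thesis by simp
qed

lemma eigenspace_1:
  shows "5 \<le> vec.dim (eigenspace A 1)"
proof -
  let ?vs = "[L [1, 0, 0, 1, 0, - 1, 0, - 1, - 1, 1, - 1, - 1, 1, 0, - 1, 0, 1, 0, 0, 1],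
      L [0, 1, 0, - 1, 0, 1, 0, 0, 0, - 1, 0, 0, - 1, 0, 1, 0, - 1, 1, 0, 0],
      L [0, 0, 1, - 1, 0, 0, 0, 1, 0, - 1, 1, 0, - 1, 0, 0, 0, - 1, 0, 1, 0],
      L [0, 0, 0, 0, 1, - 1, 0, 0, - 1, 1, 0, - 1, 1, 1, - 1, 0, 0, 0, 0, 0],
      L [0, 0, 0, 0, 0, 0, 1, - 1, - 1, 1, - 1, - 1, 1, 0, 0, 1, 0, 0, 0, 0]]"
  let ?ds = "[L [1, 0, 0, 0, 0, 0, 0, 0, 0, 0, 0, 0, 0, 0, 0, 0, 0, 0, 0, 0],
      L [0, 1, 0, 0, 0, 0, 0, 0, 0, 0, 0, 0, 0, 0, 0, 0, 0, 0, 0, 0],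
      L [0, 0, 1, 0, 0, 0, 0, 0, 0, 0, 0, 0, 0, 0, 0, 0, 0, 0, 0, 0],
      L [0, 0, 0, 0, 1, 0, 0, 0, 0, 0, 0, 0, 0, 0, 0, 0, 0, 0, 0, 0],
      L [0, 0, 0, 0, 0, 0, 1, 0, 0, 0, 0, 0, 0, 0, 0, 0, 0, 0, 0, 0]]"
  have "length ?vs \<le> vec.dim (eigenspace A 1)"
  proof (rule dim_ge_dual)
    show "set ?vs \<subseteq> eigenspace A 1"
      by (simp add: eigenspace_def coords)
    have "\<forall>i<5. \<forall>j<5. herm (?vs ! i) (?ds ! j) = 0 \<longleftrightarrow> i \<noteq> j"
      unfolding all_less_5 by (simp add: coords)
    then show "herm (?vs ! i) (?ds ! j) = 0 \<longleftrightarrow> i \<noteq> j" if "i < length ?vs" "j < length ?vs" for i j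
      using that by simp
  qed simp
  then show ?thesis by simp
qed

lemma eigenspace_0:
  shows "4 \<le> vec.dim (eigenspace A 0)"
proof -
  let ?vs = "[L [1, 0, 0, 0, 0, - 1, 0, - 1, 0, - 1, 1, 0, 1, 0, 1, 0, 0, 0, 0, - 1],
      L [0, 1, 0, - 1, 0, 0, - 1, 1, 0, 0, - 1, 0, 0, 0, 0, 1, 1, - 1, 0, 0],
      L [0, 0, 1, - 1, 0, 0, - 1, 1, - 1, 1, - 1, 1, - 1, 0, 0, 1, 1, 0, - 1, 0],
      L [0, 0, 0, 0, 1, - 1, 1, - 1, 1, - 1, 1, - 1, 1, - 1, 1, - 1, 0, 0, 0, 0]]"
  let ?ds = "[L [1, 0, 0, 0, 0, 0, 0, 0, 0, 0, 0, 0, 0, 0, 0, 0, 0, 0, 0, 0],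
      L [0, 1, 0, 0, 0, 0, 0, 0, 0, 0, 0, 0, 0, 0, 0, 0, 0, 0, 0, 0],
      L [0, 0, 1, 0, 0, 0, 0, 0, 0, 0, 0, 0, 0, 0, 0, 0, 0, 0, 0, 0],
      L [0, 0, 0, 0, 1, 0, 0, 0, 0, 0, 0, 0, 0, 0, 0, 0, 0, 0, 0, 0]]"
  have "length ?vs \<le> vec.dim (eigenspace A 0)"
  proof (rule dim_ge_dual)
    show "set ?vs \<subseteq> eigenspace A 0"
      by (simp add: eigenspace_def coords)
    have "\<forall>i<4. \<forall>j<4. herm (?vs ! i) (?ds ! j) = 0 \<longleftrightarrow> i \<noteq> j"
      unfolding all_less_4 by (simp add: coords)
    then show "herm (?vs ! i) (?ds ! j) = 0 \<longleftrightarrow> i \<noteq> j" if "i < length ?vs" "j < length ?vs" for i j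
      using that by simp
  qed simp
  then show ?thesis by simp
qed

lemma eigenspace_minus_2:
  shows "4 \<le> vec.dim (eigenspace A (- 2))"
proof -
  let ?vs = "[L [1, 0, 0, - 2, 0, - 1, 0, - 1, 2, 1, - 1, 2, 1, 0, - 1, 0, - 2, 0, 0, 1],
      L [0, 1, 0, - 1, 0, - 2, 1, - 1, 2, 0, - 1, 2, 0, 0, - 2, 1, - 1, 1, 0, 0],
      L [0, 0, 1, - 1, 0, 0, - 1, - 1, 1, 1, - 1, 1, 1, 0, 0, - 1, - 1, 0, 1, 0],
      L [0, 0, 0, 0, 1, - 1, 1, - 1, 1, - 1, - 1, 1, - 1, 1, - 1, 1, 0, 0, 0, 0]]"
  let ?ds = "[L [1, 0, 0, 0, 0, 0, 0, 0, 0, 0, 0, 0, 0, 0, 0, 0, 0, 0, 0, 0],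
      L [0, 1, 0, 0, 0, 0, 0, 0, 0, 0, 0, 0, 0, 0, 0, 0, 0, 0, 0, 0],
      L [0, 0, 1, 0, 0, 0, 0, 0, 0, 0, 0, 0, 0, 0, 0, 0, 0, 0, 0, 0],
      L [0, 0, 0, 0, 1, 0, 0, 0, 0, 0, 0, 0, 0, 0, 0, 0, 0, 0, 0, 0]]"
  have "length ?vs \<le> vec.dim (eigenspace A (- 2))"
  proof (rule dim_ge_dual)
    show "set ?vs \<subseteq> eigenspace A (- 2)"
      by (simp add: eigenspace_def coords L_uminus)
    have "\<forall>i<4. \<forall>j<4. herm (?vs ! i) (?ds ! j) = 0 \<longleftrightarrow> i \<noteq> j"
      unfolding all_less_4 by (simp add: coords)
    then show "herm (?vs ! i) (?ds ! j) = 0 \<longleftrightarrow> i \<noteq> j" if "i < length ?vs" "j < length ?vs" for i j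
      using that by simp
  qed simp
  then show ?thesis by simp
qed

lemma spectrum:
  "has_spectrum A [(3, 1), (complex_of_real (sqrt 5), 3), (1, 5), (0, 4), (- 2, 4), (- complex_of_real (sqrt 5), 3)]"
proof (rule has_spectrumI)
  let ?s = "complex_of_real (sqrt 5)"
  have s: "?s * ?s = 5" by (rule sqrt5_square)
  have "?s \<noteq> c" if "c * c \<noteq> 5" for c using s that by auto
  \<comment> \<open>The negated values handle the comparisons with \<open>- ?s\<close>, and 0 also
    separates \<open>?s\<close> from \<open>- ?s\<close>.\<close>
  from this[of 3] this[of "- 3"] this[of 1] this[of "- 1"] this[of 0] this[of 2] this[of "- 2"]
  have "?s \<notin> {3, - 3, 1, - 1, 0, 2, - 2}" by simp
  then show "distinct (map fst [(3, 1), (?s, 3), (1, 5), (0, 4), (- 2, 4), (- ?s, 3)])"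
    by (auto simp: minus_equation_iff[of ?s] eq_neg_iff_add_eq_0 add.commute)
  show "adjoint A = A" by (rule adjoint_adj_matrix[OF symp_E])
  show "(\<Sum>(\<theta>, m)\<leftarrow>[(3, 1), (?s, 3), (1, 5), (0, 4), (- 2, 4), (- ?s, 3)]. m) = CARD('v)"
    by (simp add: card_V)
  show "0 < m \<and> m \<le> vec.dim (eigenspace A \<theta>)"
    if "(\<theta>, m) \<in> set [(3, 1), (?s, 3), (1, 5), (0, 4), (- 2, 4), (- ?s, 3)]" for \<theta> m
    using that eigenspace_3 eigenspace_sqrt5[OF s] eigenspace_1 eigenspace_0 eigenspace_minus_2
      eigenspace_sqrt5[of "- ?s"] s by auto
qed

subsection \<open>Orderings of the vertices at distance two\<close>

lemma vs_eq_iff: "i < 20 \<Longrightarrow> j < 20 \<Longrightarrow> vs ! i = vs ! j \<longleftrightarrow> i = j"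
  using vs(1,2) by (simp add: nth_eq_iff_index_eq)

lemma E_iff: "i < 20 \<Longrightarrow> j < 20 \<Longrightarrow> E (vs ! i) (vs ! j) \<longleftrightarrow> j \<in> set (nbrs ! i)"
proof -
  assume ij: "i < 20" "j < 20"
  have "E (vs ! i) (vs ! j) \<longleftrightarrow> vs ! j \<in> (!) vs ` set (nbrs ! i)"
    using vs(5)[OF ij(1)] by blast
  also have "\<dots> \<longleftrightarrow> j \<in> set (nbrs ! i)"
    using nbrs ij by (intro inj_on_image_mem_iff[OF vs_inj]) auto
  finally show ?thesis .
qed

lemma sphere: "sphere_at E i x = (!) vs ` {k \<in> {..<20}. level ! k = i}"
proof -
  have "sphere_at E i x = {y \<in> (!) vs ` {..<20}. gdist E x y = i}"
    unfolding sphere_at_def using vs_UNIV by blast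
  then show ?thesis using vs(6) by auto
qed

lemma sphere_1: "sphere_at E 1 x = {vs ! 1, vs ! 2, vs ! 3}"
  and sphere_2: "sphere_at E 2 x = {vs ! 4, vs ! 5, vs ! 6, vs ! 7, vs ! 8, vs ! 9}"
proof -
  have "\<forall>k<20. (level ! k = 1 \<longleftrightarrow> k \<in> {1, 2, 3}) \<and> (level ! k = 2 \<longleftrightarrow> k \<in> {4, 5, 6, 7, 8, 9})"
    unfolding all_less_20 level_def by simp
  moreover have "{1, 2, 3, 4, 5, 6, 7, 8, 9} \<subseteq> {..<20::nat}" by simp
  ultimately have "{k \<in> {..<20}. level ! k = 1} = {1, 2, 3}"
    "{k \<in> {..<20}. level ! k = 2} = {4, 5, 6, 7, 8, 9}"
    by blast+
  then show "sphere_at E 1 x = {vs ! 1, vs ! 2, vs ! 3}"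
    "sphere_at E 2 x = {vs ! 4, vs ! 5, vs ! 6, vs ! 7, vs ! 8, vs ! 9}"
    by (simp_all only: sphere image_insert image_empty)
qed

lemma ex_admissible: "\<exists>ys. admissible_ordering E x ys"
proof
  have "\<forall>u\<in>sphere_at E 2 x. \<forall>w\<in>sphere_at E 2 x. E u w \<longrightarrow>
      u \<in> {vs ! 4, vs ! 6, vs ! 8} \<and> w \<in> {vs ! 5, vs ! 7, vs ! 9} \<or>
      w \<in> {vs ! 4, vs ! 6, vs ! 8} \<and> u \<in> {vs ! 5, vs ! 7, vs ! 9}"
    unfolding sphere_2 by (simp add: E_iff vs_eq_iff nbrs_def)
  \<comment> \<open>The last sibling pair is reversed, so that positions 1, 3 and 6 carry one colour
    class of the hexagon.\<close>
  then show "admissible_ordering E x [vs ! 4, vs ! 5, vs ! 6, vs ! 7, vs ! 9, vs ! 8]"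
    unfolding admissible_ordering_def ordering_of_def sphere_1
    by (simp add: sphere_2 vs_eq_iff E_iff nbrs_def insert_commute)
qed

text \<open>Both edges and sibling pairs of the hexagon join the two classes of an admissible ordering, so
  these are the two colour classes of the hexagon and the prescribed vector is \<open>\<plusminus>\<nu>\<^sub>2\<close>.\<close>

lemma admissible_sign:
  assumes ys: "admissible_ordering E x ys"
  obtains c where "c \<noteq> 0" "essential_part ys (\<nu>\<^sub>2 c) = [1, -1, 1, -1, -1, 1]"
proof -
  define P where "P = {ys ! 0, ys ! 2, ys ! 5}"
  define Q where "Q = {ys ! 1, ys ! 3, ys ! 4}"
  have len: "length ys = 6" and dist: "distinct ys" and set_ys: "set ys = sphere_at E 2 x"
    using ys by (auto simp: admissible_ordering_def ordering_of_def)
  have ys_eq: "ys = [ys ! 0, ys ! 1, ys ! 2, ys ! 3, ys ! 4, ys ! 5]"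
  proof (rule nth_equalityI)
    have "\<forall>i<6. ys ! i = [ys ! 0, ys ! 1, ys ! 2, ys ! 3, ys ! 4, ys ! 5] ! i"
      unfolding all_less_6 by simp
    then show "ys ! i = [ys ! 0, ys ! 1, ys ! 2, ys ! 3, ys ! 4, ys ! 5] ! i" if "i < length ys" for i
      using that len by metis
  qed (simp add: len)
  have PQ: "P \<inter> Q = {}" "P \<union> Q = sphere_at E 2 x"
  proof -
    have "distinct [ys ! 0, ys ! 1, ys ! 2, ys ! 3, ys ! 4, ys ! 5]" using dist ys_eq by metis
    then show "P \<inter> Q = {}" by (auto simp: P_def Q_def)
    have "set [ys ! 0, ys ! 1, ys ! 2, ys ! 3, ys ! 4, ys ! 5] = sphere_at E 2 x"
      using set_ys ys_eq by metis
    then show "P \<union> Q = sphere_at E 2 x" by (auto simp: P_def Q_def)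
  qed
  have edge: "u \<in> P \<longleftrightarrow> w \<notin> P" if "E u w" "u \<in> sphere_at E 2 x" "w \<in> sphere_at E 2 x" for u w
  proof -
    have "u \<in> P \<and> w \<in> Q \<or> w \<in> P \<and> u \<in> Q"
      using ys that unfolding admissible_ordering_def P_def Q_def by blast
    then show ?thesis using PQ(1) by blast
  qed
  have pairs: "\<exists>z\<in>sphere_at E 1 x. E z (ys ! 0) \<and> E z (ys ! 1)"
    "\<exists>z\<in>sphere_at E 1 x. E z (ys ! 2) \<and> E z (ys ! 3)"
    "\<exists>z\<in>sphere_at E 1 x. E z (ys ! 4) \<and> E z (ys ! 5)"
    using ys by (simp_all add: admissible_ordering_def)
  have partner: "\<exists>w. (u \<in> P \<and> w \<in> Q \<or> u \<in> Q \<and> w \<in> P) \<and> (\<exists>z\<in>sphere_at E 1 x. E z u \<and> E z w)"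
    if "u \<in> sphere_at E 2 x" for u
  proof -
    have "u \<in> {ys ! 0, ys ! 1, ys ! 2, ys ! 3, ys ! 4, ys ! 5}"
      using that PQ(2) by (auto simp: P_def Q_def)
    moreover have "ys ! 0 \<in> P" "ys ! 1 \<in> Q" "ys ! 2 \<in> P" "ys ! 3 \<in> Q" "ys ! 4 \<in> Q" "ys ! 5 \<in> P"
      by (auto simp: P_def Q_def)
    ultimately show ?thesis using pairs by (elim insertE emptyE) metis+
  qed
  \<comment> \<open>The partner prescribed by the ordering shares a neighbour of \<open>x\<close>
    with \<open>vs ! i\<close>, and \<open>vs ! j\<close> is the only other hexagon vertex that
    does.\<close>
  have sibling: "vs ! i \<in> P \<longleftrightarrow> vs ! j \<notin> P" if ij: "(i, j) \<in> {(4, 5), (6, 7), (8, 9)}" for i j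
  proof -
    have "vs ! i \<in> sphere_at E 2 x" using ij by (auto simp: sphere_2)
    then obtain w z where w: "vs ! i \<in> P \<and> w \<in> Q \<or> vs ! i \<in> Q \<and> w \<in> P"
      and z: "z \<in> sphere_at E 1 x" "E z (vs ! i)" "E z w"
      using partner by blast
    have "w \<in> sphere_at E 2 x" using w PQ(2) by blast
    then obtain l where l: "l \<in> {4, 5, 6, 7, 8, 9}" "w = vs ! l" unfolding sphere_2 by blast
    obtain k where k: "k \<in> {1, 2, 3}" "z = vs ! k" using z(1) unfolding sphere_1 by blast
    have small: "k < 20" "l < 20" "i < 20" using k l ij by auto
    have "i \<in> set (nbrs ! k)" "l \<in> set (nbrs ! k)"
      using z k l small by (simp_all add: E_iff)
    moreover have "\<forall>(i, j)\<in>{(4, 5), (6, 7), (8, 9)}. \<forall>k\<in>{1, 2, 3}. \<forall>l\<in>{4, 5, 6, 7, 8, 9}.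
        i \<in> set (nbrs ! k) \<and> l \<in> set (nbrs ! k) \<longrightarrow> l = i \<or> l = j"
      by (simp add: nbrs_def)
    ultimately have "l = i \<or> l = j"
      using k(1) l(1) ij by blast
    then show ?thesis using w l PQ(1) by blast
  qed
  have "vs ! 5 \<in> P \<longleftrightarrow> vs ! 6 \<notin> P" "vs ! 7 \<in> P \<longleftrightarrow> vs ! 8 \<notin> P" "vs ! 9 \<in> P \<longleftrightarrow> vs ! 4 \<notin> P"
    by (rule edge; simp add: sphere_2 E_iff nbrs_def)+
  with sibling[of 4 5] sibling[of 6 7] sibling[of 8 9]
  have alt: "(\<forall>k\<in>{4, 6, 8}. vs ! k \<in> P \<longleftrightarrow> vs ! 4 \<in> P) \<and> (\<forall>k\<in>{5, 7, 9}. vs ! k \<in> P \<longleftrightarrow> vs ! 4 \<notin> P)"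
    by simp
  define c :: complex where "c = (if vs ! 4 \<in> P then 1 else - 1)"
  have val: "\<nu>\<^sub>2 c $ u = (if u \<in> P then 1 else - 1)" if "u \<in> sphere_at E 2 x" for u
    using that alt unfolding sphere_2 by (auto simp: L_nth c_def)
  have "essential_part ys (\<nu>\<^sub>2 c) = [1, -1, 1, -1, -1, 1]"
  proof -
    have "\<nu>\<^sub>2 c $ (ys ! k) = (if ys ! k \<in> P then 1 else - 1)" if "k < 6" for k
      by (rule val) (use nth_mem[of k ys] set_ys len that in simp)
    moreover have "ys ! 0 \<in> P" "ys ! 2 \<in> P" "ys ! 5 \<in> P" "ys ! 1 \<notin> P" "ys ! 3 \<notin> P" "ys ! 4 \<notin> P"
      using PQ(1) by (auto simp: P_def Q_def)
    ultimately have "map (\<lambda>y. \<nu>\<^sub>2 c $ y) [ys ! 0, ys ! 1, ys ! 2, ys ! 3, ys ! 4, ys ! 5] =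
        [1, -1, 1, -1, -1, 1]"
      by simp
    then show ?thesis unfolding essential_part_def using ys_eq by metis
  qed
  moreover have "c \<noteq> 0" by (simp add: c_def)
  ultimately show thesis using that by blast
qed

section \<open>Assembling the module data, the decomposition and the dimension of
  \<open>T\<close>\<close>

lemma pure_vector_basis_II:
  assumes "vec.independent (set (basis_II E x (S\<^sub>1 a b c)))" "a + b + c = 0" "k < length (basis_II E x (S\<^sub>1 a b c))"
  shows "pure_vector E x ([1, 2, 2, 3, 3, 4] ! k) (basis_II E x (S\<^sub>1 a b c) ! k)"
proof -
  have "k < 6" using assms(3) by (simp add: basis_II_def Let_def)
  moreover have "basis_II E x (S\<^sub>1 a b c) ! k \<noteq> 0"
    using assms(1,3) vec.dependent_zero nth_mem by metis
  ultimately show ?thesis using pure_II[OF assms(2)] by (simp add: pure_vector_iff)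
qed

lemma pure_vector_basis_III:
  assumes "c \<noteq> 0" "k < length (basis_III c)"
  shows "pure_vector E x ([2, 3] ! k) (basis_III c ! k)"
proof -
  have "basis_III c ! k \<noteq> 0"
    using independent_III(2)[OF assms(1)] assms(2) vec.dependent_zero nth_mem by metis
  then show ?thesis using pure_III[of k c] assms(2) by (simp add: pure_vector_iff)
qed

lemma multiplicities:
  assumes "orthogonal_decomposition E x Ws"
  shows "multiplicity_in_V E x W\<^sub>0 = 1" "multiplicity_in_V E x (gen \<nu>\<^sub>a) = 2"
    "multiplicity_in_V E x (gen \<nu>\<^sub>b) = 2" "c \<noteq> 0 \<Longrightarrow> multiplicity_in_V E x (gen (\<nu>\<^sub>2 c)) = 1"
  using multiplicity_gen[OF primitive_e0 fix_e(1,2) assms] multiplicity_gen[OF primitive_e1 fix_e(3,4) assms]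
    multiplicity_gen[OF primitive_e1 fix_e(5,6) assms] multiplicity_gen[OF primitive_e2 fix_e(7,8) assms]
  by (simp_all add: range_e)

lemmas irreducibles = irreducible_gen[OF primitive_e0 fix_e(1,2)] irreducible_gen[OF primitive_e1 fix_e(3,4)]
  irreducible_gen[OF primitive_e1 fix_e(5,6)] irreducible_gen[OF primitive_e2 fix_e(7,8)]

lemma basis_data_I:
  "endpoint E x W\<^sub>0 = 0" "mod_diameter E x W\<^sub>0 = 5" "shape E x W\<^sub>0 = [1, 1, 1, 1, 1, 1]"
  "vec.dim W\<^sub>0 = 6" "pure_basis E x W\<^sub>0 (map (estar E x) [0, 1, 2, 3, 4, 5])"
proof -
  have pv: "pure_vector E x ([0, 1, 2, 3, 4, 5] ! k) (map (estar E x) [0, 1, 2, 3, 4, 5] ! k)"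
    if "k < length (map (estar E x) [0, 1, 2, 3, 4, 5])" for k
    using pure_I[of k] that by simp
  have ks: "sorted [0, 1, 2, 3, 4, 5::nat]" "[0, 1, 2, 3, 4, 5::nat] \<noteq> []"
    "\<And>i. i \<in> set [0, 1, 2, 3, 4, 5] \<Longrightarrow> i \<le> gdiam E"
    by (auto simp: gdiam)
  note data = pure_basis_data[OF _ pv independent_I ks span_I]
  show "endpoint E x W\<^sub>0 = 0" "mod_diameter E x W\<^sub>0 = 5" "vec.dim W\<^sub>0 = 6"
    using data(1,2,4) by simp_all
  show "pure_basis E x W\<^sub>0 (map (estar E x) [0, 1, 2, 3, 4, 5])"
    using data(5) by (simp del: list.map)
  show "shape E x W\<^sub>0 = [1, 1, 1, 1, 1, 1]"
    using data(3) by (simp add: upt_rec)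
qed

lemma basis_data_II:
  assumes u: "a + b + c = 0" "u = S\<^sub>1 a b c"
    and ind: "distinct (basis_II E x u)" "vec.independent (set (basis_II E x u))"
  shows "endpoint E x (gen u) = 1" "mod_diameter E x (gen u) = 3" "shape E x (gen u) = [1, 2, 2, 1]"
    "vec.dim (gen u) = 6" "pure_basis E x (gen u) (basis_II E x u)"
    "pure_vector E x 1 u" "EstarW E x 1 (gen u) = vec.span {u}" "vec.dim (EstarW E x 1 (gen u)) = 1"
proof -
  have len: "length (basis_II E x u) = 6" by (simp add: basis_II_def Let_def)
  have pv: "pure_vector E x ([1, 2, 2, 3, 3, 4] ! k) (basis_II E x u ! k)"
    if "k < length (basis_II E x u)" for k
    using pure_vector_basis_II[OF _ u(1)] ind that u(2) by simp
  have ks: "sorted [1, 2, 2, 3, 3, 4::nat]" "[1, 2, 2, 3, 3, 4::nat] \<noteq> []"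
    "\<And>i. i \<in> set [1, 2, 2, 3, 3, 4] \<Longrightarrow> i \<le> gdiam E"
    by (auto simp: gdiam)
  have l: "length [1, 2, 2, 3, 3, 4::nat] = length (basis_II E x u)" using len by simp
  have W: "gen u = vec.span (set (basis_II E x u))" using span_II[OF u(1)] u(2) by simp
  note data = pure_basis_data[OF l pv ind ks W]
  show "endpoint E x (gen u) = 1" "mod_diameter E x (gen u) = 3" "vec.dim (gen u) = 6"
    using data(1,2,4) len by simp_all
  show "pure_basis E x (gen u) (basis_II E x u)" using data(5) by simp
  show "shape E x (gen u) = [1, 2, 2, 1]"
    using data(3) by (simp add: upt_rec)
  show "pure_vector E x 1 u" using pv[of 0] len by (simp add: basis_II_def Let_def)
  have "{basis_II E x u ! k |k. k < length (basis_II E x u) \<and> [1, 2, 2, 3, 3, 4] ! k = (1::nat)} = {u}"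
  proof -
    have "\<forall>k<6. [1, 2, 2, 3, 3, 4] ! k = (1::nat) \<longleftrightarrow> k = 0" unfolding all_less_6 by simp
    moreover have "basis_II E x u ! 0 = u" by (simp add: basis_II_def Let_def)
    ultimately show ?thesis unfolding len by force
  qed
  with EstarW_span[OF l pv, of 1] W show "EstarW E x 1 (gen u) = vec.span {u}" by simp
  show "vec.dim (EstarW E x 1 (gen u)) = 1"
    unfolding W using dim_EstarW_span[OF l pv ind, of 1] by simp
qed

lemma basis_data_III:
  assumes c: "c \<noteq> 0"
  shows "endpoint E x (gen (\<nu>\<^sub>2 c)) = 2" "mod_diameter E x (gen (\<nu>\<^sub>2 c)) = 1" "shape E x (gen (\<nu>\<^sub>2 c)) = [1, 1]"
    "vec.dim (gen (\<nu>\<^sub>2 c)) = 2" "pure_basis E x (gen (\<nu>\<^sub>2 c)) (basis_III c)"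
    "pure_vector E x 2 (\<nu>\<^sub>2 c)" "EstarW E x 2 (gen (\<nu>\<^sub>2 c)) = vec.span {\<nu>\<^sub>2 c}"
    "vec.dim (EstarW E x 2 (gen (\<nu>\<^sub>2 c))) = 1"
proof -
  note pv = pure_vector_basis_III[OF c]
  have ks: "sorted [2, 3::nat]" "[2, 3::nat] \<noteq> []" "\<And>i. i \<in> set [2, 3] \<Longrightarrow> i \<le> gdiam E"
    by (auto simp: gdiam)
  have l: "length [2, 3::nat] = length (basis_III c)" by simp
  note data = pure_basis_data[OF l pv independent_III[OF c] ks span_III]
  show "endpoint E x (gen (\<nu>\<^sub>2 c)) = 2" "mod_diameter E x (gen (\<nu>\<^sub>2 c)) = 1" "vec.dim (gen (\<nu>\<^sub>2 c)) = 2"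
    using data(1,2,4) by simp_all
  show "pure_basis E x (gen (\<nu>\<^sub>2 c)) (basis_III c)" using data(5) by simp
  show "shape E x (gen (\<nu>\<^sub>2 c)) = [1, 1]"
    using data(3) by (simp add: upt_rec)
  show "pure_vector E x 2 (\<nu>\<^sub>2 c)" using pv[of 0] by simp
  have "{basis_III c ! k |k. k < length (basis_III c) \<and> [2, 3] ! k = (2::nat)} = {\<nu>\<^sub>2 c}"
  proof -
    have "\<forall>k<2. [2, 3] ! k = (2::nat) \<longleftrightarrow> k = 0" unfolding all_less_2 by simp
    moreover have "basis_III c ! 0 = \<nu>\<^sub>2 c" "length (basis_III c) = 2" by simp_all
    ultimately show ?thesis by force
  qed
  with EstarW_span[OF l pv, of 2] show "EstarW E x 2 (gen (\<nu>\<^sub>2 c)) = vec.span {\<nu>\<^sub>2 c}"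
    unfolding span_III by simp
  show "vec.dim (EstarW E x 2 (gen (\<nu>\<^sub>2 c))) = 1"
    unfolding span_III using dim_EstarW_span[OF l pv independent_III[OF c], of 2] by simp
qed

lemma orthogonal_modules:
  assumes "c \<noteq> 0"
  shows "orthogonal_decomposition E x [W\<^sub>0, gen \<nu>\<^sub>a, gen \<nu>\<^sub>b, gen (\<nu>\<^sub>2 c)]" (is "orthogonal_decomposition E x ?Ws")
proof (rule orthogonal_decompositionI)
  show "T_irreducible E x W" if "W \<in> set ?Ws" for W
    using that irreducibles assms by auto
  show "(\<Sum>W\<leftarrow>?Ws. vec.dim W) = CARD('v)"
    using basis_data_I(4) basis_data_II(4)[OF _ refl independent_II_a] basis_data_II(4)[OF _ refl independent_II_b]
      basis_data_III(4)[OF assms]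
    by (simp add: card_V)
  have ab: "herm \<nu>\<^sub>a \<nu>\<^sub>b = 0" by (simp add: coords)
  \<comment> \<open>Each pair is listed in the orientation in which its separation was proved;
    symmetry of orthogonality gives the other one.\<close>
  let ?P = "{(W\<^sub>0, gen \<nu>\<^sub>a), (W\<^sub>0, gen \<nu>\<^sub>b), (W\<^sub>0, gen (\<nu>\<^sub>2 c)),
      (gen \<nu>\<^sub>a, gen \<nu>\<^sub>b), (gen (\<nu>\<^sub>2 c), gen \<nu>\<^sub>a), (gen (\<nu>\<^sub>2 c), gen \<nu>\<^sub>b)}"
  have "herm u v = 0" if "(U, V) \<in> ?P" "u \<in> U" "v \<in> V" for U V u v
    using that
      separated_orthogonal[OF adjoint_Estar sep_01 fix_e(1,3), of u v]
      separated_orthogonal[OF adjoint_Estar sep_01 fix_e(1,5), of u v]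
      separated_orthogonal[OF adjoint_Estar sep_02 fix_e(1,7), where u' = u and v' = v]
      primitive_orthogonal[OF primitive_e1 fix_e(3,5) ab, of u v]
      separated_orthogonal[OF adjoint_e2 sep_21 fix_e(7,3), where u' = u and v' = v]
      separated_orthogonal[OF adjoint_e2 sep_21 fix_e(7,5), where u' = u and v' = v]
    by (elim insertE emptyE Pair_inject) simp_all
  then have "\<forall>(U, V)\<in>?P. \<forall>u\<in>U. \<forall>v\<in>V. herm u v = 0 \<and> herm v u = 0"
    using herm_eq_0_sym by blast
  then have all: "\<forall>i<4. \<forall>j<4. i \<noteq> j \<longrightarrow> (\<forall>u\<in>?Ws ! i. \<forall>v\<in>?Ws ! j. herm u v = 0)"
    unfolding all_less_4 by simp
  show "herm u v = 0"
    if "i < length ?Ws" "j < length ?Ws" "i \<noteq> j" "u \<in> ?Ws ! i" "v \<in> ?Ws ! j" for i j u v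
  proof -
    have "i < 4" "j < 4" using that(1,2) by simp_all
    with all that(3-5) show ?thesis by blast
  qed
qed

lemma isomorphic_modules:
  assumes "c \<noteq> 0"
  shows "\<forall>i<4. \<forall>j<4. T_isomorphic E x ([W\<^sub>0, gen \<nu>\<^sub>a, gen \<nu>\<^sub>b, gen (\<nu>\<^sub>2 c)] ! i)
      ([W\<^sub>0, gen \<nu>\<^sub>a, gen \<nu>\<^sub>b, gen (\<nu>\<^sub>2 c)] ! j) \<longleftrightarrow> [1, 2, 2, 3 :: nat] ! i = [1, 2, 2, 3] ! j"
proof -
  note c = fix_e(8)[OF assms]
  have same: "T_isomorphic E x W\<^sub>0 W\<^sub>0" "T_isomorphic E x (gen \<nu>\<^sub>a) (gen \<nu>\<^sub>a)" "T_isomorphic E x (gen \<nu>\<^sub>a) (gen \<nu>\<^sub>b)"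
    "T_isomorphic E x (gen \<nu>\<^sub>b) (gen \<nu>\<^sub>a)" "T_isomorphic E x (gen \<nu>\<^sub>b) (gen \<nu>\<^sub>b)"
    "T_isomorphic E x (gen (\<nu>\<^sub>2 c)) (gen (\<nu>\<^sub>2 c))"
    using isomorphic_gen[OF primitive_e0 fix_e(1,2) fix_e(1,2)]
      isomorphic_gen[OF primitive_e1 fix_e(3,4) fix_e(3,4)] isomorphic_gen[OF primitive_e1 fix_e(3,4) fix_e(5,6)]
      isomorphic_gen[OF primitive_e1 fix_e(5,6) fix_e(3,4)] isomorphic_gen[OF primitive_e1 fix_e(5,6) fix_e(5,6)]
      isomorphic_gen[OF primitive_e2 fix_e(7) c fix_e(7) c]
    by blast+
  have other: "\<not> T_isomorphic E x W\<^sub>0 (gen \<nu>\<^sub>a)" "\<not> T_isomorphic E x W\<^sub>0 (gen \<nu>\<^sub>b)"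
    "\<not> T_isomorphic E x W\<^sub>0 (gen (\<nu>\<^sub>2 c))"
    "\<not> T_isomorphic E x (gen \<nu>\<^sub>a) W\<^sub>0" "\<not> T_isomorphic E x (gen \<nu>\<^sub>b) W\<^sub>0"
    "\<not> T_isomorphic E x (gen (\<nu>\<^sub>2 c)) W\<^sub>0"
    "\<not> T_isomorphic E x (gen (\<nu>\<^sub>2 c)) (gen \<nu>\<^sub>a)" "\<not> T_isomorphic E x (gen (\<nu>\<^sub>2 c)) (gen \<nu>\<^sub>b)"
    "\<not> T_isomorphic E x (gen \<nu>\<^sub>a) (gen (\<nu>\<^sub>2 c))" "\<not> T_isomorphic E x (gen \<nu>\<^sub>b) (gen (\<nu>\<^sub>2 c))"
    by (rule separated_not_isomorphic[OF e_T(1) sep(1) fix_e(1,2) fix_e(3)]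
        separated_not_isomorphic[OF e_T(1) sep(1) fix_e(1,2) fix_e(5)]
        separated_not_isomorphic[OF e_T(1) sep(3) fix_e(1,2) fix_e(7)]
        separated_not_isomorphic[OF e_T(2) sep(4) fix_e(3,4) fix_e(1)]
        separated_not_isomorphic[OF e_T(2) sep(4) fix_e(5,6) fix_e(1)]
        separated_not_isomorphic[OF e_T(3) sep(6) fix_e(7) c fix_e(1)]
        separated_not_isomorphic[OF e_T(3) sep(2) fix_e(7) c fix_e(3)]
        separated_not_isomorphic[OF e_T(3) sep(2) fix_e(7) c fix_e(5)]
        separated_not_isomorphic[OF e_T(2) sep(5) fix_e(3,4) fix_e(7)]
        separated_not_isomorphic[OF e_T(2) sep(5) fix_e(5,6) fix_e(7)]; assumption)+
  show ?thesis
    unfolding all_less_4 by (simp add: same other)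
qed

lemma dim_T: "mat_space.dim T = 76"
proof -
  let ?e = "(!) [Estar E x 0, e\<^sub>1, e\<^sub>2]" and ?u = "(!) [estar E x 0, \<nu>\<^sub>a, \<nu>\<^sub>2 1]"
  let ?n = "(!) [6, 6, 2::nat]"
  \<comment> \<open>An orthogonal basis is required here. In the type II basis v_1, ..., v_6 of
    \<open>\<nu>\<^sub>a\<close>, the vectors v_3 and v_5 are therefore replaced by 2 v_3 + v_2 and
    2 v_5 - v_4.\<close>
  let ?w = "\<lambda>i. (!) ([map (estar E x) [0, 1, 2, 3, 4, 5],
    [\<nu>\<^sub>a, S\<^sub>2 1 1 (- 1) (- 1) 0 0, S\<^sub>2 1 (- 1) 1 (- 1) (- 2) 2,
     S\<^sub>3 1 1 (- 1) (- 1) 0 0, S\<^sub>3 1 (- 1) 1 (- 1) (- 2) 2, S\<^sub>4 0 (- 1) 1], basis_III 1] ! i)"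
  have "mat_space.dim T = (\<Sum>i<3. (?n i)\<^sup>2)"
  proof (rule dim_terwilliger)
    show "primitive (?e i)" if "i < 3" for i
      using that primitive_e0 primitive_e1 primitive_e2 by (auto simp: less_Suc_eq numeral_3_eq_3)
    show "?e i ** B ** ?e j = 0" if "i < 3" "j < 3" "i \<noteq> j" "B \<in> T" for i j B
    proof -
      have "\<forall>i<3. \<forall>j<3. i \<noteq> j \<longrightarrow> ?e i ** B ** ?e j = 0"
        unfolding all_less_3 using sep[OF that(4)] that(4) by simp
      then show ?thesis using that by blast
    qed
    show "?e i *v ?u i = ?u i" "?u i \<noteq> 0" if "i < 3" for i
      using that fix_e(1-4) fix_e(7,8)[of 1] by (auto simp: less_Suc_eq numeral_3_eq_3)
    show "?w i j \<in> gen (?u i)" if "i < 3" "j < ?n i" for i j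
    proof -
      have "\<forall>j<6. estar E x j \<in> W\<^sub>0" by (simp add: estar_gen)
      then have "\<forall>j<6. ?w 0 j \<in> W\<^sub>0" unfolding all_less_6 by simp
      moreover have "\<forall>j<6. ?w 1 j \<in> gen \<nu>\<^sub>a"
      proof -
        have basis: "basis_II E x \<nu>\<^sub>a = [\<nu>\<^sub>a, S\<^sub>2 1 1 (- 1) (- 1) 0 0, S\<^sub>2 0 (- 1) 1 0 (- 1) 1,
            S\<^sub>3 1 1 (- 1) (- 1) 0 0, S\<^sub>3 1 0 0 (- 1) (- 1) 1, S\<^sub>4 0 (- 1) 1]"
          by (subst basis_II_20) simp_all
        have "v \<in> gen \<nu>\<^sub>a" if "v \<in> set (basis_II E x \<nu>\<^sub>a)" for v
          using span_II[of 1 "- 1" 0] that by (simp add: vec.span_base)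
        then have base: "\<nu>\<^sub>a \<in> gen \<nu>\<^sub>a" "S\<^sub>2 1 1 (- 1) (- 1) 0 0 \<in> gen \<nu>\<^sub>a" "S\<^sub>2 0 (- 1) 1 0 (- 1) 1 \<in> gen \<nu>\<^sub>a"
          "S\<^sub>3 1 1 (- 1) (- 1) 0 0 \<in> gen \<nu>\<^sub>a" "S\<^sub>3 1 0 0 (- 1) (- 1) 1 \<in> gen \<nu>\<^sub>a" "S\<^sub>4 0 (- 1) 1 \<in> gen \<nu>\<^sub>a"
          unfolding basis by simp_all
        have "2 *s S\<^sub>2 0 (- 1) 1 0 (- 1) 1 + S\<^sub>2 1 1 (- 1) (- 1) 0 0 \<in> gen \<nu>\<^sub>a"
          "2 *s S\<^sub>3 1 0 0 (- 1) (- 1) 1 + (- 1) *s S\<^sub>3 1 1 (- 1) (- 1) 0 0 \<in> gen \<nu>\<^sub>a"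
          by (intro vec.subspace_add[OF subspace_gen] vec.subspace_scale[OF subspace_gen] base)+
        then have "S\<^sub>2 1 (- 1) 1 (- 1) (- 2) 2 \<in> gen \<nu>\<^sub>a" "S\<^sub>3 1 (- 1) 1 (- 1) (- 2) 2 \<in> gen \<nu>\<^sub>a"
          by (simp_all only: coords, simp_all)
        with base show ?thesis unfolding all_less_6 by simp
      qed
      moreover have "\<forall>j<2. ?w 2 j \<in> gen (\<nu>\<^sub>2 1)"
        unfolding all_less_2 span_III by (simp add: vec.span_base)
      ultimately have "\<forall>i<3. \<forall>j<?n i. ?w i j \<in> gen (?u i)"
        unfolding all_less_3 by simp
      then show ?thesis using that by blast
    qed
    have "\<forall>i<3. \<forall>j<?n i. \<forall>k<?n i. herm (?w i j) (?w i k) = 0 \<longleftrightarrow> j \<noteq> k"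
      unfolding all_less_3 by (simp add: all_less_6 all_less_2 estar_20 coords)
    then have *: "herm (?w i j) (?w i k) = 0 \<longleftrightarrow> j \<noteq> k" if "i < 3" "j < ?n i" "k < ?n i" for i j k
      using that by blast
    show "?w i j \<noteq> 0" if "i < 3" "j < ?n i" for i j
      using *[OF that that(2)] by (metis herm_0_left)
    show "herm (?w i j) (?w i k) = 0" if "i < 3" "j < ?n i" "k < ?n i" "j \<noteq> k" for i j k
      using *[OF that(1-3)] that(4) by blast
    show "(\<Sum>i<3. ?n i * vec.dim (range ((*v) (?e i)))) = CARD('v)"
      unfolding less_3 by (simp add: range_e card_V)
  qed
  then show ?thesis by (simp add: less_3)
qed

text \<open>The type II seeds are explicit because the labelling starts from \<open>zs\<close>;
  \<open>ys\<close> enters only through the scalar \<open>c\<close> of the type III seed.\<close>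

lemma decomposition:
  assumes ys: "admissible_ordering E x ys" and zs: "zs = [vs ! 1, vs ! 2, vs ! 3]"
  shows "\<exists>W0 W1a W1b W2 \<nu>a \<nu>b \<nu>2.
          orthogonal_decomposition E x [W0, W1a, W1b, W2] \<and>
          (\<forall>i<4. \<forall>j<4. T_isomorphic E x ([W0, W1a, W1b, W2] ! i) ([W0, W1a, W1b, W2] ! j) \<longleftrightarrow>
             [1, 2, 2, 3 :: nat] ! i = [1, 2, 2, 3] ! j) \<and>
          module_data E x W0 0 1 6 5 [1, 1, 1, 1, 1, 1]
            (map (estar E x) [0, 1, 2, 3, 4, 5]) B_I
            [3, complex_of_real (sqrt 5), 1, 0, -2, - complex_of_real (sqrt 5)] \<and>
          is_seed E x W1a zs [1, -1, 0] \<nu>a \<and>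
          A *v \<nu>a = Estar E x 2 *v (A *v \<nu>a) \<and>
          module_data E x W1a 1 2 6 3 [1, 2, 2, 1] (basis_II E x \<nu>a) B_II
            [complex_of_real (sqrt 5), 1, 1, 0, -2, - complex_of_real (sqrt 5)] \<and>
          is_seed E x W1b zs [1, 1, -2] \<nu>b \<and>
          A *v \<nu>b = Estar E x 2 *v (A *v \<nu>b) \<and>
          module_data E x W1b 1 2 6 3 [1, 2, 2, 1] (basis_II E x \<nu>b) B_II
            [complex_of_real (sqrt 5), 1, 1, 0, -2, - complex_of_real (sqrt 5)] \<and>
          is_seed E x W2 ys [1, -1, 1, -1, -1, 1] \<nu>2 \<and>
          module_data E x W2 2 1 2 1 [1, 1]
            [\<nu>2, Estar E x 3 *v (A *v \<nu>2)] B_III [0, -2]"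
proof -
  obtain c where c: "c \<noteq> 0" "essential_part ys (\<nu>\<^sub>2 c) = [1, -1, 1, -1, -1, 1]"
    using admissible_sign[OF ys] by blast
  note od = orthogonal_modules[OF c(1)]
  have sum_a: "1 + (- 1) + 0 = (0::complex)" and sum_b: "1 + 1 + (- 2) = (0::complex)" by simp_all
  note data_a = basis_data_II[OF sum_a refl independent_II_a]
  note data_b = basis_data_II[OF sum_b refl independent_II_b]
  note data_2 = basis_data_III[OF c(1)]
  have ess: "essential_part zs \<nu>\<^sub>a = [1, -1, 0]" "essential_part zs \<nu>\<^sub>b = [1, 1, -2]"
    unfolding essential_part_def zs by (simp_all add: L_nth)
  show ?thesis
  proof (intro exI conjI)
    show "orthogonal_decomposition E x [W\<^sub>0, gen \<nu>\<^sub>a, gen \<nu>\<^sub>b, gen (\<nu>\<^sub>2 c)]" by (rule od)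
    show "\<forall>i<4. \<forall>j<4. T_isomorphic E x ([W\<^sub>0, gen \<nu>\<^sub>a, gen \<nu>\<^sub>b, gen (\<nu>\<^sub>2 c)] ! i)
      ([W\<^sub>0, gen \<nu>\<^sub>a, gen \<nu>\<^sub>b, gen (\<nu>\<^sub>2 c)] ! j) \<longleftrightarrow> [1, 2, 2, 3 :: nat] ! i = [1, 2, 2, 3] ! j"
      by (rule isomorphic_modules[OF c(1)])
    show "module_data E x W\<^sub>0 0 1 6 5 [1, 1, 1, 1, 1, 1] (map (estar E x) [0, 1, 2, 3, 4, 5]) B_I
        [3, complex_of_real (sqrt 5), 1, 0, -2, - complex_of_real (sqrt 5)]"
      unfolding module_data_def
      using irreducibles(1) basis_data_I multiplicities(1)[OF od] represents_I eigenvalues_B_I by blast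
    show "is_seed E x (gen \<nu>\<^sub>a) zs [1, -1, 0] \<nu>\<^sub>a"
      unfolding is_seed_def data_a(1) using data_a(6-8) ess(1) by simp
    show "module_data E x (gen \<nu>\<^sub>a) 1 2 6 3 [1, 2, 2, 1] (basis_II E x \<nu>\<^sub>a) B_II
        [complex_of_real (sqrt 5), 1, 1, 0, -2, - complex_of_real (sqrt 5)]"
      unfolding module_data_def
      using irreducibles(2) data_a(1-5) multiplicities(2)[OF od] represents_II[OF sum_a] eigenvalues_B_II by blast
    show "is_seed E x (gen \<nu>\<^sub>b) zs [1, 1, -2] \<nu>\<^sub>b"
      unfolding is_seed_def data_b(1) using data_b(6-8) ess(2) by simp
    show "module_data E x (gen \<nu>\<^sub>b) 1 2 6 3 [1, 2, 2, 1] (basis_II E x \<nu>\<^sub>b) B_II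
        [complex_of_real (sqrt 5), 1, 1, 0, -2, - complex_of_real (sqrt 5)]"
      unfolding module_data_def
      using irreducibles(3) data_b(1-5) multiplicities(3)[OF od] represents_II[OF sum_b] eigenvalues_B_II by blast
    show "is_seed E x (gen (\<nu>\<^sub>2 c)) ys [1, -1, 1, -1, -1, 1] (\<nu>\<^sub>2 c)"
      unfolding is_seed_def data_2(1) using data_2(6-8) c(2) by simp
    show "module_data E x (gen (\<nu>\<^sub>2 c)) 2 1 2 1 [1, 1] (basis_III c) B_III [0, -2]"
      unfolding module_data_def
      using irreducibles(4)[OF c(1)] data_2(1-5) multiplicities(4)[OF od c(1)] represents_III eigenvalues_B_III
      by blast
  qed (simp_all add: coords)
qed

end

theorem mainTheorem9:
  fixes E :: "'v::finite \<Rightarrow> 'v \<Rightarrow> bool" and x :: 'v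
  assumes "dodecahedron_graph E"
  shows
    "let A = adj_matrix E; s5 = complex_of_real (sqrt 5) in
     has_spectrum A [(3, 1), (s5, 3), (1, 5), (0, 4), (-2, 4), (-s5, 3)] \<and>
     (\<exists>ys. admissible_ordering E x ys) \<and>
     (\<forall>zs ys. ordering_of zs (sphere_at E 1 x) \<and> admissible_ordering E x ys \<longrightarrow>
       (\<exists>W0 W1a W1b W2 \<nu>a \<nu>b \<nu>2.
          orthogonal_decomposition E x [W0, W1a, W1b, W2] \<and>
          (\<forall>i<4. \<forall>j<4. T_isomorphic E x ([W0, W1a, W1b, W2] ! i) ([W0, W1a, W1b, W2] ! j) \<longleftrightarrow>
             [1, 2, 2, 3 :: nat] ! i = [1, 2, 2, 3] ! j) \<and>
          module_data E x W0 0 1 6 5 [1, 1, 1, 1, 1, 1]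
            (map (estar E x) [0, 1, 2, 3, 4, 5]) B_I [3, s5, 1, 0, -2, -s5] \<and>
          is_seed E x W1a zs [1, -1, 0] \<nu>a \<and>
          A *v \<nu>a = Estar E x 2 *v (A *v \<nu>a) \<and>
          module_data E x W1a 1 2 6 3 [1, 2, 2, 1]
            (basis_II E x \<nu>a) B_II [s5, 1, 1, 0, -2, -s5] \<and>
          is_seed E x W1b zs [1, 1, -2] \<nu>b \<and>
          A *v \<nu>b = Estar E x 2 *v (A *v \<nu>b) \<and>
          module_data E x W1b 1 2 6 3 [1, 2, 2, 1]
            (basis_II E x \<nu>b) B_II [s5, 1, 1, 0, -2, -s5] \<and>
          is_seed E x W2 ys [1, -1, 1, -1, -1, 1] \<nu>2 \<and>
          module_data E x W2 2 1 2 1 [1, 1]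
            [\<nu>2, Estar E x 3 *v (A *v \<nu>2)] B_III [0, -2])) \<and>
     mat_space.dim (terwilliger E x) = 6^2 + 6^2 + 2^2 \<and>
     mat_space.dim (terwilliger E x) = 76"
proof -
  interpret dodecahedron E by (rule dodecahedron.intro[OF assms])
  \<comment> \<open>The spectrum, the existence of an admissible ordering and the dimension of
    \<open>T\<close> do not involve \<open>zs\<close>, so any labelling serves for them; the
    decomposition takes a labelling adapted to the given \<open>zs\<close>.\<close>
  obtain zs\<^sub>0 where "ordering_of zs\<^sub>0 (sphere_at E 1 x)"
    using finite_distinct_list[of "sphere_at E 1 x"] by (auto simp: ordering_of_def)
  then obtain vs\<^sub>0 where "dodecahedron_labelling E x vs\<^sub>0" using ex_labelling by blast
  then interpret vs\<^sub>0: labelled_dodecahedron E x vs\<^sub>0 by unfold_locales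
  have decomp: "\<exists>vs. labelled_dodecahedron E x vs \<and> zs = [vs ! 1, vs ! 2, vs ! 3]"
    if "ordering_of zs (sphere_at E 1 x)" for zs
    using ex_labelling[OF that] dodecahedron_axioms
    by (auto simp: labelled_dodecahedron_def labelled_dodecahedron_axioms_def)
  show ?thesis
    unfolding Let_def
  proof (intro conjI allI impI; (elim conjE)?)
    fix zs ys assume "ordering_of zs (sphere_at E 1 x)" and ys: "admissible_ordering E x ys"
    with decomp obtain vs where "labelled_dodecahedron E x vs" "zs = [vs ! 1, vs ! 2, vs ! 3]" by blast
    from labelled_dodecahedron.decomposition[OF this(1) ys this(2)]
    show "\<exists>W0 W1a W1b W2 \<nu>a \<nu>b \<nu>2.
          orthogonal_decomposition E x [W0, W1a, W1b, W2] \<and>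
          (\<forall>i<4. \<forall>j<4. T_isomorphic E x ([W0, W1a, W1b, W2] ! i) ([W0, W1a, W1b, W2] ! j) \<longleftrightarrow>
             [1, 2, 2, 3 :: nat] ! i = [1, 2, 2, 3] ! j) \<and>
          module_data E x W0 0 1 6 5 [1, 1, 1, 1, 1, 1]
            (map (estar E x) [0, 1, 2, 3, 4, 5]) B_I
            [3, complex_of_real (sqrt 5), 1, 0, -2, - complex_of_real (sqrt 5)] \<and>
          is_seed E x W1a zs [1, -1, 0] \<nu>a \<and>
          adj_matrix E *v \<nu>a = Estar E x 2 *v (adj_matrix E *v \<nu>a) \<and>
          module_data E x W1a 1 2 6 3 [1, 2, 2, 1] (basis_II E x \<nu>a) B_II
            [complex_of_real (sqrt 5), 1, 1, 0, -2, - complex_of_real (sqrt 5)] \<and>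
          is_seed E x W1b zs [1, 1, -2] \<nu>b \<and>
          adj_matrix E *v \<nu>b = Estar E x 2 *v (adj_matrix E *v \<nu>b) \<and>
          module_data E x W1b 1 2 6 3 [1, 2, 2, 1] (basis_II E x \<nu>b) B_II
            [complex_of_real (sqrt 5), 1, 1, 0, -2, - complex_of_real (sqrt 5)] \<and>
          is_seed E x W2 ys [1, -1, 1, -1, -1, 1] \<nu>2 \<and>
          module_data E x W2 2 1 2 1 [1, 1]
            [\<nu>2, Estar E x 3 *v (adj_matrix E *v \<nu>2)] B_III [0, -2]" .
  qed (use vs\<^sub>0.spectrum vs\<^sub>0.ex_admissible vs\<^sub>0.dim_T in simp_all)
qed

end
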